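(* Let $(X_0,X_1)$ be a Banach couple with continuous embedding $X_1\hookrightarrow X_0$. Let $$1<p<\infty,\qquad 0<\lambda<1,\qquad 0<T<\infty,\qquad \theta=1-\frac{1-\lambda}{p}.$$ Then the trace at $t=0$ of the Morrey evolution class is exactly $$\operatorname{Tr}_0\mathbb E^{p,\lambda}(0,T;X_0,X_1):=\{u(0):u\in\mathbb E^{p,\lambda}(0,T;X_0,X_1)\}=(X_0,X_1)_{\theta,\infty}.$$ More precisely, the trace map $\operatorname{Tr}_0:u\mapsto u(0)$ is bounded from $\mathbb E^{p,\lambda}(0,T;X_0,X_1)$, equipped with its natural norm, into $(X_0,X_1)_{\theta,\infty}$. Conversely, for every $x\in(X_0,X_1)_{\theta,\infty}$ there exists $u\in\mathbb E^{p,\lambda}(0,T;X_0,X_1)$ such that $u(0)=x$ in $X_0$, and $$\|u\|_{\mathcal M^{p,\lambda}(0,T;X_1)}+\|u'\|_{\mathcal M^{p,\lambda}(0,T;X_0)}\le C\|x\|_{(X_0,X_1)_{\theta,\infty}}.$$ The constant $C$ depends only on $p,\lambda,T$ and the embedding constant of $X_1\hookrightarrow X_0$.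
   Context: For a Banach space $X$, the time-Morrey space $\mathcal M^{p,\lambda}(0,T;X)$ consists of the (strongly measurable) functions $f:(0,T)\to X$ with finite norm $$\|f\|_{\mathcal M^{p,\lambda}(0,T;X)}:=\sup_{I\subset(0,T)}|I|^{-\lambda/p}\Bigl(\int_I\|f(t)\|_X^p\,dt\Bigr)^{1/p},$$ the supremum being over all intervals $I\subset(0,T)$. The Morrey evolution class is $\mathbb E^{p,\lambda}(0,T;X_0,X_1):=\{u: u\in\mathcal M^{p,\lambda}(0,T;X_1),\ u'=\partial_t u\in\mathcal M^{p,\lambda}(0,T;X_0)\}$, with the derivative understood in the sense of $X_0$-valued distributions; its natural norm is $\|u\|_{\mathcal M^{p,\lambda}(0,T;X_1)}+\|u'\|_{\mathcal M^{p,\lambda}(0,T;X_0)}$. Every $u$ in this class has an absolutely continuous $X_0$-valued representative on $[0,T]$, and $u(0)$ denotes the value at $0$ of this representative. A Banach couple is a pair of Banach spaces continuously embedded in a common Hausdorff topological vector space. For $x\in X_0+X_1$ and $r>0$, $$K(r,x;X_0,X_1):=\inf\{\|x_0\|_{X_0}+r\|x_1\|_{X_1}: x=x_0+x_1,\ x_0\in X_0,\ x_1\in X_1\}.$$ $(X_0,X_1)_{\theta,\infty}$ is the set of $x\in X_0+X_1$ with $\|x\|_{(X_0,X_1)_{\theta,\infty}}:=\sup_{r>0}r^{-\theta}K(r,x;X_0,X_1)<\infty$. *)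

theory Defs
  imports "HOL-Analysis.Analysis"
begin

text \<open>
  The Banach couple is given by two Banach spaces, the types \<open>'a\<close> (for \<open>X\<^sub>0\<close>) and \<open>'b\<close> (for
  \<open>X\<^sub>1\<close>), and an injective bounded linear map \<open>j :: 'b \<Rightarrow> 'a\<close>, the embedding of \<open>X\<^sub>1\<close>
  into \<open>X\<^sub>0\<close>. The ambient Hausdorff space is \<open>'a\<close> itself, and \<open>X\<^sub>0 + X\<^sub>1 = X\<^sub>0\<close>.
  The spaces need not be separable. The library's Bochner integral requires a second countable
  target, and there Borel measurability coincides with strong measurability; the two notions are
  therefore given here for arbitrary Banach spaces.
  Functions on \<open>(0,T)\<close> are total functions whose values outside \<open>(0,T)\<close> are irrelevant.
\<close>

definition strongly_measurable :: "'c measure \<Rightarrow> ('c \<Rightarrow> 'a::banach) \<Rightarrow> bool" where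
  "strongly_measurable M f \<longleftrightarrow>
     (\<exists>s. (\<forall>i::nat. simple_function M (s i)) \<and> (AE x in M. (\<lambda>i. s i x) \<longlonglongrightarrow> f x))"

text \<open>As \<^const>\<open>has_bochner_integral\<close>, with strong in place of Borel measurability.\<close>

definition has_strong_bochner_integral :: "'c measure \<Rightarrow> ('c \<Rightarrow> 'a::banach) \<Rightarrow> 'a \<Rightarrow> bool" where
  "has_strong_bochner_integral M f z \<longleftrightarrow>
     strongly_measurable M f \<and>
     (\<exists>s. (\<forall>i::nat. Bochner_Integration.simple_bochner_integrable M (s i)) \<and>
          (\<lambda>i. \<integral>\<^sup>+x. ennreal (norm (f x - s i x)) \<partial>M) \<longlonglongrightarrow> 0 \<and>
          (\<lambda>i. Bochner_Integration.simple_bochner_integral M (s i)) \<longlonglongrightarrow> z)"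

text \<open>Real powers on \<open>[0,\<infinity>]\<close>, for positive exponents.\<close>

definition enn_powr :: "ennreal \<Rightarrow> real \<Rightarrow> ennreal" where
  "enn_powr x a = (if x = \<infinity> then \<infinity> else ennreal (enn2real x powr a))"

text \<open>The supremum is over the intervals of positive length, as \<open>|I|\<close> occurs with a negative
  power.\<close>

definition morrey_norm :: "real \<Rightarrow> real \<Rightarrow> real \<Rightarrow> (real \<Rightarrow> 'a::banach) \<Rightarrow> ennreal" where
  "morrey_norm p l T f =
     (SUP I \<in> {I. is_interval I \<and> I \<subseteq> {0<..<T} \<and> 0 < measure lebesgue I}.
        ennreal (measure lebesgue I powr (- (l / p))) *
        enn_powr (\<integral>\<^sup>+t\<in>I. ennreal (norm (f t) powr p) \<partial>lebesgue) (1 / p))"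

definition morrey_space :: "real \<Rightarrow> real \<Rightarrow> real \<Rightarrow> (real \<Rightarrow> 'a::banach) set" where
  "morrey_space p l T =
     {f. strongly_measurable (lebesgue_on {0<..<T}) f \<and> morrey_norm p l T f < \<infinity>}"

definition test_function :: "real \<Rightarrow> (real \<Rightarrow> real) \<Rightarrow> bool" where
  "test_function T \<phi> \<longleftrightarrow>
     (\<forall>n. (deriv ^^ n) \<phi> differentiable_on UNIV) \<and>
     compact (closure {t. \<phi> t \<noteq> 0}) \<and> closure {t. \<phi> t \<noteq> 0} \<subseteq> {0<..<T}"

definition has_weak_derivative :: "real \<Rightarrow> (real \<Rightarrow> 'a::banach) \<Rightarrow> (real \<Rightarrow> 'a) \<Rightarrow> bool" where
  "has_weak_derivative T w v \<longleftrightarrow>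
     (\<forall>\<phi>. test_function T \<phi> \<longrightarrow>
        (\<exists>z. has_strong_bochner_integral (lebesgue_on {0<..<T}) (\<lambda>t. deriv \<phi> t *\<^sub>R w t) z \<and>
             has_strong_bochner_integral (lebesgue_on {0<..<T}) (\<lambda>t. \<phi> t *\<^sub>R v t) (- z)))"

definition evolution_space ::
    "real \<Rightarrow> real \<Rightarrow> real \<Rightarrow> ('b::banach \<Rightarrow> 'a::banach) \<Rightarrow> (real \<Rightarrow> 'b) set" where
  "evolution_space p l T j =
     {u \<in> morrey_space p l T. \<exists>v \<in> morrey_space p l T. has_weak_derivative T (\<lambda>t. j (u t)) v}"

definition absolutely_continuous_Icc :: "real \<Rightarrow> real \<Rightarrow> (real \<Rightarrow> 'a::banach) \<Rightarrow> bool" where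
  "absolutely_continuous_Icc c d w \<longleftrightarrow>
     (\<forall>\<epsilon>>0. \<exists>\<delta>>0. \<forall>(n::nat) a b.
        (\<forall>i<n. c \<le> a i \<and> a i \<le> b i \<and> b i \<le> d) \<and>
        (\<forall>i<n. \<forall>k<n. i \<noteq> k \<longrightarrow> {a i<..<b i} \<inter> {a k<..<b k} = {}) \<and>
        (\<Sum>i<n. b i - a i) < \<delta> \<longrightarrow>
        (\<Sum>i<n. norm (w (b i) - w (a i))) < \<epsilon>)"

text \<open>The value at \<open>0\<close> of the absolutely continuous \<open>X\<^sub>0\<close>-valued representative of \<open>u\<close>.\<close>

definition trace0 :: "real \<Rightarrow> ('b::banach \<Rightarrow> 'a::banach) \<Rightarrow> (real \<Rightarrow> 'b) \<Rightarrow> 'a" where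
  "trace0 T j u =
     (THE x. \<exists>w. absolutely_continuous_Icc 0 T w \<and>
                 (AE t in lebesgue_on {0<..<T}. w t = j (u t)) \<and> w 0 = x)"

definition K_functional :: "('b::banach \<Rightarrow> 'a::banach) \<Rightarrow> real \<Rightarrow> 'a \<Rightarrow> real" where
  "K_functional j r x = Inf {norm x0 + r * norm x1 | x0 x1. x = x0 + j x1}"

definition interpolation_norm :: "('b::banach \<Rightarrow> 'a::banach) \<Rightarrow> real \<Rightarrow> 'a \<Rightarrow> ennreal" where
  "interpolation_norm j \<theta> x = (SUP r\<in>{0<..}. ennreal (r powr (- \<theta>) * K_functional j r x))"

definition interpolation_space :: "('b::banach \<Rightarrow> 'a::banach) \<Rightarrow> real \<Rightarrow> 'a set" where
  "interpolation_space j \<theta> = {x. interpolation_norm j \<theta> x < \<infinity>}"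

text \<open>
  The constant of the extension estimate has to be uniform over all Banach couples (with the given
  embedding constant). As HOL cannot quantify over types inside a formula, a constant claimed to
  exist by \<open>\<exists>C\<close> could depend on the spaces \<open>'a\<close> and \<open>'b\<close>. Uniformity is expressed by a closed
  term instead; it happens to depend only on \<open>p\<close> and \<open>\<lambda>\<close>. It arises from a piecewise linear \<open>u\<close>
  interpolating near-optimal decompositions of \<open>x\<close> at the points \<open>T / 2^k\<close>: pointwise,
  \<open>4 t\<^bsup>\<theta>-1\<^esup>\<close> bounds \<open>u\<close>, \<open>8 t\<^bsup>\<theta>-1\<^esup>\<close> bounds \<open>u'\<close> (times the norm of \<open>x\<close>),
  and \<open>t\<^bsup>\<theta>-1\<^esup>\<close> has Morrey norm at most \<open>\<lambda>\<^bsup>-1/p\<^esup>\<close>.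
\<close>

definition extension_constant :: "real \<Rightarrow> real \<Rightarrow> real" where
  "extension_constant p l = 12 * l powr (- (1 / p))"

end

theory Submission
  imports Defs "HOL-Analysis.Analysis"
begin

text \<open>
  Let \<open>y = j u\<close> have the weak derivative \<open>v\<close>. Testing against smoothed versions of
  \<open>\<Phi>(\<tau>) = |(s,s+h] \<inter> (-\<infinity>,\<tau>]| / h - |(t,t+h'] \<inter> (-\<infinity>,\<tau>]| / h'\<close> shows that the means of \<open>y\<close> over \<open>(s,s+h]\<close>
  and \<open>(t,t+h']\<close> differ by at most \<open>\<integral>\<parallel>v\<parallel>\<close> over the hull of these intervals. Hence the means converge to a
  function \<open>w\<close> with \<open>\<parallel>w t - w s\<parallel> \<le> \<integral>\<^bsub>s\<^esub>\<^bsup>t\<^esup> \<parallel>v\<parallel>\<close>, and the primitive of \<open>y - w\<close> has derivative \<open>0\<close>,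
  so that \<open>w = y\<close> almost everywhere: \<open>w\<close> is the absolutely continuous representative.
  For \<open>r \<le> T\<close>, choose \<open>t \<in> (0,r)\<close> with \<open>\<parallel>u t\<parallel>\<close> at most twice its \<open>L\<^sup>p\<close>-mean over \<open>(0,r)\<close>; then
  \<open>w 0 = (w 0 - w t) + j (u t)\<close> is a decomposition which bounds \<open>K(r, w 0)\<close> by a multiple of \<open>r\<^bsup>\<theta>\<^esup>\<close>.
  Conversely, near-optimal decompositions of \<open>x\<close> at the scales \<open>T / 2\<^sup>k\<close> are interpolated linearly.
\<close>

section \<open>The strong Bochner integral\<close>

text \<open>\<open>v\<close> is never integrated by itself: the trace bound quantifies over every
  weak derivative, and of such a \<open>v\<close> only the products with test functions are known to
  be integrable. All control therefore runs through the scalar primitive \<open>g\<close> of the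
  norm of \<open>v\<close>, and the representative is built from means of \<open>y\<close>.
  Continuity of \<open>g\<close> also gives derivative 0 of the primitive of \<open>y - w\<close> at
  every point of (0,T), which spares a differentiation theorem for almost every point. The spaces
  may be nonseparable, so strong measurability is handled through simple approximations; these
  converge only almost everywhere, and completeness of Lebesgue measure makes their norms
  measurable. The exponent comes from scaling: by \<open>(\<theta> - 1) * p = l - 1\<close>, a
  function of size t^(\<theta>-1) has a p-th power integral of order r^l over (0,r), exactly the
  Morrey growth, and its own integral over (0,r) is of order r^\<theta>. The same two powers bound
  the two parts of a decomposition at scale r, as growth r^\<theta> of the K-functional
  requires.\<close>

lemma (in complete_measure) borel_measurable_AE_eq:
  assumes f: "f \<in> borel_measurable M" and ae: "AE x in M. f x = g x"
  shows "g \<in> borel_measurable M"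
proof (rule measurableI)
  fix A :: "'b set" assume "A \<in> sets borel"
  then have A: "f -` A \<inter> space M \<in> sets M"
    using f by (rule measurable_sets[rotated])
  have ae': "AE x in M. x \<in> f -` A \<inter> space M \<longleftrightarrow> x \<in> g -` A \<inter> space M"
    using ae by eventually_elim auto
  show "g -` A \<inter> space M \<in> sets M"
    by (rule in_sets_AE[OF ae' A]) auto
qed simp

lemma const_divide_LIMSEQ: "(\<lambda>n. c / real (n + k)) \<longlonglongrightarrow> 0"
  by (intro tendsto_divide_0[OF tendsto_const] filterlim_at_top_imp_at_infinity
      filterlim_compose[OF filterlim_real_sequentially] filterlim_add_const_nat_at_top)

lemma finite_measure_Ioo: "finite_measure (lebesgue_on {a<..<b :: real})"
  by (rule finite_measure_lebesgue_on) simp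

text \<open>A null set of the restriction is one of the complete measure, so its subsets are
  measurable there and lie in \<open>S\<close>. This opens the context
  \<open>complete_measure\<close> for (0,T).\<close>

lemma complete_measure_lebesgue_on:
  assumes "S \<in> sets lebesgue" shows "complete_measure (lebesgue_on S)"
proof
  fix A B assume "B \<subseteq> A" "A \<in> null_sets (lebesgue_on S)"
  then have "A \<in> null_sets lebesgue" "A \<subseteq> S"
    using assms by (auto simp: null_sets_restrict_space)
  then have "B \<in> null_sets lebesgue" "B \<subseteq> S"
    using \<open>B \<subseteq> A\<close> completion.complete2 by (blast, blast)
  then show "B \<in> sets (lebesgue_on S)"
    using assms by (auto simp: sets_restrict_space_iff)
qed

section \<open>Closure properties of strong measurability\<close>

text \<open>Simple functions are stable under pointwise composition, and joint sequential continuity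
  of \<open>h\<close> carries the almost everywhere limits along. Taking \<open>h\<close> to be
  \<open>+\<close>, \<open>-\<close> or \<open>*\<^sub>R\<close>, or letting it ignore its second
  argument, gives the rules below.\<close>

lemma strongly_measurable_compose2:
  assumes "strongly_measurable M f" "strongly_measurable M g"
    and h: "\<And>s t a b. s \<longlonglongrightarrow> a \<Longrightarrow> t \<longlonglongrightarrow> b \<Longrightarrow> (\<lambda>i::nat. h (s i) (t i)) \<longlonglongrightarrow> h a b"
  shows "strongly_measurable M (\<lambda>x. h (f x) (g x))"
proof -
  obtain s t where s: "\<And>i::nat. simple_function M (s i)" "AE x in M. (\<lambda>i. s i x) \<longlonglongrightarrow> f x"
    and t: "\<And>i::nat. simple_function M (t i)" "AE x in M. (\<lambda>i. t i x) \<longlonglongrightarrow> g x"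
    using assms(1,2) unfolding strongly_measurable_def by blast
  have "AE x in M. (\<lambda>i. h (s i x) (t i x)) \<longlonglongrightarrow> h (f x) (g x)"
    using s(2) t(2) by eventually_elim (rule h)
  moreover have "simple_function M (\<lambda>x. h (s i x) (t i x))" for i
    using s(1) t(1) by (rule simple_function_compose2)
  ultimately show ?thesis
    unfolding strongly_measurable_def by (intro exI[of _ "\<lambda>i x. h (s i x) (t i x)"]) auto
qed

lemma strongly_measurable_AE_cong:
  assumes "strongly_measurable M f" and "AE x in M. f x = g x"
  shows "strongly_measurable M g"
proof -
  obtain s where s: "\<And>i::nat. simple_function M (s i)" "AE x in M. (\<lambda>i. s i x) \<longlonglongrightarrow> f x"
    using assms(1) unfolding strongly_measurable_def by blast
  have "AE x in M. (\<lambda>i. s i x) \<longlonglongrightarrow> g x"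
    using s(2) assms(2) by eventually_elim auto
  with s(1) show ?thesis unfolding strongly_measurable_def by blast
qed

lemma strongly_measurable_const: "strongly_measurable M (\<lambda>x. c)"
  unfolding strongly_measurable_def by (intro exI[of _ "\<lambda>i x. c"]) auto

lemma strongly_measurable_add:
  "strongly_measurable M f \<Longrightarrow> strongly_measurable M g \<Longrightarrow> strongly_measurable M (\<lambda>x. f x + g x)"
  by (rule strongly_measurable_compose2[where h = "(+)"]) (auto intro: tendsto_add)

lemma strongly_measurable_diff:
  "strongly_measurable M f \<Longrightarrow> strongly_measurable M g \<Longrightarrow> strongly_measurable M (\<lambda>x. f x - g x)"
  by (rule strongly_measurable_compose2[where h = "(-)"]) (auto intro: tendsto_diff)

lemma strongly_measurable_bounded_linear:
  assumes "bounded_linear h" "strongly_measurable M f"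
  shows "strongly_measurable M (\<lambda>x. h (f x))"
  by (rule strongly_measurable_compose2[where h = "\<lambda>a b. h a", OF assms(2,2)])
     (rule bounded_linear.tendsto[OF assms(1)])

lemma borel_measurable_imp_strongly_measurable:
  fixes g :: "_ \<Rightarrow> real"
  assumes "g \<in> borel_measurable M" shows "strongly_measurable M g"
  using borel_measurable_implies_sequence_metric[OF assms, of 0]
  unfolding strongly_measurable_def by (blast intro: AE_I2)

lemma strongly_measurable_scaleR:
  fixes g :: "_ \<Rightarrow> real"
  assumes "g \<in> borel_measurable M" "strongly_measurable M f"
  shows "strongly_measurable M (\<lambda>x. g x *\<^sub>R f x)"
  using borel_measurable_imp_strongly_measurable[OF assms(1)] assms(2)
  by (rule strongly_measurable_compose2[where h = "(*\<^sub>R)"]) (auto intro: tendsto_scaleR)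

text \<open>The limit exists only almost everywhere, so \<open>lim\<close> serves as a total
  measurable substitute; completeness then moves measurability from it to the norm of
  \<open>f\<close>.\<close>

lemma (in complete_measure) strongly_measurable_norm:
  assumes "strongly_measurable M f"
  shows "(\<lambda>x. norm (f x)) \<in> borel_measurable M"
proof -
  obtain s where s: "\<And>i::nat. simple_function M (s i)" "AE x in M. (\<lambda>i. s i x) \<longlonglongrightarrow> f x"
    using assms unfolding strongly_measurable_def by blast
  have "simple_function M (\<lambda>x. norm (s i x))" for i
    using s(1) by (rule simple_function_compose1)
  then have "(\<lambda>x. lim (\<lambda>i. norm (s i x))) \<in> borel_measurable M"
    by (intro borel_measurable_lim_metric borel_measurable_simple_function)
  moreover have "AE x in M. lim (\<lambda>i. norm (s i x)) = norm (f x)"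
    using s(2) by eventually_elim (simp add: limI tendsto_norm)
  ultimately show ?thesis by (rule borel_measurable_AE_eq)
qed

section \<open>Integrability criterion and construction of the integral\<close>

abbreviation "sb_integrable \<equiv> Bochner_Integration.simple_bochner_integrable"
abbreviation "sb_integral \<equiv> Bochner_Integration.simple_bochner_integral"

abbreviation L1_norm :: "'c measure \<Rightarrow> ('c \<Rightarrow> 'a::banach) \<Rightarrow> ennreal" where
  "L1_norm M f \<equiv> \<integral>\<^sup>+x. ennreal (norm (f x)) \<partial>M"

text \<open>Bochner's criterion taken as the definition; that it yields an integral is
  \<open>has_strong_integral\<close>.\<close>

definition strongly_integrable :: "'c measure \<Rightarrow> ('c \<Rightarrow> 'a::banach) \<Rightarrow> bool" where
  "strongly_integrable M f \<longleftrightarrow> strongly_measurable M f \<and> L1_norm M f < \<infinity>"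

definition strong_integral :: "'c measure \<Rightarrow> ('c \<Rightarrow> 'a::banach) \<Rightarrow> 'a" where
  "strong_integral M f = (THE z. has_strong_bochner_integral M f z)"

lemma strongly_integrableD:
  "strongly_integrable M f \<Longrightarrow> strongly_measurable M f"
  by (simp add: strongly_integrable_def)

context complete_measure
begin

lemma strongly_integrable_norm:
  assumes "strongly_integrable M f" shows "integrable M (\<lambda>x. norm (f x))"
  using assms strongly_measurable_norm
  by (intro integrableI_bounded) (auto simp: strongly_integrable_def)

lemma strongly_integrableI:
  fixes g :: "'a \<Rightarrow> real"
  assumes f: "strongly_measurable M f" and g: "integrable M g"
    and le: "AE x in M. norm (f x) \<le> g x"
  shows "strongly_integrable M f"
proof -
  have "integrable M (\<lambda>x. norm (f x))"
    by (rule Bochner_Integration.integrable_bound[OF g])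
      (use le strongly_measurable_norm[OF f] in auto)
  then show ?thesis
    using f by (simp add: strongly_integrable_def integrable_iff_bounded)
qed

lemma L1_norm_eq:
  assumes "strongly_integrable M f"
  shows "L1_norm M f = ennreal (\<integral>x. norm (f x) \<partial>M)"
  by (rule nn_integral_eq_integral[OF strongly_integrable_norm[OF assms]]) simp

lemma strongly_integrable_diff:
  assumes "strongly_integrable M f" "strongly_integrable M g"
  shows "strongly_integrable M (\<lambda>x. f x - g x)"
proof (rule strongly_integrableI[where g = "\<lambda>x. norm (f x) + norm (g x)"])
  show "strongly_measurable M (\<lambda>x. f x - g x)"
    by (intro strongly_measurable_diff strongly_integrableD assms)
  show "integrable M (\<lambda>x. norm (f x) + norm (g x))"
    using assms[THEN strongly_integrable_norm] by simp
qed (simp add: norm_triangle_ineq4)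

lemma strongly_integrable_bounded_mult:
  fixes g :: "'a \<Rightarrow> real"
  assumes f: "strongly_integrable M f" and g: "g \<in> borel_measurable M" "\<And>x. \<bar>g x\<bar> \<le> C"
  shows "strongly_integrable M (\<lambda>x. g x *\<^sub>R f x)"
proof (rule strongly_integrableI[where g = "\<lambda>x. C * norm (f x)"])
  show "strongly_measurable M (\<lambda>x. g x *\<^sub>R f x)"
    by (intro strongly_measurable_scaleR strongly_integrableD f g)
  show "integrable M (\<lambda>x. C * norm (f x))"
    using strongly_integrable_norm[OF f] by simp
  show "AE x in M. norm (g x *\<^sub>R f x) \<le> C * norm (f x)"
    by (intro AE_I2) (simp add: mult_right_mono[OF g(2)])
qed

lemma strongly_integrable_indicator:
  assumes "strongly_integrable M f" and "A \<inter> space M \<in> sets M"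
  shows "strongly_integrable M (\<lambda>x. indicat_real A x *\<^sub>R f x)"
proof -
  have 1: "indicat_real A \<in> borel_measurable M"
    using assms(2) borel_measurable_indicator_iff by blast
  have 2: "\<bar>indicat_real A x\<bar> \<le> 1" for x
    by (cases "x \<in> A") simp_all
  show ?thesis
    by (rule strongly_integrable_bounded_mult[OF assms(1) 1 2])
qed

lemma simple_function_borel_norm:
  "simple_function M s \<Longrightarrow> (\<lambda>x. norm (s x)) \<in> borel_measurable M" for s :: "'a \<Rightarrow> 'c::banach"
  by (intro borel_measurable_simple_function simple_function_compose1[where g = norm])

lemma simple_bochner_integral_norm_le:
  fixes s :: "'a \<Rightarrow> 'c::banach"
  assumes s: "sb_integrable M s"
  shows "ennreal (norm (sb_integral M s)) \<le> L1_norm M s"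
proof -
  have "ennreal (norm (sb_integral M s))
      \<le> ennreal (sb_integral M (\<lambda>x. norm (s x)))"
    by (rule ennreal_leI[OF simple_bochner_integral_norm_bound[OF s]])
  also have "\<dots> = L1_norm M s"
    by (rule simple_bochner_integral_eq_nn_integral)
       (auto intro: simple_bochner_integrable_compose2[where p = "\<lambda>a b. norm a", OF _ s s])
  finally show ?thesis .
qed

lemma strongly_measurable_simple:
  "simple_function M s \<Longrightarrow> strongly_measurable M s" for s :: "'a \<Rightarrow> 'c::banach"
  unfolding strongly_measurable_def by (intro exI[of _ "\<lambda>i. s"]) auto

text \<open>The simple approximants satisfy the bound up to their error in L1, which vanishes in the
  limit. Applied to a difference it gives uniqueness, and applied to a test function times
  \<open>v\<close> it gives the basic estimate of the means.\<close>

lemma has_strong_bochner_integral_norm_le: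
  assumes "has_strong_bochner_integral M f z"
  shows "ennreal (norm z) \<le> L1_norm M f"
proof -
  from assms obtain s where f: "strongly_measurable M f"
    and s: "\<And>i::nat. sb_integrable M (s i)"
    and lim: "(\<lambda>i. L1_norm M (\<lambda>x. f x - s i x)) \<longlonglongrightarrow> 0"
      "(\<lambda>i. sb_integral M (s i)) \<longlonglongrightarrow> z"
    unfolding has_strong_bochner_integral_def by blast
  have sf: "simple_function M (s i)" for i
    using s[of i] by (auto elim: simple_bochner_integrable.cases)
  have "(\<lambda>x. norm (f x - s i x)) \<in> borel_measurable M" for i
    by (intro strongly_measurable_norm strongly_measurable_diff f
        strongly_measurable_simple sf)
  note [measurable] = this strongly_measurable_norm[OF f]
  have le: "ennreal (norm (sb_integral M (s i)))
      \<le> L1_norm M f + L1_norm M (\<lambda>x. f x - s i x)" for i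
  proof -
    have "L1_norm M (s i)
      \<le> (\<integral>\<^sup>+x. ennreal (norm (f x)) + ennreal (norm (f x - s i x)) \<partial>M)"
      using norm_triangle_sub[of "s i _" "f _"]
      by (intro nn_integral_mono) (simp flip: ennreal_plus add: norm_minus_commute)
    also have "\<dots> = L1_norm M f + L1_norm M (\<lambda>x. f x - s i x)"
      by (rule nn_integral_add) auto
    finally show ?thesis
      using simple_bochner_integral_norm_le[OF s] order_trans by blast
  qed
  have l1: "(\<lambda>i. ennreal (norm (sb_integral M (s i)))) \<longlonglongrightarrow> ennreal (norm z)"
    by (intro tendsto_ennrealI tendsto_norm lim)
  have l2: "(\<lambda>i. L1_norm M f + L1_norm M (\<lambda>x. f x - s i x))
      \<longlonglongrightarrow> L1_norm M f + 0"
    by (intro tendsto_add tendsto_const lim)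
  show ?thesis
    using LIMSEQ_le[OF l1 l2] le by simp
qed

text \<open>One rule for all linear operations: \<open>c = 1\<close> gives sums,
  \<open>c = - 1\<close> differences, and \<open>f = 0\<close> scalar multiples.\<close>

lemma has_strong_bochner_integral_scaleR_add:
  assumes "has_strong_bochner_integral M f y" "has_strong_bochner_integral M g z"
  shows "has_strong_bochner_integral M (\<lambda>x. f x + c *\<^sub>R g x) (y + c *\<^sub>R z)"
proof -
  from assms obtain s t where f: "strongly_measurable M f" and g: "strongly_measurable M g"
    and s: "\<And>i::nat. sb_integrable M (s i)"
      "(\<lambda>i. L1_norm M (\<lambda>x. f x - s i x)) \<longlonglongrightarrow> 0"
      "(\<lambda>i. sb_integral M (s i)) \<longlonglongrightarrow> y"
    and t: "\<And>i::nat. sb_integrable M (t i)"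
      "(\<lambda>i. L1_norm M (\<lambda>x. g x - t i x)) \<longlonglongrightarrow> 0"
      "(\<lambda>i. sb_integral M (t i)) \<longlonglongrightarrow> z"
    unfolding has_strong_bochner_integral_def by blast
  have sf: "simple_function M (s i)" "simple_function M (t i)" for i
    using s(1)[of i] t(1)[of i] by (auto elim: simple_bochner_integrable.cases)
  have "(\<lambda>x. norm (f x - s i x)) \<in> borel_measurable M"
    "(\<lambda>x. norm (g x - t i x)) \<in> borel_measurable M" for i
    by (intro strongly_measurable_norm strongly_measurable_diff f g
        strongly_measurable_simple sf)+
  note [measurable] = this
  have le: "L1_norm M (\<lambda>x. f x + c *\<^sub>R g x - (s i x + c *\<^sub>R t i x))
      \<le> L1_norm M (\<lambda>x. f x - s i x) + ennreal \<bar>c\<bar> * L1_norm M (\<lambda>x. g x - t i x)" for i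
  proof -
    have "norm (f x + c *\<^sub>R g x - (s i x + c *\<^sub>R t i x)) \<le> norm (f x - s i x) + \<bar>c\<bar> * norm (g x - t i x)" for x
    proof -
      have "f x + c *\<^sub>R g x - (s i x + c *\<^sub>R t i x) = (f x - s i x) + c *\<^sub>R (g x - t i x)"
        by (simp add: algebra_simps)
      then show ?thesis by (metis norm_triangle_ineq norm_scaleR)
    qed
    then have "L1_norm M (\<lambda>x. f x + c *\<^sub>R g x - (s i x + c *\<^sub>R t i x))
      \<le> (\<integral>\<^sup>+x. ennreal (norm (f x - s i x)) + ennreal \<bar>c\<bar> * ennreal (norm (g x - t i x)) \<partial>M)"
      by (intro nn_integral_mono) (simp flip: ennreal_plus ennreal_mult)
    also have "\<dots> = L1_norm M (\<lambda>x. f x - s i x) + ennreal \<bar>c\<bar> * L1_norm M (\<lambda>x. g x - t i x)"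
      by (simp add: nn_integral_add nn_integral_cmult)
    finally show ?thesis .
  qed
  have bound: "(\<lambda>i. L1_norm M (\<lambda>x. f x - s i x) + ennreal \<bar>c\<bar> * L1_norm M (\<lambda>x. g x - t i x))
      \<longlonglongrightarrow> 0 + ennreal \<bar>c\<bar> * 0"
    by (intro tendsto_add s ennreal_tendsto_cmult t) simp
  have "(\<lambda>i. L1_norm M (\<lambda>x. f x + c *\<^sub>R g x - (s i x + c *\<^sub>R t i x))) \<longlonglongrightarrow> 0"
    by (rule tendsto_sandwich[OF _ _ tendsto_const bound[simplified]]) (simp_all add: le)
  moreover have ti: "sb_integrable M (\<lambda>x. c *\<^sub>R t i x)" for i
    by (rule simple_bochner_integrable_compose2[where p = "\<lambda>a b. c *\<^sub>R a", OF _ t(1) t(1)]) simp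
  then have "sb_integrable M (\<lambda>x. s i x + c *\<^sub>R t i x)" for i
    by (intro simple_bochner_integrable_compose2[where p = "(+)"] s) simp_all
  moreover have "sb_integral M (\<lambda>x. s i x + c *\<^sub>R t i x)
    = sb_integral M (s i) + c *\<^sub>R sb_integral M (t i)" for i
    by (simp add: simple_bochner_integral_add[OF s(1) ti] simple_bochner_integral_linear[OF linear_scaleR t(1)])
  moreover have "strongly_measurable M (\<lambda>x. f x + c *\<^sub>R g x)"
    by (intro strongly_measurable_add strongly_measurable_scaleR f g) simp
  ultimately show ?thesis
    unfolding has_strong_bochner_integral_def using s(3) t(3)
    by (intro conjI exI[of _ "\<lambda>i x. s i x + c *\<^sub>R t i x"]) (auto intro!: tendsto_intros)
qed

lemma has_strong_bochner_integral_unique: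
  assumes "has_strong_bochner_integral M f y" "has_strong_bochner_integral M f z"
  shows "y = z"
proof -
  have "ennreal (norm (y - z)) \<le> 0"
    using has_strong_bochner_integral_norm_le[OF has_strong_bochner_integral_scaleR_add[OF assms, of "-1"]]
    by simp
  then show ?thesis by simp
qed

lemma strong_integral_eq:
  "has_strong_bochner_integral M f z \<Longrightarrow> strong_integral M f = z"
  unfolding strong_integral_def using has_strong_bochner_integral_unique by blast

lemma strongly_integrable_approx:
  assumes "strongly_integrable M f"
  obtains s where "\<And>i::nat. sb_integrable M (s i)"
    "(\<lambda>i. L1_norm M (\<lambda>x. f x - s i x)) \<longlonglongrightarrow> 0"
proof -
  obtain r where r: "\<And>i::nat. simple_function M (r i)" "AE x in M. (\<lambda>i. r i x) \<longlonglongrightarrow> f x"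
    using strongly_integrableD[OF assms] unfolding strongly_measurable_def by blast
  have fin: "L1_norm M f < \<infinity>"
    using assms by (simp add: strongly_integrable_def)
  note [measurable] = strongly_measurable_norm[OF strongly_integrableD[OF assms]]
    simple_function_borel_norm[OF r(1)]
  \<comment> \<open>Cutting off where the approximant exceeds twice \<open>f\<close> gives the
    dominating function \<open>3 * norm (f x)\<close>. Where \<open>f x\<close> is nonzero, the
    factor 2 leaves the approximants eventually unchanged; where \<open>f x = 0\<close>, the cut
    makes them vanish.\<close>
  define s where "s i x = indicat_real {x\<in>space M. norm (r i x) \<le> 2 * norm (f x)} x *\<^sub>R r i x" for i x
  have sf: "simple_function M (s i)" for i
    unfolding s_def by (intro simple_function_compose2[where h = "(*\<^sub>R)"] r simple_function_indicator) measurable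
  have s_le: "norm (s i x) \<le> 2 * norm (f x)" for i x
    by (simp add: s_def indicator_def)
  have "L1_norm M (s i) < \<infinity>" for i
  proof -
    have "L1_norm M (s i) \<le> (\<integral>\<^sup>+x. 2 * ennreal (norm (f x)) \<partial>M)"
      using s_le by (intro nn_integral_mono) (simp flip: ennreal_numeral ennreal_mult)
    also have "\<dots> < \<infinity>" using fin by (simp add: nn_integral_cmult ennreal_mult_less_top)
    finally show ?thesis .
  qed
  then have "sb_integrable M (s i)" for i
    by (intro simple_bochner_integrableI_bounded sf)
  moreover have "(\<lambda>i. L1_norm M (\<lambda>x. f x - s i x)) \<longlonglongrightarrow> (\<integral>\<^sup>+x. 0 \<partial>M)"
  proof (rule nn_integral_dominated_convergence[where w = "\<lambda>x. 3 * ennreal (norm (f x))"])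
    show "(\<lambda>x. ennreal (norm (f x - s i x))) \<in> borel_measurable M" for i
      by (intro measurable_compose[OF _ measurable_ennreal] strongly_measurable_norm
          strongly_measurable_diff strongly_integrableD assms strongly_measurable_simple sf)
    have "norm (f x - s i x) \<le> 3 * norm (f x)" for i x
      using norm_triangle_ineq4[of "f x" "s i x"] s_le[of i x] by simp
    then show "AE x in M. ennreal (norm (f x - s i x)) \<le> 3 * ennreal (norm (f x))" for i
      by (simp flip: ennreal_numeral ennreal_mult)
    show "(\<integral>\<^sup>+x. 3 * ennreal (norm (f x)) \<partial>M) < \<infinity>"
      using fin by (simp add: nn_integral_cmult ennreal_mult_less_top)
    show "AE x in M. (\<lambda>i. ennreal (norm (f x - s i x))) \<longlonglongrightarrow> 0"
      using r(2) AE_space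
    proof eventually_elim
      case (elim x)
      have "(\<lambda>i. s i x) \<longlonglongrightarrow> f x"
      proof (cases "f x = 0")
        case True
        then have "s i x = 0" for i using s_le[of i x] by simp
        with True show ?thesis by simp
      next
        case False
        have "\<forall>\<^sub>F i in sequentially. norm (r i x) < 2 * norm (f x)"
          by (rule order_tendstoD(2)[OF tendsto_norm[OF elim(1)]]) (use False in simp)
        then have "\<forall>\<^sub>F i in sequentially. r i x = s i x"
          by eventually_elim (use elim(2) in \<open>simp add: s_def\<close>)
        then show ?thesis using elim(1) by (rule Lim_transform_eventually[rotated])
      qed
      then have "(\<lambda>i. norm (f x - s i x)) \<longlonglongrightarrow> norm (f x - f x)"
        by (intro tendsto_intros)
      then show ?case using tendsto_ennrealI by fastforce
    qed
  qed auto
  ultimately show ?thesis using that[of s] by simp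
qed

text \<open>Integrals of approximants form a Cauchy sequence, as two of them differ by at most the
  sum of their errors in L1. Completeness of the target space then provides the value.\<close>

lemma has_strong_integral:
  assumes "strongly_integrable M f"
  shows "has_strong_bochner_integral M f (strong_integral M f)"
proof -
  obtain s where s: "\<And>i::nat. sb_integrable M (s i)"
    "(\<lambda>i. L1_norm M (\<lambda>x. f x - s i x)) \<longlonglongrightarrow> 0"
    using strongly_integrable_approx[OF assms] by blast
  let ?I = "\<lambda>i. sb_integral M (s i)"
  let ?E = "\<lambda>i. L1_norm M (\<lambda>x. f x - s i x)"
  have sf: "simple_function M (s i)" for i
    using s(1)[of i] by (auto elim: simple_bochner_integrable.cases)
  have [measurable]: "(\<lambda>x. norm (f x - s i x)) \<in> borel_measurable M" for i
    by (intro strongly_measurable_norm strongly_measurable_diff strongly_integrableD assms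
        strongly_measurable_simple sf)
  have le: "ennreal (norm (?I m - ?I n)) \<le> ?E m + ?E n" for m n
  proof -
    have "ennreal (norm (?I m - ?I n)) = ennreal (norm (sb_integral M (\<lambda>x. s m x - s n x)))"
      by (simp add: simple_bochner_integral_diff[OF s(1) s(1)])
    also have "\<dots> \<le> L1_norm M (\<lambda>x. s m x - s n x)"
      by (rule simple_bochner_integral_norm_le) (rule simple_bochner_integrable_compose2[where p = "(-)", OF _ s(1) s(1)], simp)
    also have "\<dots> \<le> (\<integral>\<^sup>+x. ennreal (norm (f x - s m x)) + ennreal (norm (f x - s n x)) \<partial>M)"
      using dist_triangle3 by (intro nn_integral_mono) (simp flip: ennreal_plus dist_norm)
    also have "\<dots> = ?E m + ?E n" by (rule nn_integral_add) auto
    finally show ?thesis .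
  qed
  have "Cauchy ?I"
  proof (rule metric_CauchyI)
    fix e :: real assume "0 < e"
    then have "\<forall>\<^sub>F i in sequentially. ?E i < ennreal (e / 2)"
      by (intro order_tendstoD(2)[OF s(2)]) simp
    then obtain N where N: "\<And>i. N \<le> i \<Longrightarrow> ?E i < ennreal (e / 2)"
      by (auto simp: eventually_sequentially)
    have "dist (?I m) (?I n) < e" if "N \<le> m" "N \<le> n" for m n
    proof -
      have "ennreal (norm (?I m - ?I n)) < ennreal (e / 2) + ennreal (e / 2)"
        using le[of m n] add_strict_mono[OF N[OF that(1)] N[OF that(2)]] by (rule order.strict_trans1)
      also have "\<dots> = ennreal e" using \<open>0 < e\<close> by (simp flip: ennreal_plus)
      finally show ?thesis using \<open>0 < e\<close> by (simp add: dist_norm ennreal_less_iff)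
    qed
    then show "\<exists>N. \<forall>m\<ge>N. \<forall>n\<ge>N. dist (?I m) (?I n) < e" by blast
  qed
  then obtain z where "?I \<longlonglongrightarrow> z" using Cauchy_convergent convergent_def by blast
  then have "has_strong_bochner_integral M f z"
    unfolding has_strong_bochner_integral_def using s strongly_integrableD[OF assms] by blast
  then show ?thesis by (simp add: strong_integral_eq)
qed

lemma norm_strong_integral_le:
  assumes "strongly_integrable M f"
  shows "norm (strong_integral M f) \<le> (\<integral>x. norm (f x) \<partial>M)"
  using has_strong_bochner_integral_norm_le[OF has_strong_integral[OF assms]]
  by (simp add: L1_norm_eq[OF assms])

lemma strong_integral_add:
  assumes "strongly_integrable M f" "strongly_integrable M g"
  shows "strong_integral M (\<lambda>x. f x + g x) = strong_integral M f + strong_integral M g"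
  using has_strong_bochner_integral_scaleR_add[OF assms[THEN has_strong_integral], of 1]
  by (simp add: strong_integral_eq)

lemma strong_integral_diff:
  assumes "strongly_integrable M f" "strongly_integrable M g"
  shows "strong_integral M (\<lambda>x. f x - g x) = strong_integral M f - strong_integral M g"
  using has_strong_bochner_integral_scaleR_add[OF assms[THEN has_strong_integral], of "-1"]
  by (simp add: strong_integral_eq)

lemma has_strong_bochner_integral_0: "has_strong_bochner_integral M (\<lambda>x. 0) 0"
proof -
  have "has_strong_bochner_integral M (\<lambda>x. 0) (strong_integral M (\<lambda>x. 0))"
    by (intro has_strong_integral) (simp add: strongly_integrable_def strongly_measurable_const)
  from has_strong_bochner_integral_scaleR_add[OF this this, of "-1"] show ?thesis by simp
qed

lemma strong_integral_scaleR:
  assumes "strongly_integrable M f"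
  shows "strong_integral M (\<lambda>x. c *\<^sub>R f x) = c *\<^sub>R strong_integral M f"
  using has_strong_bochner_integral_scaleR_add[OF has_strong_bochner_integral_0 has_strong_integral[OF assms], of c]
  by (simp add: strong_integral_eq)

lemma has_strong_bochner_integral_cong_AE:
  assumes "has_strong_bochner_integral M f z" and "AE x in M. f x = g x"
  shows "has_strong_bochner_integral M g z"
proof -
  from assms(1) obtain s where f: "strongly_measurable M f"
    and s: "\<And>i::nat. sb_integrable M (s i)"
    and lim: "(\<lambda>i. L1_norm M (\<lambda>x. f x - s i x)) \<longlonglongrightarrow> 0"
       "(\<lambda>i. sb_integral M (s i)) \<longlonglongrightarrow> z"
    unfolding has_strong_bochner_integral_def by blast
  have "L1_norm M (\<lambda>x. f x - s i x) = L1_norm M (\<lambda>x. g x - s i x)" for i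
    using assms(2) by (intro nn_integral_cong_AE) auto
  with lim s strongly_measurable_AE_cong[OF f assms(2)] show ?thesis
    unfolding has_strong_bochner_integral_def by auto
qed

text \<open>Approximants of the scalar function, multiplied by \<open>c\<close>, approximate the
  vector function, so the value is an ordinary integral. The explicit vector integrals below, over
  level sets, of constants and of ramps, are evaluated this way.\<close>

lemma has_strong_bochner_integral_scaleR_const:
  fixes g :: "'a \<Rightarrow> real"
  assumes "integrable M g"
  shows "has_strong_bochner_integral M (\<lambda>x. g x *\<^sub>R c) ((\<integral>x. g x \<partial>M) *\<^sub>R c)"
proof -
  have [measurable]: "g \<in> borel_measurable M" using assms by simp
  have gm: "strongly_measurable M g" by (rule borel_measurable_imp_strongly_measurable) simp
  have "strongly_integrable M g"
    using assms by (intro strongly_integrableI[OF gm, of "\<lambda>x. norm (g x)"]) auto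
  then obtain s where s: "\<And>i::nat. sb_integrable M (s i)"
    "(\<lambda>i. L1_norm M (\<lambda>x. g x - s i x)) \<longlonglongrightarrow> 0"
    using strongly_integrable_approx by blast
  have sf: "simple_function M (s i)" for i
    using s(1)[of i] by (auto elim: simple_bochner_integrable.cases)
  note [measurable] = borel_measurable_simple_function[OF sf]
  have int: "integrable M (s i)" "(\<integral>x. s i x \<partial>M) = sb_integral M (s i)" for i
    using has_bochner_integral_simple_bochner_integrable[OF s(1)]
    by (auto simp: has_bochner_integral_iff)
  have "(\<lambda>i. sb_integral M (s i)) \<longlonglongrightarrow> (\<integral>x. g x \<partial>M)"
    unfolding int(2)[symmetric] using s(2) assms int(1)
    by (intro tendsto_L1_int) (simp_all add: abs_minus_commute)
  then have "(\<lambda>i. sb_integral M (s i) *\<^sub>R c) \<longlonglongrightarrow> (\<integral>x. g x \<partial>M) *\<^sub>R c"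
    by (intro tendsto_intros)
  moreover have "sb_integral M (\<lambda>x. s i x *\<^sub>R c)
      = sb_integral M (s i) *\<^sub>R c" for i
    by (rule simple_bochner_integral_linear[OF _ s(1)]) (intro bounded_linear.linear bounded_linear_scaleR_left)
  moreover have "sb_integrable M (\<lambda>x. s i x *\<^sub>R c)" for i
    by (rule simple_bochner_integrable_compose2[where p = "\<lambda>a b. a *\<^sub>R c", OF _ s(1) s(1)]) simp
  moreover have "L1_norm M (\<lambda>x. g x *\<^sub>R c - s i x *\<^sub>R c)
      = ennreal (norm c) * L1_norm M (\<lambda>x. g x - s i x)" for i
    by (subst nn_integral_cmult[symmetric])
       (auto simp flip: scaleR_diff_left ennreal_mult simp: mult.commute)
  then have "(\<lambda>i. L1_norm M (\<lambda>x. g x *\<^sub>R c - s i x *\<^sub>R c)) \<longlonglongrightarrow> 0"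
    using ennreal_tendsto_cmult[OF _ s(2), of "ennreal (norm c)"] by simp
  moreover have "strongly_measurable M (\<lambda>x. g x *\<^sub>R c)"
    by (intro strongly_measurable_scaleR strongly_measurable_const) simp
  ultimately show ?thesis
    unfolding has_strong_bochner_integral_def
    by (intro conjI exI[of _ "\<lambda>i x. s i x *\<^sub>R c"]) auto
qed

lemma has_strong_bochner_integral_sum:
  assumes "\<And>i. i \<in> I \<Longrightarrow> has_strong_bochner_integral M (f i) (z i)"
  shows "has_strong_bochner_integral M (\<lambda>x. \<Sum>i\<in>I. f i x) (\<Sum>i\<in>I. z i)"
  using assms
proof (induction I rule: infinite_finite_induct)
  case (insert i I)
  then show ?case
    using has_strong_bochner_integral_scaleR_add[of "f i" "z i" "\<lambda>x. \<Sum>i\<in>I. f i x" "\<Sum>i\<in>I. z i" 1] by simp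
qed (auto intro: has_strong_bochner_integral_0)

lemma strong_integral_cong_AE:
  assumes "strongly_integrable M f" and "AE x in M. f x = g x"
  shows "strong_integral M g = strong_integral M f"
  by (intro strong_integral_eq has_strong_bochner_integral_cong_AE[OF _ assms(2)]
      has_strong_integral assms(1))

text \<open>If \<open>s\<close> is simple, integrating \<open>s - f\<close> over the level sets of \<open>s\<close> gives \<open>\<integral>\<parallel>s\<parallel> \<le> \<integral>\<parallel>f - s\<parallel>\<close>.\<close>

lemma AE_eq_0_if_strong_integral_eq_0:
  assumes f: "strongly_integrable M f"
    and fin: "emeasure M (space M) < \<infinity>"
    and zero: "\<And>A. A \<in> sets M \<Longrightarrow> strong_integral M (\<lambda>x. indicat_real A x *\<^sub>R f x) = 0"
  shows "AE x in M. f x = 0"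
proof -
  obtain s where s: "\<And>i::nat. sb_integrable M (s i)"
    "(\<lambda>i. L1_norm M (\<lambda>x. f x - s i x)) \<longlonglongrightarrow> 0"
    using strongly_integrable_approx[OF f] by blast
  have sf: "simple_function M (s i)" for i
    using s(1)[of i] by (auto elim: simple_bochner_integrable.cases)
  have sm: "strongly_measurable M (s i)" for i
    by (rule strongly_measurable_simple[OF sf])
  have [measurable]: "(\<lambda>x. norm (f x - s i x)) \<in> borel_measurable M" for i
    by (intro strongly_measurable_norm strongly_measurable_diff strongly_integrableD f sm)
  note [measurable] = simple_function_borel_norm[OF sf]
    strongly_measurable_norm[OF strongly_integrableD[OF f]]
  have le: "L1_norm M (s i) \<le> L1_norm M (\<lambda>x. f x - s i x)" for i
  proof -
    let ?A = "\<lambda>y. s i -` {y} \<inter> space M"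
    have finR: "finite (s i ` space M)" and A[measurable]: "\<And>y. ?A y \<in> sets M"
      using sf[of i] by (auto dest: simple_functionD)
    \<comment> \<open>The finitely many level sets partition the space, so it suffices to compare
      the two integrals on each of them.\<close>
    have part: "(\<integral>\<^sup>+x. g x \<partial>M) = (\<Sum>y\<in>s i ` space M. \<integral>\<^sup>+x. g x * indicator (?A y) x \<partial>M)"
      if [measurable]: "g \<in> borel_measurable M" for g :: "'a \<Rightarrow> ennreal"
    proof -
      have "(\<Sum>y\<in>s i ` space M. g x * indicator (?A y) x) = g x" if "x \<in> space M" for x
      proof -
        have "(\<Sum>y\<in>s i ` space M. g x * indicator (?A y) x) = (\<Sum>y\<in>s i ` space M. if y = s i x then g x else 0)"
          using that by (intro sum.cong) (auto simp: indicator_def)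
        also have "\<dots> = g x" using that finR by (simp add: sum.delta)
        finally show ?thesis .
      qed
      then have "(\<integral>\<^sup>+x. g x \<partial>M) = (\<integral>\<^sup>+x. (\<Sum>y\<in>s i ` space M. g x * indicator (?A y) x) \<partial>M)"
        by (intro nn_integral_cong) simp
      also have "\<dots> = (\<Sum>y\<in>s i ` space M. \<integral>\<^sup>+x. g x * indicator (?A y) x \<partial>M)"
        by (rule nn_integral_sum) measurable
      finally show ?thesis .
    qed
    have "(\<integral>\<^sup>+x. ennreal (norm (s i x)) * indicator (?A y) x \<partial>M)
        \<le> (\<integral>\<^sup>+x. ennreal (norm (f x - s i x)) * indicator (?A y) x \<partial>M)" for y
    proof -
      have mA: "emeasure M (?A y) < \<infinity>"
        using fin emeasure_space[of M "?A y"] by (rule order.strict_trans1[rotated])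
      have intA: "integrable M (indicat_real (?A y))"
        using mA by simp
      have "has_strong_bochner_integral M (\<lambda>x. indicat_real (?A y) x *\<^sub>R y) (measure M (?A y) *\<^sub>R y)"
        using has_strong_bochner_integral_scaleR_const[OF intA, of y] A mA by simp
      moreover have "has_strong_bochner_integral M (\<lambda>x. indicat_real (?A y) x *\<^sub>R f x) 0"
      proof -
        have "strongly_integrable M (\<lambda>x. indicat_real (?A y) x *\<^sub>R f x)"
          by (intro strongly_integrable_indicator f) simp
        then show ?thesis
          using has_strong_integral zero[OF A] by fastforce
      qed
      ultimately have "has_strong_bochner_integral M
          (\<lambda>x. indicat_real (?A y) x *\<^sub>R y + (-1) *\<^sub>R (indicat_real (?A y) x *\<^sub>R f x)) (measure M (?A y) *\<^sub>R y + (-1) *\<^sub>R 0)"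
        by (rule has_strong_bochner_integral_scaleR_add)
      from has_strong_bochner_integral_norm_le[OF this]
      have "ennreal (norm (measure M (?A y) *\<^sub>R y))
        \<le> L1_norm M (\<lambda>x. indicat_real (?A y) x *\<^sub>R y - indicat_real (?A y) x *\<^sub>R f x)"
        by simp
      also have "\<dots> = (\<integral>\<^sup>+x. ennreal (norm (f x - s i x)) * indicator (?A y) x \<partial>M)"
        by (intro nn_integral_cong) (auto simp: indicator_def norm_minus_commute)
      finally have "ennreal (norm (measure M (?A y) *\<^sub>R y))
        \<le> (\<integral>\<^sup>+x. ennreal (norm (f x - s i x)) * indicator (?A y) x \<partial>M)" .
      moreover have "(\<integral>\<^sup>+x. ennreal (norm (s i x)) * indicator (?A y) x \<partial>M)
          = (\<integral>\<^sup>+x. ennreal (norm y) * indicator (?A y) x \<partial>M)"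
        by (intro nn_integral_cong) (auto simp: indicator_def)
      moreover have "\<dots> = ennreal (norm (measure M (?A y) *\<^sub>R y))"
        using mA by (simp add: nn_integral_cmult_indicator emeasure_eq_ennreal_measure ennreal_mult mult.commute)
      ultimately show ?thesis by simp
    qed
    then show ?thesis
      by (subst part, measurable, subst part, measurable) (rule sum_mono)
  qed
  \<comment> \<open>\<open>f\<close> is bounded by \<open>s i\<close> plus the error, and
    \<open>s i\<close> by the error, hence \<open>f\<close> by twice the error, which tends to
    0.\<close>
  have "L1_norm M f \<le> 2 * L1_norm M (\<lambda>x. f x - s i x)" for i
  proof -
    have "L1_norm M f \<le> (\<integral>\<^sup>+x. ennreal (norm (s i x)) + ennreal (norm (f x - s i x)) \<partial>M)"
      by (intro nn_integral_mono) (simp flip: ennreal_plus add: norm_triangle_sub)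
    also have "\<dots> = L1_norm M (s i) + L1_norm M (\<lambda>x. f x - s i x)"
      by (rule nn_integral_add) auto
    also have "\<dots> \<le> 2 * L1_norm M (\<lambda>x. f x - s i x)"
      unfolding mult_2 by (rule add_right_mono[OF le])
    finally show ?thesis .
  qed
  moreover have "(\<lambda>i. 2 * L1_norm M (\<lambda>x. f x - s i x)) \<longlonglongrightarrow> 2 * 0"
    by (rule ennreal_tendsto_cmult[OF _ s(2)]) simp
  ultimately have "L1_norm M f \<le> 2 * 0"
    by (intro LIMSEQ_le_const) auto
  then have "L1_norm M f = 0"
    by simp
  then have "AE x in M. ennreal (norm (f x)) = 0"
    by (subst (asm) nn_integral_0_iff_AE) auto
  then show ?thesis by eventually_elim simp
qed

section \<open>Bounded multipliers and vanishing integrals over half-lines\<close>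

text \<open>Dominated convergence for the norms of the differences, dominated by
  \<open>2 * C * norm (f x)\<close>. Only the scalar multiplier varies, which covers both increasing
  unions of sets and smoothed test functions.\<close>

lemma strong_integral_tendsto_bounded_mult:
  fixes a :: "nat \<Rightarrow> 'a \<Rightarrow> real"
  assumes f: "strongly_integrable M f"
    and a: "\<And>n. a n \<in> borel_measurable M" "a' \<in> borel_measurable M"
    and bound: "\<And>n x. \<bar>a n x\<bar> \<le> C" "\<And>x. \<bar>a' x\<bar> \<le> C"
    and lim: "\<And>x. x \<in> space M \<Longrightarrow> (\<lambda>n. a n x) \<longlonglongrightarrow> a' x"
  shows "(\<lambda>n. strong_integral M (\<lambda>x. a n x *\<^sub>R f x)) \<longlonglongrightarrow> strong_integral M (\<lambda>x. a' x *\<^sub>R f x)"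
proof -
  have ia: "strongly_integrable M (\<lambda>x. a n x *\<^sub>R f x)" for n
    by (rule strongly_integrable_bounded_mult[OF f a(1) bound(1)])
  have ia': "strongly_integrable M (\<lambda>x. a' x *\<^sub>R f x)"
    by (rule strongly_integrable_bounded_mult[OF f a(2) bound(2)])
  have nf: "integrable M (\<lambda>x. norm (f x))"
    by (rule strongly_integrable_norm[OF f])
  have L: "(\<lambda>n. \<integral>x. norm (a n x *\<^sub>R f x - a' x *\<^sub>R f x) \<partial>M) \<longlonglongrightarrow> (\<integral>x. 0 \<partial>M)"
  proof (rule integral_dominated_convergence[where w = "\<lambda>x. 2 * C * norm (f x)"])
    show "integrable M (\<lambda>x. 2 * C * norm (f x))" using nf by simp
    show "(\<lambda>x. norm (a n x *\<^sub>R f x - a' x *\<^sub>R f x)) \<in> borel_measurable M" for n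
      by (rule borel_measurable_integrable[OF strongly_integrable_norm[OF strongly_integrable_diff[OF ia ia']]])
    have "(\<lambda>n. norm (a n x *\<^sub>R f x - a' x *\<^sub>R f x)) \<longlonglongrightarrow> 0" if "x \<in> space M" for x
    proof -
      have "(\<lambda>n. norm (a n x *\<^sub>R f x - a' x *\<^sub>R f x)) \<longlonglongrightarrow> norm (a' x *\<^sub>R f x - a' x *\<^sub>R f x)"
        by (intro tendsto_intros lim that)
      then show ?thesis by simp
    qed
    then show "AE x in M. (\<lambda>n. norm (a n x *\<^sub>R f x - a' x *\<^sub>R f x)) \<longlonglongrightarrow> 0"
      by (rule AE_I2)
    have "norm (norm (a n x *\<^sub>R f x - a' x *\<^sub>R f x)) \<le> 2 * C * norm (f x)" for n x
    proof -
      have "\<bar>a n x - a' x\<bar> \<le> 2 * C" using bound(1)[of n x] bound(2)[of x] by linarith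
      then show ?thesis by (simp flip: scaleR_diff_left add: mult_right_mono)
    qed
    then show "AE x in M. norm (norm (a n x *\<^sub>R f x - a' x *\<^sub>R f x)) \<le> 2 * C * norm (f x)" for n
      by (intro AE_I2)
  qed simp
  have "norm (strong_integral M (\<lambda>x. a n x *\<^sub>R f x) - strong_integral M (\<lambda>x. a' x *\<^sub>R f x))
     \<le> (\<integral>x. norm (a n x *\<^sub>R f x - a' x *\<^sub>R f x) \<partial>M)" for n
    using norm_strong_integral_le[OF strongly_integrable_diff[OF ia ia']]
    by (simp add: strong_integral_diff[OF ia ia'])
  then have "(\<lambda>n. strong_integral M (\<lambda>x. a n x *\<^sub>R f x) - strong_integral M (\<lambda>x. a' x *\<^sub>R f x)) \<longlonglongrightarrow> 0"
    by (rule Lim_null_comparison[OF always_eventually[OF allI]]) (use L in simp)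
  then show ?thesis by (simp only: LIM_zero_iff)
qed

text \<open>Additivity handles the finite unions, and convergence of the indicators passes to the
  full union. This is the union step of the Dynkin argument below.\<close>

lemma strong_integral_eq_0_UN:
  assumes f: "strongly_integrable M f"
    and A: "\<And>i::nat. A i \<inter> space M \<in> sets M" "disjoint_family A"
    and zero: "\<And>i. strong_integral M (\<lambda>x. indicat_real (A i) x *\<^sub>R f x) = 0"
  shows "strong_integral M (\<lambda>x. indicat_real (\<Union>i. A i) x *\<^sub>R f x) = 0"
proof -
  have UN: "(\<Union>i. A i) \<inter> space M \<in> sets M" "(\<Union>i<n. A i) \<inter> space M \<in> sets M" for n
  proof -
    have "(\<Union>i\<in>I. A i) \<inter> space M \<in> sets M" for I
    proof -
      have "(\<Union>i\<in>I. A i) \<inter> space M = (\<Union>i\<in>I. A i \<inter> space M)" by blast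
      also have "\<dots> \<in> sets M" by (rule sets.countable_UN) (use A(1) in blast)
      finally show ?thesis .
    qed
    then show "(\<Union>i. A i) \<inter> space M \<in> sets M" "(\<Union>i<n. A i) \<inter> space M \<in> sets M"
      by blast+
  qed
  have in': "strongly_integrable M (\<lambda>x. indicat_real (\<Union>i<n. A i) x *\<^sub>R f x)"
    and iA: "strongly_integrable M (\<lambda>x. indicat_real (A n) x *\<^sub>R f x)" for n
    by (intro strongly_integrable_indicator f UN A(1))+
  have fin: "strong_integral M (\<lambda>x. indicat_real (\<Union>i<n. A i) x *\<^sub>R f x) = 0" for n
  proof (induction n)
    case 0
    then show ?case by (simp add: strong_integral_eq[OF has_strong_bochner_integral_0])
  next
    case (Suc n)
    have "A i \<inter> A n = {}" if "i < n" for i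
      using A(2) that by (simp add: disjoint_family_on_def)
    then have "(\<Union>i<n. A i) \<inter> A n = {}" by blast
    moreover have "(\<Union>i<Suc n. A i) = (\<Union>i<n. A i) \<union> A n"
      by (auto simp: lessThan_Suc)
    ultimately have "indicat_real (\<Union>i<Suc n. A i) x = indicat_real (\<Union>i<n. A i) x + indicat_real (A n) x" for x
      by (simp add: indicator_add)
    then show ?case
      using strong_integral_add[OF in' iA, of n n] by (simp only: scaleR_add_left Suc zero) simp
  qed
  have "(\<lambda>n. strong_integral M (\<lambda>x. indicat_real (\<Union>i<n. A i) x *\<^sub>R f x))
    \<longlonglongrightarrow> strong_integral M (\<lambda>x. indicat_real (\<Union>i. A i) x *\<^sub>R f x)"
  proof (rule strong_integral_tendsto_bounded_mult[OF f])
    show "indicat_real (\<Union>i. A i) \<in> borel_measurable M" "indicat_real (\<Union>i<n. A i) \<in> borel_measurable M" for n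
      by (rule borel_measurable_indicator_iff[THEN iffD2], rule UN)+
    show "\<bar>indicat_real (\<Union>i<n. A i) x\<bar> \<le> 1" "\<bar>indicat_real (\<Union>i. A i) x\<bar> \<le> 1" for n x
      by (simp_all add: indicator_def)
    fix x
    show "(\<lambda>n. indicat_real (\<Union>i<n. A i) x) \<longlonglongrightarrow> indicat_real (\<Union>i. A i) x"
      by (rule LIMSEQ_indicator_UN)
  qed
  then show ?thesis
    unfolding fin by (simp add: LIMSEQ_const_iff)
qed

end

text \<open>The sets over which \<open>f\<close> integrates to 0 form a Dynkin system: complements
  use the vanishing total integral, disjoint unions the preceding lemma. Half-lines are closed under
  intersection and generate the Borel sets; null sets then extend the conclusion to Lebesgue
  sets.\<close>

lemma AE_eq_0_if_strong_integral_atMost_eq_0: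
  fixes f :: "real \<Rightarrow> 'a::banach"
  assumes S: "S \<in> lmeasurable"
    and f: "strongly_integrable (lebesgue_on S) f"
    and total: "strong_integral (lebesgue_on S) f = 0"
    and zero: "\<And>a. strong_integral (lebesgue_on S) (\<lambda>x. indicat_real {..a} x *\<^sub>R f x) = 0"
  shows "AE x in lebesgue_on S. f x = 0"
proof -
  let ?M = "lebesgue_on S"
  have S': "S \<in> sets lebesgue" using S by blast
  interpret complete_measure ?M by (rule complete_measure_lebesgue_on[OF S'])
  have borel: "strong_integral ?M (\<lambda>x. indicat_real A x *\<^sub>R f x) = 0" if "A \<in> sets borel" for A
  proof -
    have "Int_stable (range (atMost :: real \<Rightarrow> real set))"
      by (auto simp: Int_stable_def)
    moreover have "range (atMost :: real \<Rightarrow> real set) \<subseteq> Pow UNIV"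
      by simp
    moreover have "A \<in> sigma_sets UNIV (range atMost)"
      using that by (simp add: borel_eq_atMost)
    ultimately show ?thesis
    proof (induction rule: sigma_sets_induct_disjoint)
      case (basic A)
      then show ?case using zero by blast
    next
      case empty
      show ?case
        by (simp add: strong_integral_eq[OF has_strong_bochner_integral_0])
    next
      case (compl A)
      have "A \<in> sets borel" using compl(1) by (simp add: borel_eq_atMost)
      then have "A \<inter> space ?M \<in> sets ?M"
        using S' by (auto simp: sets_restrict_space)
      then have "strong_integral ?M (\<lambda>x. f x - indicat_real A x *\<^sub>R f x) = 0"
        by (simp add: strong_integral_diff f strongly_integrable_indicator total compl(2))
      moreover have "(\<lambda>x. f x - indicat_real A x *\<^sub>R f x) = (\<lambda>x. indicat_real (UNIV - A) x *\<^sub>R f x)"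
        by (auto simp: indicator_def)
      ultimately show ?case by simp
    next
      case (union A)
      have "A i \<in> sets borel" for i using union(2) by (auto simp: borel_eq_atMost)
      then have "A i \<inter> space ?M \<in> sets ?M" for i
        using S' by (auto simp: sets_restrict_space)
      then show ?case by (rule strong_integral_eq_0_UN[OF f _ union(1,3)])
    qed
  qed
  show ?thesis
  proof (rule AE_eq_0_if_strong_integral_eq_0[OF f])
    show "emeasure ?M (space ?M) < \<infinity>"
      using S by (simp add: emeasure_restrict_space S' fmeasurable_def)
    fix A assume "A \<in> sets ?M"
    then have "A \<in> sets lebesgue" using S' by (simp add: sets_restrict_space_iff)
    then obtain B N where B: "B \<in> sets borel" "negligible N" "B \<union> N = A"
      by (rule sets_lebesgue_almost_borel)
    have "AE x in lebesgue. x \<notin> N" 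
      using B(2) by (intro AE_not_in) (simp add: negligible_iff_null_sets)
    then have "AE x in ?M. x \<notin> N"
      using S' by (subst AE_restrict_space_iff) (auto elim: eventually_mono)
    then have "AE x in ?M. indicat_real B x *\<^sub>R f x = indicat_real A x *\<^sub>R f x"
      by eventually_elim (use B(3) in \<open>auto simp: indicator_def\<close>)
    moreover have "B \<inter> space ?M \<in> sets ?M"
      using B(1) S' by (auto simp: sets_restrict_space)
    ultimately have "strong_integral ?M (\<lambda>x. indicat_real A x *\<^sub>R f x)
        = strong_integral ?M (\<lambda>x. indicat_real B x *\<^sub>R f x)"
      by (intro strong_integral_cong_AE strongly_integrable_indicator f)
    then show "strong_integral ?M (\<lambda>x. indicat_real A x *\<^sub>R f x) = 0"
      using borel[OF B(1)] by simp
  qed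
qed

section \<open>Gauge integrals and continuous functions on an interval\<close>

text \<open>The bridge from integrals over the fixed space (0,T) to gauge integrals over variable
  subintervals: the two domains differ by at most the points s, 0 and T. The half-open form lets the
  indicators of adjacent intervals add up.\<close>

lemma integral_indicator_Ioc:
  fixes k :: "real \<Rightarrow> real"
  assumes k: "integrable (lebesgue_on {0<..<T}) k" and st: "0 \<le> s" "t \<le> T"
  shows "integrable (lebesgue_on {0<..<T}) (\<lambda>x. indicat_real {s<..t} x * k x)"
    and "(\<integral>x. indicat_real {s<..t} x * k x \<partial>lebesgue_on {0<..<T}) = integral {s..t} k"
proof -
  let ?M = "lebesgue_on {0<..<T}"
  have "{s<..t} \<inter> {0<..<T} \<in> sets ?M"
    by (auto simp: sets_restrict_space)
  from integrable_mult_indicator[OF this k]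
  have "integrable ?M (\<lambda>x. indicat_real ({s<..t} \<inter> {0<..<T}) x * k x)" by simp
  moreover have "integrable ?M (\<lambda>x. indicat_real ({s<..t} \<inter> {0<..<T}) x * k x)
      \<longleftrightarrow> integrable ?M (\<lambda>x. indicat_real {s<..t} x * k x)"
    by (rule Bochner_Integration.integrable_cong[OF refl]) (simp add: indicator_def)
  ultimately show int: "integrable ?M (\<lambda>x. indicat_real {s<..t} x * k x)"
    by blast
  then have "(\<integral>x. indicat_real {s<..t} x * k x \<partial>?M) = integral {0<..<T} (\<lambda>x. indicat_real {s<..t} x * k x)"
    by (rule lebesgue_integral_eq_integral) simp
  also have "\<dots> = integral {0<..<T} (\<lambda>x. if x \<in> {s<..t} then k x else 0)"
    by (intro Henstock_Kurzweil_Integration.integral_cong) (auto simp: indicator_def)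
  also have "\<dots> = integral ({s<..t} \<inter> {0<..<T}) k"
    by (rule Henstock_Kurzweil_Integration.integral_restrict_Int)
  also have "\<dots> = integral {s..t} k"
  proof (rule integral_subset_negligible)
    show "negligible ({s..t} - {s<..t} \<inter> {0<..<T})"
      by (rule negligible_subset[of "{s, 0, T}"]) (use st in auto)
  qed auto
  finally show "(\<integral>x. indicat_real {s<..t} x * k x \<partial>?M) = integral {s..t} k" .
qed

lemma simple_function_floor:
  fixes c :: real
  assumes "0 < c"
  shows "simple_function (lebesgue_on {a<..<b}) (\<lambda>x. \<lfloor>c * x\<rfloor>)"
  unfolding simple_function_def
proof (intro conjI ballI)
  have "(\<lambda>x. \<lfloor>c * x\<rfloor>) ` space (lebesgue_on {a<..<b}) \<subseteq> {\<lfloor>c * a\<rfloor>..\<lfloor>c * b\<rfloor>}"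
    using assms by (auto intro!: floor_mono mult_left_mono)
  then show "finite ((\<lambda>x. \<lfloor>c * x\<rfloor>) ` space (lebesgue_on {a<..<b}))"
    by (rule finite_subset) simp
  fix k
  have "(\<lambda>x. \<lfloor>c * x\<rfloor>) -` {k} \<inter> space (lebesgue_on {a<..<b}) = {of_int k / c..<(of_int k + 1) / c} \<inter> {a<..<b}"
    using assms by (auto simp: floor_eq_iff pos_divide_le_eq pos_less_divide_eq mult.commute[of c])
  also have "\<dots> \<in> sets (lebesgue_on {a<..<b})"
    by (auto simp: sets_restrict_space)
  finally show "(\<lambda>x. \<lfloor>c * x\<rfloor>) -` {k} \<inter> space (lebesgue_on {a<..<b}) \<in> sets (lebesgue_on {a<..<b})" .
qed

text \<open>The approximants sample \<open>f\<close> at the grid point of mesh 1/(i+1) just below x.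
  On a bounded interval this takes finitely many values, and the grid points tend to x.\<close>

lemma continuous_on_imp_strongly_measurable:
  fixes f :: "real \<Rightarrow> 'a::banach"
  assumes "continuous_on {a<..<b} f"
  shows "strongly_measurable (lebesgue_on {a<..<b}) f"
  unfolding strongly_measurable_def
proof (intro exI conjI allI AE_I2)
  let ?q = "\<lambda>i x. of_int \<lfloor>real (Suc i) * x\<rfloor> / real (Suc i)"
  \<comment> \<open>A grid point may lie left of the interval; the default value 0 used there is met
    by each x for finitely many i only.\<close>
  let ?s = "\<lambda>i x. if ?q i x \<in> {a<..<b} then f (?q i x) else 0"
  show "simple_function (lebesgue_on {a<..<b}) (?s i)" for i
    by (rule simple_function_compose1[OF simple_function_floor,
        where g = "\<lambda>k. if of_int k / real (Suc i) \<in> {a<..<b} then f (of_int k / real (Suc i)) else 0"]) simp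
  fix x assume "x \<in> space (lebesgue_on {a<..<b})"
  then have x: "x \<in> {a<..<b}" by simp
  have q: "(\<lambda>i. ?q i x) \<longlonglongrightarrow> x"
  proof (rule LIMSEQ_I)
    fix r :: real assume "0 < r"
    then obtain N where N: "inverse (real (Suc N)) < r" using reals_Archimedean by blast
    have "norm (?q i x - x) < r" if "N \<le> i" for i
    proof -
      have "\<bar>of_int \<lfloor>real (Suc i) * x\<rfloor> - real (Suc i) * x\<bar> \<le> 1" by linarith
      moreover have "?q i x - x = (of_int \<lfloor>real (Suc i) * x\<rfloor> - real (Suc i) * x) / real (Suc i)"
        by (simp add: diff_divide_distrib del: of_nat_Suc)
      ultimately have "\<bar>?q i x - x\<bar> \<le> 1 / real (Suc i)"
        by (simp add: abs_divide divide_right_mono del: of_nat_Suc)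
      also have "\<dots> \<le> inverse (real (Suc N))"
        using that by (simp add: field_simps)
      finally show ?thesis using N by simp
    qed
    then show "\<exists>N. \<forall>n\<ge>N. norm (?q n x - x) < r" by blast
  qed
  then have ev: "\<forall>\<^sub>F i in sequentially. ?q i x \<in> {a<..<b}"
    using x by (intro topological_tendstoD) auto
  have "(\<lambda>i. f (?q i x)) \<longlonglongrightarrow> f x"
    by (rule continuous_on_tendsto_compose[OF assms q x ev])
  then show "(\<lambda>i. ?s i x) \<longlonglongrightarrow> f x"
    by (rule Lim_transform_eventually) (use ev in eventually_elim, simp)
qed

section \<open>Smooth test functions\<close>

lemma funpow_deriv_Suc: "(deriv ^^ Suc n) f = (deriv ^^ n) (deriv f)"
  by (simp add: funpow_swap1)

definition smooth :: "(real \<Rightarrow> real) \<Rightarrow> bool" where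
  "smooth f \<longleftrightarrow> (\<forall>n. (deriv ^^ n) f differentiable_on UNIV)"

text \<open>By induction on the order, all derivatives stay in \<open>F\<close>. Smoothness of a
  concrete function thus amounts to one differentiation inside an invariant family.\<close>

lemma smooth_if_closed_deriv:
  assumes "f \<in> F" and "\<And>g. g \<in> F \<Longrightarrow> g differentiable_on UNIV" and "\<And>g. g \<in> F \<Longrightarrow> deriv g \<in> F"
  shows "smooth f"
proof -
  have "(deriv ^^ n) f \<in> F" for n
    by (induction n) (use assms in auto)
  then show ?thesis unfolding smooth_def using assms(2) by blast
qed

lemma smooth_antiderivative:
  assumes "\<And>x. (f has_real_derivative g x) (at x)" "smooth g"
  shows "smooth f"
  unfolding smooth_def
proof
  fix n
  have d: "deriv f = g" using assms(1) by (intro ext DERIV_imp_deriv)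
  show "(deriv ^^ n) f differentiable_on UNIV"
  proof (cases n)
    case 0
    have "f differentiable (at x)" for x
      using assms(1) real_differentiable_def by blast
    then show ?thesis using 0 by (simp add: differentiable_on_def differentiable_at_withinI)
  next
    case (Suc m)
    then show ?thesis using assms(2) d by (simp add: smooth_def funpow_swap1)
  qed
qed

lemma smooth_has_real_derivative:
  assumes "smooth f" shows "(f has_real_derivative deriv f x) (at x)"
proof -
  have "f differentiable (at x)"
    using assms[unfolded smooth_def, rule_format, of 0] by (simp add: differentiable_on_def)
  then show ?thesis
    by (metis DERIV_imp_deriv real_differentiable_def)
qed

lemma smooth_deriv: "smooth f \<Longrightarrow> smooth (deriv f)"
  unfolding smooth_def by (metis funpow_deriv_Suc)

text \<open>For fixed inner affine maps the combinations form a family closed under differentiation,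
  as the chain rule only multiplies the outer coefficients by \<open>c\<close> and \<open>e\<close>.
  Shifts, rescalings and differences of smooth functions are all instances.\<close>

lemma smooth_linear_combination:
  assumes "smooth f" "smooth g"
  shows "smooth (\<lambda>x. a * f (c * x + d) + b * g (e * x + k))"
proof (rule smooth_if_closed_deriv[where F =
    "{\<lambda>x. a * f (c * x + d) + b * g (e * x + k) | f g a b. smooth f \<and> smooth g}"])
  show "(\<lambda>x. a * f (c * x + d) + b * g (e * x + k)) \<in> {\<lambda>x. a * f (c * x + d) + b * g (e * x + k) | f g a b. smooth f \<and> smooth g}"
    using assms by blast
  fix h assume "h \<in> {\<lambda>x. a * f (c * x + d) + b * g (e * x + k) | f g a b. smooth f \<and> smooth g}"
  then obtain f g a b where h: "h = (\<lambda>x. a * f (c * x + d) + b * g (e * x + k))" "smooth f" "smooth g" by blast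
  have D: "(h has_real_derivative (a * c) * deriv f (c * x + d) + (b * e) * deriv g (e * x + k)) (at x)" for x
  proof -
    have A: "((\<lambda>x. f (c * x + d)) has_real_derivative deriv f (c * x + d) * c) (at x)" if "smooth f" for f c d
      by (rule DERIV_chain2[OF smooth_has_real_derivative[OF that]]) (auto intro!: derivative_eq_intros)
    show ?thesis
      unfolding h(1)
      using DERIV_add[OF DERIV_cmult[OF A[OF h(2), of c d], of a] DERIV_cmult[OF A[OF h(3), of e k], of b]]
      by (simp add: mult.assoc mult.commute[of c "deriv f _"] mult.commute[of e "deriv g _"])
  qed
  then show "h differentiable_on UNIV"
    unfolding differentiable_on_def using real_differentiable_def by blast
  have "deriv h = (\<lambda>x. (a * c) * deriv f (c * x + d) + (b * e) * deriv g (e * x + k))"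
    using D by (intro ext DERIV_imp_deriv)
  then show "deriv h \<in> {\<lambda>x. a * f (c * x + d) + b * g (e * x + k) | f g a b. smooth f \<and> smooth g}"
    using smooth_deriv[OF h(2)] smooth_deriv[OF h(3)] by blast
qed

text \<open>With \<open>q = x - x\<^sup>2\<close>, the functions \<open>p q\<^bsup>-k\<^esup> e\<^bsup>-1/q\<^esup>\<close> on \<open>(0,1)\<close>, \<open>p\<close> a polynomial, are closed under
  differentiation, which gives their smoothness without computing higher derivatives.\<close>

definition bump_fun :: "real poly \<Rightarrow> nat \<Rightarrow> real \<Rightarrow> real" where
  "bump_fun p k x = (if 0 < x \<and> x < 1 then poly p x / (x - x\<^sup>2) ^ k * exp (- 1 / (x - x\<^sup>2)) else 0)"

text \<open>Raise \<open>y \<le> exp y\<close> at y = 1/((n+1) q) to the power n+1 and take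
  reciprocals. The exponential thereby beats every negative power of \<open>q\<close>.\<close>

lemma exp_minus_inverse_le:
  fixes q :: real assumes "0 < q"
  shows "exp (- 1 / q) \<le> (real (Suc n) * q) ^ Suc n"
proof -
  have "(1 / (real (Suc n) * q)) ^ Suc n \<le> exp (1 / (real (Suc n) * q)) ^ Suc n"
  proof (rule power_mono)
    show "1 / (real (Suc n) * q) \<le> exp (1 / (real (Suc n) * q))"
      using exp_ge_add_one_self[of "1 / (real (Suc n) * q)"] by linarith
  qed (use assms in simp)
  also have "\<dots> = exp (real (Suc n) * (1 / (real (Suc n) * q)))"
    by (rule exp_of_nat_mult[symmetric])
  also have "real (Suc n) * (1 / (real (Suc n) * q)) = 1 / q"
    by simp
  finally have *: "(1 / (real (Suc n) * q)) ^ Suc n \<le> exp (1 / q)" .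
  have pos: "0 < (real (Suc n) * q) ^ Suc n"
    using assms by (intro zero_less_power mult_pos_pos) simp_all
  have "exp (- 1 / q) = 1 / exp (1 / q)"
    by (simp add: exp_minus inverse_eq_divide)
  also have "\<dots> \<le> 1 / (1 / (real (Suc n) * q)) ^ Suc n"
    using * pos by (intro divide_left_mono) (simp_all add: power_one_over)
  also have "\<dots> = (real (Suc n) * q) ^ Suc n"
    by (simp only: power_one_over) simp
  finally show ?thesis .
qed

lemma has_real_derivative_0_if_quadratic:
  fixes f :: "real \<Rightarrow> real"
  assumes "\<And>x. \<bar>f x - f a\<bar> \<le> C * (x - a)\<^sup>2"
  shows "(f has_real_derivative 0) (at a)"
  unfolding DERIV_def
proof (rule Lim_null_comparison)
  have "norm ((f (a + h) - f a) / h) \<le> C * \<bar>h\<bar>" for h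
  proof (cases "h = 0")
    case False
    have "\<bar>f (a + h) - f a\<bar> \<le> C * \<bar>h\<bar> * \<bar>h\<bar>"
      using assms[of "a + h"] by (simp add: power2_eq_square mult.assoc)
    then show ?thesis
      using False by (simp add: pos_divide_le_eq)
  qed simp
  then show "\<forall>\<^sub>F h in at 0. norm ((f (a + h) - f a) / h) \<le> C * \<bar>h\<bar>"
    by simp
  have "((\<lambda>h. C * \<bar>h\<bar>) \<longlongrightarrow> C * \<bar>0::real\<bar>) (at 0)"
    by (intro tendsto_intros)
  then show "((\<lambda>h. C * \<bar>h\<bar>) \<longlongrightarrow> 0) (at (0::real))"
    by simp
qed

text \<open>The exponential is bounded by a multiple of q^(k+2) with q = x - x^2: k factors cancel
  the denominator, and two remain for quadratic decay at the end points. The polynomial is bounded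
  on [0,1] by compactness.\<close>

lemma bump_fun_bound:
  obtains C where "\<And>x. \<bar>bump_fun p k x\<bar> \<le> C * (x - x\<^sup>2)\<^sup>2" "0 \<le> C"
proof -
  have "compact (poly p ` {0..1})"
    by (intro compact_continuous_image continuous_intros) simp
  then obtain B where B: "\<And>x. x \<in> {0..1} \<Longrightarrow> \<bar>poly p x\<bar> \<le> B"
    by (force dest!: compact_imp_bounded simp: bounded_iff)
  have "0 \<le> B" by (rule order_trans[OF abs_ge_zero B[of 0]]) simp
  let ?n = "real (Suc (Suc k))"
  let ?C = "B * ?n ^ Suc (Suc k)"
  have "\<bar>bump_fun p k x\<bar> \<le> ?C * (x - x\<^sup>2)\<^sup>2" for x
  proof (cases "0 < x \<and> x < 1")
    case True
    define q where "q = x - x\<^sup>2"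
    have q: "0 < q" using True by (simp add: q_def power2_eq_square)
    have "\<bar>bump_fun p k x\<bar> = \<bar>poly p x\<bar> * (exp (- 1 / q) / q ^ k)"
      using True q by (simp add: bump_fun_def abs_mult flip: q_def)
    also have "\<dots> \<le> B * ((?n * q) ^ Suc (Suc k) / q ^ k)"
      using exp_minus_inverse_le[OF q, of "Suc k"] B[of x] True q \<open>0 \<le> B\<close>
      by (intro mult_mono divide_right_mono) simp_all
    also have "(?n * q) ^ Suc (Suc k) / q ^ k = ?n ^ Suc (Suc k) * q\<^sup>2"
      using q by (simp only: power_mult_distrib) (simp add: power2_eq_square)
    finally show ?thesis by (simp add: q_def mult.assoc)
  next
    case False
    then have "bump_fun p k x = 0" by (auto simp: bump_fun_def)
    then show ?thesis using \<open>0 \<le> B\<close> by simp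
  qed
  then show ?thesis using \<open>0 \<le> B\<close> that[of ?C] by simp
qed

text \<open>Here \<open>[:0, 1, -1:]\<close> is q = x - x^2 and \<open>[:1, -2:]\<close> its
  derivative; the numerator results from the product and quotient rules over the common denominator
  q^(k+2). At 0 and 1 the quadratic decay forces the derivative 0.\<close>

lemma bump_fun_has_real_derivative:
  "(bump_fun p k has_real_derivative bump_fun (pderiv p * [:0, 1, -1:]\<^sup>2
      - of_nat k * p * [:0, 1, -1:] * [:1, -2:] + p * [:1, -2:]) (k + 2) x) (at x)"
  (is "(_ has_real_derivative bump_fun ?r _ _) _")
proof -
  consider "0 < x" "x < 1" | "x < 0 \<or> x > 1" | "x = 0 \<or> x = 1" by linarith
  then show ?thesis
  proof cases
    case 1
    define q where "q = x - x\<^sup>2"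
    have q: "0 < q" using 1 by (simp add: q_def power2_eq_square)
    have "((\<lambda>x. poly p x / (x - x\<^sup>2) ^ k * exp (- 1 / (x - x\<^sup>2))) has_real_derivative bump_fun ?r (k + 2) x) (at x)"
    proof -
      have Dq: "((\<lambda>x. x - x\<^sup>2) has_real_derivative 1 - 2 * x) (at x)"
        by (auto intro!: derivative_eq_intros)
      have D1: "((\<lambda>x. (x - x\<^sup>2) ^ k) has_real_derivative of_nat k * (1 - 2 * x) * q ^ (k - 1)) (at x)"
        using DERIV_power[OF Dq, of k] by (simp add: q_def mult_ac)
      have D2: "((\<lambda>x. exp (- 1 / (x - x\<^sup>2))) has_real_derivative exp (- 1 / q) * ((1 - 2 * x) / q\<^sup>2)) (at x)"
      proof -
        have "((\<lambda>x. - 1 / (x - x\<^sup>2)) has_real_derivative (0 * q - (- 1) * (1 - 2 * x)) / (q * q)) (at x)"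
          unfolding q_def by (rule DERIV_divide[OF DERIV_const Dq]) (use q q_def in simp)
        from DERIV_chain2[OF DERIV_exp this] show ?thesis
          by (simp add: q_def power2_eq_square)
      qed
      have "((\<lambda>x. poly p x / (x - x\<^sup>2) ^ k) has_real_derivative
          (poly (pderiv p) x * q ^ k - poly p x * (of_nat k * (1 - 2 * x) * q ^ (k - 1))) / (q ^ k * q ^ k)) (at x)"
        using DERIV_divide[OF poly_DERIV D1] q by (simp add: q_def)
      from DERIV_mult[OF this D2]
      have "((\<lambda>x. poly p x / (x - x\<^sup>2) ^ k * exp (- 1 / (x - x\<^sup>2))) has_real_derivative
          (poly (pderiv p) x * q ^ k - poly p x * (of_nat k * (1 - 2 * x) * q ^ (k - 1))) / (q ^ k * q ^ k) * exp (- 1 / q)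
          + exp (- 1 / q) * ((1 - 2 * x) / q\<^sup>2) * (poly p x / q ^ k)) (at x)"
        by (simp add: q_def)
      moreover have "(poly (pderiv p) x * q ^ k - poly p x * (of_nat k * (1 - 2 * x) * q ^ (k - 1))) / (q ^ k * q ^ k) * exp (- 1 / q)
          + exp (- 1 / q) * ((1 - 2 * x) / q\<^sup>2) * (poly p x / q ^ k) = bump_fun ?r (k + 2) x"
      proof -
        have r: "poly ?r x = poly (pderiv p) x * q\<^sup>2 - real k * poly p x * q * (1 - 2 * x) + poly p x * (1 - 2 * x)"
          by (simp add: q_def power2_eq_square algebra_simps)
        have b: "bump_fun ?r (k + 2) x = poly ?r x / q ^ (k + 2) * exp (- 1 / q)"
          using 1 unfolding bump_fun_def q_def by simp
        \<comment> \<open>\<open>k - 1\<close> is truncated subtraction; the factor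
          \<open>real k\<close> makes the identity true for \<open>k = 0\<close> as well.\<close>
        have k: "real k * q ^ (k - 1) = real k * q ^ k / q"
          using q by (cases k) simp_all
        have "(poly (pderiv p) x * q ^ k - poly p x * (of_nat k * (1 - 2 * x) * q ^ (k - 1))) / (q ^ k * q ^ k)
            = (poly (pderiv p) x - real k * poly p x * (1 - 2 * x) / q) / q ^ k"
        proof -
          have e: "poly p x * (of_nat k * (1 - 2 * x) * q ^ (k - 1)) = poly p x * (1 - 2 * x) * (real k * q ^ k / q)"
            by (simp only: k[symmetric] mult_ac)
          show ?thesis
            unfolding e using q by (simp add: field_simps)
        qed
        then show ?thesis
          unfolding b r using q
          by (simp only: power_add power2_eq_square) (simp add: divide_simps, simp add: algebra_simps)
      qed
      ultimately show ?thesis by simp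
    qed
    then show ?thesis
      by (rule has_field_derivative_transform_within_open[of _ _ _ "{0<..<1}"])
         (use 1 in \<open>auto simp: bump_fun_def\<close>)
  next
    case 2
    have "((\<lambda>x. 0) has_real_derivative 0) (at x)" by simp
    then have "(bump_fun p k has_real_derivative 0) (at x)"
      by (rule has_field_derivative_transform_within_open[of _ _ _ "{..<0} \<union> {1<..}"])
         (use 2 in \<open>auto simp: bump_fun_def\<close>)
    then show ?thesis using 2 by (auto simp: bump_fun_def)
  next
    case 3
    obtain C where C: "\<And>y. \<bar>bump_fun p k y\<bar> \<le> C * (y - y\<^sup>2)\<^sup>2" "0 \<le> C"
      using bump_fun_bound by blast
    have z: "bump_fun p' k' x = 0" for p' k' using 3 by (auto simp: bump_fun_def)
    have "\<bar>bump_fun p k y - bump_fun p k x\<bar> \<le> C * (y - x)\<^sup>2" for y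
    proof (cases "0 < y \<and> y < 1")
      case True
      \<comment> \<open>Both factors on the right are at most 1, so the one belonging to the end
        point x may be kept alone.\<close>
      have "(y - y\<^sup>2)\<^sup>2 = y\<^sup>2 * (1 - y)\<^sup>2" by (simp add: power2_eq_square algebra_simps)
      moreover have "y\<^sup>2 \<le> 1" "(1 - y)\<^sup>2 \<le> 1" using True by (auto intro!: power_le_one)
      ultimately have "(y - y\<^sup>2)\<^sup>2 \<le> (y - x)\<^sup>2"
        using 3 by (auto simp: power2_commute[of y 1] mult_left_le mult_left_le_one_le)
      then show ?thesis using C(1)[of y] C(2) z by (auto intro: order_trans mult_left_mono)
    next
      case False
      then have "bump_fun p k y = 0" by (auto simp: bump_fun_def)
      then show ?thesis using z C(2) by simp
    qed
    from has_real_derivative_0_if_quadratic[OF this] show ?thesis by (simp add: z)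
  qed
qed

lemma smooth_bump_fun: "smooth (bump_fun p k)"
proof (rule smooth_if_closed_deriv[where F = "{bump_fun p k | p k. True}"])
  fix g assume "g \<in> {bump_fun p k | p k. True}"
  then obtain p k where g: "g = bump_fun p k" by blast
  show "g differentiable_on UNIV"
    unfolding g differentiable_on_def using bump_fun_has_real_derivative real_differentiable_def by blast
  show "deriv g \<in> {bump_fun p k | p k. True}"
    unfolding g using DERIV_imp_deriv[OF bump_fun_has_real_derivative[of p k]] by blast
qed auto

lemma bump_fun_1_pos: "0 < x \<Longrightarrow> x < 1 \<Longrightarrow> 0 < bump_fun 1 0 x"
  by (simp add: bump_fun_def)

section \<open>Smooth ramps and smoothed steps\<close>

lemma continuous_antiderivative_exists:
  fixes g :: "real \<Rightarrow> real"
  assumes "continuous_on UNIV g"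
  obtains f where "\<And>x. (f has_real_derivative g x) (at x)" "f 0 = 0"
proof
  fix x :: real
  let ?a = "- \<bar>x\<bar> - 1" and ?b = "\<bar>x\<bar> + 1"
  have "((\<lambda>u. LBINT y=ereal 0..u. g y) has_vector_derivative g x) (at x within {?a..?b})"
    by (rule interval_integral_FTC2) (use continuous_on_subset[OF assms] in auto)
  moreover have "at x within {?a..?b} = at x"
    by (rule at_within_interior) (auto simp: interior_atLeastAtMost_real)
  ultimately show "((\<lambda>u. LBINT y=ereal 0..u. g y) has_real_derivative g x) (at x)"
    by (simp add: has_real_derivative_iff_has_vector_derivative)
qed (simp add: zero_ereal_def)

text \<open>Integrating the bump and dividing by its total mass \<open>s 1\<close> gives a smooth
  transition \<open>\<sigma>\<close> from 0 to 1; integrating once more gives \<open>S\<close> with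
  derivative \<open>\<sigma>\<close>. Positivity of the mass and the constant values outside [0,1]
  come from the mean value theorem.\<close>

lemma smooth_ramp_exists:
  obtains S where "smooth S" "\<And>x. x \<le> 0 \<Longrightarrow> S x = 0"
    "\<And>x. 0 \<le> deriv S x" "\<And>x. deriv S x \<le> 1" "\<And>x. x \<le> 0 \<Longrightarrow> deriv S x = 0" "\<And>x. 1 \<le> x \<Longrightarrow> deriv S x = 1"
proof -
  let ?\<rho> = "bump_fun 1 0"
  have cont: "continuous_on UNIV f" if "smooth f" for f
    using smooth_has_real_derivative[OF that] by (intro DERIV_continuous_on) (blast intro: has_field_derivative_at_within)
  obtain s where s: "\<And>x. (s has_real_derivative ?\<rho> x) (at x)" "s 0 = 0"
    using continuous_antiderivative_exists[OF cont[OF smooth_bump_fun]] by blast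
  have mono: "s x \<le> s y" if "x \<le> y" for x y
    by (rule DERIV_nonneg_imp_nondecreasing[OF that]) (use s(1) in \<open>force simp: bump_fun_def\<close>)
  have zero: "s x = 0" if "x \<le> 0" for x
  proof (cases "x = 0")
    case False
    have "\<exists>z>x. z < 0 \<and> s 0 - s x = (0 - x) * ?\<rho> z"
      using False that by (intro MVT2 s(1)) auto
    then show ?thesis using s(2) by (auto simp: bump_fun_def)
  qed (simp add: s)
  have one: "s x = s 1" if "1 \<le> x" for x
  proof (cases "x = 1")
    case False
    have "\<exists>z>1. z < x \<and> s x - s 1 = (x - 1) * ?\<rho> z"
      using False that by (intro MVT2 s(1)) auto
    then show ?thesis by (auto simp: bump_fun_def)
  qed simp
  have pos: "0 < s 1"
  proof -
    have "\<exists>z>0. z < 1 \<and> s 1 - s 0 = (1 - 0) * ?\<rho> z"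
      by (intro MVT2 s(1)) auto
    then show ?thesis using s(2) bump_fun_1_pos by force
  qed
  have sm: "smooth s" by (rule smooth_antiderivative[OF s(1) smooth_bump_fun])
  define \<sigma> where "\<sigma> x = s x / s 1" for x
  have smooth_\<sigma>: "smooth \<sigma>"
    using smooth_linear_combination[OF sm sm, of "1 / s 1" 1 0 0 1 0] by (simp add: \<sigma>_def[abs_def])
  obtain S where S: "\<And>x. (S has_real_derivative \<sigma> x) (at x)" "S 0 = 0"
    using continuous_antiderivative_exists[OF cont[OF smooth_\<sigma>]] by blast
  have dS: "deriv S x = \<sigma> x" for x by (rule DERIV_imp_deriv[OF S(1)])
  show ?thesis
  proof
    show "smooth S" by (rule smooth_antiderivative[OF S(1) smooth_\<sigma>])
    show "0 \<le> deriv S x" for x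
      using mono[of 0 x] zero[of x] s(2) pos by (cases "x \<le> 0") (auto simp: dS \<sigma>_def)
    show "deriv S x \<le> 1" for x
      using mono[of x 1] one[of x] pos by (cases "x \<le> 1") (auto simp: dS \<sigma>_def)
    show "deriv S x = 0" if "x \<le> 0" for x using zero[OF that] by (simp add: dS \<sigma>_def)
    show "deriv S x = 1" if "1 \<le> x" for x using one[OF that] pos by (simp add: dS \<sigma>_def)
    show "S x = 0" if "x \<le> 0" for x
    proof (cases "x = 0")
      case False
      have "\<exists>z>x. z < 0 \<and> S 0 - S x = (0 - x) * \<sigma> z"
        using False that by (intro MVT2 S(1)) auto
      then show ?thesis using S(2) zero by (auto simp: \<sigma>_def)
    qed (simp add: S)
  qed
qed

lemma smooth_imp_continuous_on: "smooth f \<Longrightarrow> continuous_on A f"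
  by (rule DERIV_continuous_on[where D = "deriv f"]) (blast intro: has_field_derivative_at_within smooth_has_real_derivative)

lemma smooth_borel_measurable_lebesgue_on:
  "smooth f \<Longrightarrow> S \<in> sets lebesgue \<Longrightarrow> f \<in> borel_measurable (lebesgue_on S)"
  by (rule continuous_imp_measurable_on_sets_lebesgue[OF smooth_imp_continuous_on])

lemma test_functionI:
  assumes "smooth \<phi>" "0 < a" "b < T" and "\<And>x. x \<le> a \<Longrightarrow> \<phi> x = 0" "\<And>x. b \<le> x \<Longrightarrow> \<phi> x = 0"
  shows "test_function T \<phi>"
proof -
  have "{t. \<phi> t \<noteq> 0} \<subseteq> {a..b}"
  proof
    fix x assume "x \<in> {t. \<phi> t \<noteq> 0}"
    then have "\<not> x \<le> a" "\<not> b \<le> x" using assms(4,5) by auto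
    then show "x \<in> {a..b}" by simp
  qed
  then have cl: "closure {t. \<phi> t \<noteq> 0} \<subseteq> {a..b}"
    by (rule closure_minimal) simp
  then have "compact (closure {t. \<phi> t \<noteq> 0})"
    by (meson bounded_closed_interval bounded_subset closed_closure compact_eq_bounded_closed)
  moreover have "{a..b} \<subseteq> {0<..<T}" using assms(2,3) by auto
  ultimately show ?thesis
    using assms(1) cl unfolding test_function_def smooth_def by blast
qed

text \<open>A smoothed distribution function of the uniform distribution on (0,h]. Its derivative is
  the density off two open transition intervals of length \<delta>, so each fixed point has the
  exact value once \<delta> is small.\<close>

definition smooth_step :: "real \<Rightarrow> real \<Rightarrow> (real \<Rightarrow> real) \<Rightarrow> bool" where
  "smooth_step h \<delta> R \<longleftrightarrow> smooth R \<and> (\<forall>z. 0 \<le> R z) \<and> (\<forall>z. R z \<le> 1) \<and> (\<forall>z. z \<le> 0 \<longrightarrow> R z = 0) \<and>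
     (\<forall>z. h + \<delta> \<le> z \<longrightarrow> R z = 1) \<and> (\<forall>z. \<bar>deriv R z\<bar> \<le> 1 / h) \<and>
     (\<forall>z. z \<notin> {0<..<\<delta>} \<longrightarrow> z \<notin> {h<..<h + \<delta>} \<longrightarrow> deriv R z = indicat_real {0<..h} z / h)"

lemma smooth_stepD:
  assumes "smooth_step h \<delta> R"
  shows "smooth R" "0 \<le> R z" "R z \<le> 1" "z \<le> 0 \<Longrightarrow> R z = 0" "h + \<delta> \<le> z \<Longrightarrow> R z = 1" "\<bar>deriv R z\<bar> \<le> 1 / h"
    "z \<notin> {0<..<\<delta>} \<Longrightarrow> z \<notin> {h<..<h + \<delta>} \<Longrightarrow> deriv R z = indicat_real {0<..h} z / h"
  using assms by (simp_all add: smooth_step_def)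

text \<open>A difference of two copies of the smooth ramp, rescaled to width \<delta> and shifted by
  h against each other, has as derivative the difference of two smooth transitions, divided by
  h.\<close>

lemma smooth_step_exists:
  assumes "0 < h" "0 < \<delta>"
  shows "\<exists>R. smooth_step h \<delta> R"
proof -
  obtain S where S: "smooth S" "\<And>x. x \<le> 0 \<Longrightarrow> S x = 0"
    "\<And>x. 0 \<le> deriv S x" "\<And>x. deriv S x \<le> 1" "\<And>x. x \<le> 0 \<Longrightarrow> deriv S x = 0" "\<And>x. 1 \<le> x \<Longrightarrow> deriv S x = 1"
    using smooth_ramp_exists by blast
  define R where "R z = \<delta> / h * S (1 / \<delta> * z + 0) + - (\<delta> / h) * S (1 / \<delta> * z + - (h / \<delta>))" for z
  have "smooth R"
    unfolding R_def[abs_def] by (intro smooth_linear_combination S(1))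
  have R: "R z = \<delta> / h * (S (z / \<delta>) - S ((z - h) / \<delta>))" for z
    by (simp add: R_def algebra_simps diff_divide_distrib)
  have DS: "(S has_real_derivative deriv S x) (at x)" for x
    by (rule smooth_has_real_derivative[OF S(1)])
  have mvt: "\<exists>\<xi>. a < \<xi> \<and> \<xi> < b \<and> S b - S a = (b - a) * deriv S \<xi>" if "a < b" for a b
    using MVT2[OF that DS] by blast
  have lt: "(z - h) / \<delta> < z / \<delta>" and diff: "z / \<delta> - (z - h) / \<delta> = h / \<delta>" for z
    using assms by (simp_all add: divide_strict_right_mono diff_divide_distrib)
  \<comment> \<open>By the mean value theorem \<open>R z\<close> is itself a value of
    \<open>deriv S\<close>, which yields the bounds 0 and 1 and the final value 1.\<close>
  have R_mvt: "\<exists>\<xi>. (z - h) / \<delta> < \<xi> \<and> \<xi> < z / \<delta> \<and> R z = deriv S \<xi>" for z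
  proof -
    obtain \<xi> where "(z - h) / \<delta> < \<xi>" "\<xi> < z / \<delta>" "S (z / \<delta>) - S ((z - h) / \<delta>) = h / \<delta> * deriv S \<xi>"
      using mvt[OF lt[of z]] diff[of z] by metis
    moreover have "\<delta> / h * (h / \<delta> * deriv S \<xi>) = deriv S \<xi>" using assms by simp
    ultimately have "R z = deriv S \<xi>"
      unfolding R by simp
    with \<open>(z - h) / \<delta> < \<xi>\<close> \<open>\<xi> < z / \<delta>\<close> show ?thesis by blast
  qed
  have dR: "deriv R z = 1 / h * (deriv S (z / \<delta>) - deriv S ((z - h) / \<delta>))" for z
  proof -
    have A: "((\<lambda>z. S ((z - c) / \<delta>)) has_real_derivative deriv S ((z - c) / \<delta>) * (1 / \<delta>)) (at z)" for c
      by (rule DERIV_chain2[OF DS]) (use assms in \<open>auto intro!: derivative_eq_intros\<close>)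
    have "(R has_real_derivative \<delta> / h * (deriv S ((z - 0) / \<delta>) * (1 / \<delta>) - deriv S ((z - h) / \<delta>) * (1 / \<delta>))) (at z)"
      using DERIV_cmult[OF DERIV_diff[OF A[of 0] A[of h]], of "\<delta> / h"] by (simp add: R[abs_def])
    then show ?thesis
      using assms by (simp add: DERIV_imp_deriv field_simps)
  qed
  have "smooth_step h \<delta> R"
    unfolding smooth_step_def
  proof (intro conjI allI impI)
    show "smooth R" by fact
    show "0 \<le> R z" for z using R_mvt[of z] S(3) by auto
    show "R z \<le> 1" for z using R_mvt[of z] S(4) by auto
    show "R z = 0" if "z \<le> 0" for z
      using that assms by (simp add: R S(2) divide_nonpos_pos)
    show "R z = 1" if "h + \<delta> \<le> z" for z
    proof -
      have "1 \<le> (z - h) / \<delta>" using that assms by (simp add: field_simps)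
      then show ?thesis using R_mvt[of z] S(6) by force
    qed
    show "\<bar>deriv R z\<bar> \<le> 1 / h" for z
    proof -
      have "\<bar>deriv S (z / \<delta>) - deriv S ((z - h) / \<delta>)\<bar> \<le> 1"
        using S(3)[of "z / \<delta>"] S(3)[of "(z - h) / \<delta>"] S(4)[of "z / \<delta>"] S(4)[of "(z - h) / \<delta>"] by linarith
      then show ?thesis using assms by (simp add: dR abs_mult field_simps)
    qed
    show "deriv R z = indicat_real {0<..h} z / h" if z: "z \<notin> {0<..<\<delta>}" "z \<notin> {h<..<h + \<delta>}" for z
    proof -
      consider "z \<le> 0" | "\<delta> \<le> z" "z \<le> h" "0 < z" | "h + \<delta> \<le> z"
        using z \<open>0 < \<delta>\<close> by force
      then show ?thesis
        by cases (use assms in \<open>simp_all add: dR S(5,6) divide_nonpos_pos\<close>)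
    qed
  qed
  then show ?thesis by blast
qed

lemma test_function_support:
  assumes "test_function T \<phi>"
  shows "\<exists>\<alpha> \<beta>. 0 < \<alpha> \<and> \<beta> < T \<and> (\<forall>t. t < \<alpha> \<or> \<beta> < t \<longrightarrow> \<phi> t = 0 \<and> deriv \<phi> t = 0)"
proof -
  let ?S = "closure {t. \<phi> t \<noteq> 0}"
  have S: "compact ?S" "?S \<subseteq> {0<..<T}"
    using assms by (auto simp: test_function_def)
  have "\<exists>\<alpha> \<beta>. 0 < \<alpha> \<and> \<beta> < T \<and> ?S \<subseteq> {\<alpha>..\<beta>}"
  proof (cases "?S = {}")
    case True
    \<comment> \<open>An empty support leaves \<open>\<phi>\<close> identically 0, and no order
      between \<alpha> and \<beta> is claimed, so any positive \<alpha> and any \<beta> below T will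
      do.\<close>
    then show ?thesis by (intro exI[of _ 1] exI[of _ "T - 1"]) simp
  next
    case False
    obtain \<alpha> where "\<alpha> \<in> ?S" "\<forall>t\<in>?S. \<alpha> \<le> t" using compact_attains_inf[OF S(1) False] by blast
    moreover obtain \<beta> where "\<beta> \<in> ?S" "\<forall>t\<in>?S. t \<le> \<beta>" using compact_attains_sup[OF S(1) False] by blast
    moreover have "0 < \<alpha>" "\<beta> < T" using subsetD[OF S(2) \<open>\<alpha> \<in> ?S\<close>] subsetD[OF S(2) \<open>\<beta> \<in> ?S\<close>] by simp_all
    ultimately show ?thesis by (intro exI[of _ \<alpha>] exI[of _ \<beta>]) (simp add: subset_iff)
  qed
  then obtain \<alpha> \<beta> where ab: "0 < \<alpha>" "\<beta> < T" "?S \<subseteq> {\<alpha>..\<beta>}" by blast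
  have zero: "\<phi> t = 0" if "t < \<alpha> \<or> \<beta> < t" for t
  proof (rule ccontr)
    assume "\<phi> t \<noteq> 0"
    then have "t \<in> ?S" by (intro subsetD[OF closure_subset]) simp
    then show False using subsetD[OF ab(3), of t] that by simp
  qed
  have "deriv \<phi> t = 0" if "t < \<alpha> \<or> \<beta> < t" for t
  proof -
    have "((\<lambda>t. 0) has_real_derivative 0) (at t)" by simp
    then have "(\<phi> has_real_derivative 0) (at t)"
      by (rule has_field_derivative_transform_within_open[of _ _ _ "{..<\<alpha>} \<union> {\<beta><..}"])
         (use that zero in auto)
    then show ?thesis by (rule DERIV_imp_deriv)
  qed
  with ab(1,2) zero show ?thesis by blast
qed

section \<open>The absolutely continuous representative\<close>

text \<open>The demands on \<open>v\<close> are those which an arbitrary weak derivative of finite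
  Morrey norm meets: the identity with test functions, and integrability of its norm.\<close>

locale weak_derivative =
  fixes T :: real and y v :: "real \<Rightarrow> 'a::banach"
  assumes T_pos: "0 < T"
    and y_int: "strongly_integrable (lebesgue_on {0<..<T}) y"
    and weak: "has_weak_derivative T y v"
    and v_int: "integrable (lebesgue_on {0<..<T}) (\<lambda>t. norm (v t))"
begin

abbreviation M :: "real measure" where "M \<equiv> lebesgue_on {0<..<T}"

sublocale complete_measure M
  by (rule complete_measure_lebesgue_on) simp

text \<open>The mean over (s,s+h], kept as an integral over all of (0,T) with a bounded multiplier:
  this is the shape in which derivatives of test functions produce it.\<close>

definition avg :: "real \<Rightarrow> real \<Rightarrow> 'a" where
  "avg s h = strong_integral M (\<lambda>x. (indicat_real {s<..s + h} x / h) *\<^sub>R y x)"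

text \<open>The scalar primitive that serves as modulus of continuity for the means, for
  \<open>w\<close> and for the final representative.\<close>

definition g :: "real \<Rightarrow> real" where
  "g t = integral {0..t} (\<lambda>x. norm (v x))"

lemma v_integrable_on: "(\<lambda>x. norm (v x)) integrable_on {0..T}"
  using integrable_on_lebesgue_on[OF v_int] by (simp add: integrable_on_open_interval_real)

lemma g_diff:
  assumes "0 \<le> s" "s \<le> t" "t \<le> T"
  shows "g t - g s = integral {s..t} (\<lambda>x. norm (v x))"
proof -
  have "(\<lambda>x. norm (v x)) integrable_on {0..t}"
    by (rule integrable_on_subinterval[OF v_integrable_on]) (use assms in auto)
  from Henstock_Kurzweil_Integration.integral_combine[OF assms(1,2) this]
  show ?thesis unfolding g_def by simp
qed

lemma continuous_on_g: "continuous_on {0..T} g"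
  unfolding g_def[abs_def] by (rule indefinite_integral_continuous_1[OF v_integrable_on])

lemma g_mono: "0 \<le> s \<Longrightarrow> s \<le> t \<Longrightarrow> t \<le> T \<Longrightarrow> g s \<le> g t"
  using g_diff[of s t]
    Henstock_Kurzweil_Integration.integral_nonneg[OF integrable_on_subinterval[OF v_integrable_on, of s t]]
  by simp

section \<open>Comparison of means through test functions\<close>

text \<open>Take \<open>\<phi> x = R (x - s) - R' (x - t)\<close> with smoothed steps, and
  \<open>a = deriv \<phi>\<close>. Both steps are 0 up to s and 1 from \<open>e + \<delta>\<close>
  on, so \<open>\<phi>\<close> lives between these points with absolute value at most 1, and the
  weak identity bounds the integral of \<open>a\<close> times \<open>y\<close> by that of the norm
  of \<open>v\<close> there.\<close>

lemma test_estimate: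
  assumes "0 < s" "s \<le> t" "0 < h" "0 < h'" "s + h \<le> e" "t + h' \<le> e" "0 < \<delta>" "e + \<delta> < T"
  obtains a where "a \<in> borel_measurable M" "\<And>x. \<bar>a x\<bar> \<le> 1 / h + 1 / h'"
    "norm (strong_integral M (\<lambda>x. a x *\<^sub>R y x)) \<le> g (e + \<delta>) - g s"
    "\<And>x. x - s \<notin> {0<..<\<delta>} \<Longrightarrow> x - s \<notin> {h<..<h + \<delta>} \<Longrightarrow> x - t \<notin> {0<..<\<delta>} \<Longrightarrow> x - t \<notin> {h'<..<h' + \<delta>} \<Longrightarrow>
      a x = indicat_real {s<..s + h} x / h - indicat_real {t<..t + h'} x / h'"
proof -
  obtain R where "smooth_step h \<delta> R" using smooth_step_exists[OF \<open>0 < h\<close> \<open>0 < \<delta>\<close>] by blast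
  note R = smooth_stepD[OF this]
  obtain R' where "smooth_step h' \<delta> R'" using smooth_step_exists[OF \<open>0 < h'\<close> \<open>0 < \<delta>\<close>] by blast
  note R' = smooth_stepD[OF this]
  define \<phi> where "\<phi> x = R (x - s) - R' (x - t)" for x
  have sm: "smooth \<phi>"
    using smooth_linear_combination[OF R(1) R'(1), of 1 1 "- s" "-1" 1 "- t"] by (simp add: \<phi>_def[abs_def])
  have test: "test_function T \<phi>"
  proof (rule test_functionI[OF sm \<open>0 < s\<close> \<open>e + \<delta> < T\<close>])
    show "\<phi> x = 0" if "x \<le> s" for x using that assms by (simp add: \<phi>_def R(4) R'(4))
    show "\<phi> x = 0" if "e + \<delta> \<le> x" for x using that assms by (simp add: \<phi>_def R(5) R'(5))
  qed
  have d: "deriv \<phi> x = deriv R (x - s) - deriv R' (x - t)" for x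
  proof -
    have A: "((\<lambda>x. S (x - c)) has_real_derivative deriv S (x - c) * 1) (at x)" if "smooth S" for S c
      by (rule DERIV_chain2[OF smooth_has_real_derivative[OF that]]) (auto intro!: derivative_eq_intros)
    show ?thesis
      using DERIV_diff[OF A[OF R(1), of s] A[OF R'(1), of t]] by (simp add: \<phi>_def[abs_def] DERIV_imp_deriv)
  qed
  obtain z where z: "has_strong_bochner_integral M (\<lambda>t. deriv \<phi> t *\<^sub>R y t) z"
    "has_strong_bochner_integral M (\<lambda>t. \<phi> t *\<^sub>R v t) (- z)"
    using weak test unfolding has_weak_derivative_def by blast
  have "ennreal (norm (- z)) \<le> L1_norm M (\<lambda>x. \<phi> x *\<^sub>R v x)"
    by (rule has_strong_bochner_integral_norm_le[OF z(2)])
  also have "\<dots> \<le> (\<integral>\<^sup>+x. ennreal (indicat_real {s<..e + \<delta>} x * norm (v x)) \<partial>M)"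
  proof (intro nn_integral_mono ennreal_leI)
    fix x
    have "\<bar>\<phi> x\<bar> \<le> indicat_real {s<..e + \<delta>} x"
    proof (cases "x \<in> {s<..e + \<delta>}")
      case True
      then show ?thesis
        using R(2,3)[of "x - s"] R'(2,3)[of "x - t"] by (simp add: \<phi>_def abs_le_iff)
    next
      case False
      then have "x \<le> s \<or> e + \<delta> \<le> x" by auto
      then show ?thesis using False assms by (auto simp: \<phi>_def R(4,5) R'(4,5))
    qed
    then show "norm (\<phi> x *\<^sub>R v x) \<le> indicat_real {s<..e + \<delta>} x * norm (v x)"
      by (simp add: mult_right_mono)
  qed
  also have "\<dots> = ennreal (\<integral>x. indicat_real {s<..e + \<delta>} x * norm (v x) \<partial>M)"
    using assms by (intro nn_integral_eq_integral integral_indicator_Ioc(1)[OF v_int]) auto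
  also have "(\<integral>x. indicat_real {s<..e + \<delta>} x * norm (v x) \<partial>M) = g (e + \<delta>) - g s"
    using assms by (subst g_diff) (simp_all add: integral_indicator_Ioc(2)[OF v_int])
  finally have nz: "norm z \<le> g (e + \<delta>) - g s"
    using g_mono[of s "e + \<delta>"] assms by simp
  show ?thesis
  proof
    show "deriv \<phi> \<in> borel_measurable M"
      by (intro smooth_borel_measurable_lebesgue_on smooth_deriv sm) simp
    show "\<bar>deriv \<phi> x\<bar> \<le> 1 / h + 1 / h'" for x
      using R(6)[of "x - s"] R'(6)[of "x - t"] unfolding d by linarith
    show "norm (strong_integral M (\<lambda>x. deriv \<phi> x *\<^sub>R y x)) \<le> g (e + \<delta>) - g s"
      using nz strong_integral_eq[OF z(1)] by simp
    fix x
    assume x: "x - s \<notin> {0<..<\<delta>}" "x - s \<notin> {h<..<h + \<delta>}" "x - t \<notin> {0<..<\<delta>}" "x - t \<notin> {h'<..<h' + \<delta>}"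
    show "deriv \<phi> x = indicat_real {s<..s + h} x / h - indicat_real {t<..t + h'} x / h'"
    proof -
      have "indicat_real {0<..c} (x - a) = indicat_real {a<..a + c} x" for a c
        by (auto simp: indicator_def)
      then show ?thesis
        unfolding d R(7)[OF x(1,2)] R'(7)[OF x(3,4)] by simp
    qed
  qed
qed

context
  fixes s :: real and h\<^sub>n :: "nat \<Rightarrow> real"
  assumes s: "0 < s" "s < T"
  defines "h\<^sub>n \<equiv> \<lambda>n. (T - s) / real (n + 2)"
begin

text \<open>The denominator n + 2 keeps \<open>s + h\<^sub>n n\<close> strictly below T already for
  n = 0.\<close>

lemma step_bounds: "0 < h\<^sub>n n" "s + h\<^sub>n n < T"
proof -
  have "(T - s) / real (n + 2) < T - s"
    using s by (simp add: divide_less_eq)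
  then show "0 < h\<^sub>n n" "s + h\<^sub>n n < T" using s by (simp_all add: h\<^sub>n_def)
qed

lemma step_lim: "h\<^sub>n \<longlonglongrightarrow> 0"
  unfolding h\<^sub>n_def
  by (rule const_divide_LIMSEQ)

lemma step_mono: "m \<le> n \<Longrightarrow> h\<^sub>n n \<le> h\<^sub>n m"
  unfolding h\<^sub>n_def using s by (intro divide_left_mono) auto

lemma g_step_lim: "(\<lambda>n. g (s + h\<^sub>n n)) \<longlonglongrightarrow> g s"
proof (rule continuous_on_tendsto_compose[OF continuous_on_g])
  show "(\<lambda>n. s + h\<^sub>n n) \<longlonglongrightarrow> s" using tendsto_add[OF tendsto_const step_lim, of s] by simp
  show "\<forall>\<^sub>F n in sequentially. s + h\<^sub>n n \<in> {0..T}"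
    using step_bounds s by (intro always_eventually allI) (simp add: less_imp_le add_nonneg_nonneg)
qed (use s in auto)

end

lemma indicator_Ioc_measurable: "indicat_real {a<..b} \<in> borel_measurable M"
  by (rule measurable_restrict_space1, rule measurable_completion) simp

text \<open>Let the smoothing width tend to 0 in \<open>test_estimate\<close>: the multipliers
  converge boundedly to the difference of the two densities, and the right side converges by
  continuity of \<open>g\<close>.\<close>

lemma avg_diff:
  assumes "0 < s" "s \<le> t" "0 < h" "0 < h'" "s + h \<le> e" "t + h' \<le> e" "e < T"
  shows "norm (avg s h - avg t h') \<le> g e - g s"
proof -
  \<comment> \<open>The step sizes introduced above, now with base point \<open>e\<close>, keep the
    smoothed supports inside (0,T).\<close>
  define \<delta> where "\<delta> n = (T - e) / real (n + 2)" for n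
  have e: "0 < e" "e < T" using assms by auto
  note \<delta> = step_bounds[OF e, folded \<delta>_def] and \<delta>_lim = step_lim[OF e, folded \<delta>_def]
  let ?P = "\<lambda>a n. a \<in> borel_measurable M \<and> (\<forall>x. \<bar>a x\<bar> \<le> 1 / h + 1 / h') \<and>
    norm (strong_integral M (\<lambda>x. a x *\<^sub>R y x)) \<le> g (e + \<delta> n) - g s \<and>
    (\<forall>x. x - s \<notin> {0<..<\<delta> n} \<longrightarrow> x - s \<notin> {h<..<h + \<delta> n} \<longrightarrow> x - t \<notin> {0<..<\<delta> n} \<longrightarrow> x - t \<notin> {h'<..<h' + \<delta> n} \<longrightarrow>
      a x = indicat_real {s<..s + h} x / h - indicat_real {t<..t + h'} x / h')"
  have "\<forall>n. \<exists>a. ?P a n"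
  proof
    fix n
    show "\<exists>a. ?P a n"
      by (rule test_estimate[OF assms(1-6) \<delta>(1,2), of n]) blast
  qed
  then have "\<exists>a. \<forall>n. ?P (a n) n" by (rule choice)
  then obtain a where a': "\<forall>n. ?P (a n) n" by blast
  then have a: "\<And>n. a n \<in> borel_measurable M" "\<And>n x. \<bar>a n x\<bar> \<le> 1 / h + 1 / h'"
    "\<And>n. norm (strong_integral M (\<lambda>x. a n x *\<^sub>R y x)) \<le> g (e + \<delta> n) - g s"
    "\<And>n x. x - s \<notin> {0<..<\<delta> n} \<Longrightarrow> x - s \<notin> {h<..<h + \<delta> n} \<Longrightarrow> x - t \<notin> {0<..<\<delta> n} \<Longrightarrow> x - t \<notin> {h'<..<h' + \<delta> n} \<Longrightarrow>
      a n x = indicat_real {s<..s + h} x / h - indicat_real {t<..t + h'} x / h'"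
    using a' by (simp_all only: simp_thms)
  let ?a = "\<lambda>x. indicat_real {s<..s + h} x / h - indicat_real {t<..t + h'} x / h'"
  have "(\<lambda>n. strong_integral M (\<lambda>x. a n x *\<^sub>R y x)) \<longlonglongrightarrow> strong_integral M (\<lambda>x. ?a x *\<^sub>R y x)"
  proof (rule strong_integral_tendsto_bounded_mult[OF y_int a(1) _ a(2)])
    show "?a \<in> borel_measurable M"
      using indicator_Ioc_measurable by (intro borel_measurable_diff borel_measurable_divide) auto
    show "\<bar>?a x\<bar> \<le> 1 / h + 1 / h'" for x
    proof -
      have "0 \<le> indicat_real A x / c" "indicat_real A x / c \<le> 1 / c" if "0 < c" for A c
        using that by (simp_all add: indicator_def)
      from this[OF assms(3), of "{s<..s + h}"] this[OF assms(4), of "{t<..t + h'}"] show ?thesis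
        by linarith
    qed
    fix x
    \<comment> \<open>The intervals shrink towards their excluded left end b, so every point c,
      including c = b, is eventually outside.\<close>
    have ev: "\<forall>\<^sub>F n in sequentially. c \<notin> {b<..<b + \<delta> n}" for c b
    proof (cases "b < c")
      case True
      then have "\<forall>\<^sub>F n in sequentially. \<delta> n < c - b"
        by (intro order_tendstoD(2)[OF \<delta>_lim]) simp
      then show ?thesis by eventually_elim auto
    qed simp
    have "\<forall>\<^sub>F n in sequentially. a n x = ?a x"
      using ev[of "x - s" 0] ev[of "x - s" h] ev[of "x - t" 0] ev[of "x - t" h']
      by eventually_elim (rule a(4), simp_all)
    then show "(\<lambda>n. a n x) \<longlonglongrightarrow> ?a x" by (rule tendsto_eventually)
  qed
  then have L: "(\<lambda>n. norm (strong_integral M (\<lambda>x. a n x *\<^sub>R y x))) \<longlonglongrightarrow> norm (strong_integral M (\<lambda>x. ?a x *\<^sub>R y x))"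
    by (rule tendsto_norm)
  have "(\<lambda>n. g (e + \<delta> n) - g s) \<longlonglongrightarrow> g e - g s"
    unfolding \<delta>_def by (intro tendsto_intros g_step_lim e)
  from LIMSEQ_le[OF L this] a(3)
  have "norm (strong_integral M (\<lambda>x. ?a x *\<^sub>R y x)) \<le> g e - g s" by blast
  moreover have "strong_integral M (\<lambda>x. ?a x *\<^sub>R y x) = avg s h - avg t h'"
  proof -
    have i: "strongly_integrable M (\<lambda>x. (indicat_real {a<..b} x / c) *\<^sub>R y x)" for a b c
    proof (rule strongly_integrable_bounded_mult[OF y_int, of _ "1 / \<bar>c\<bar>"])
      show "(\<lambda>x. indicat_real {a<..b} x / c) \<in> borel_measurable M"
        by (rule borel_measurable_divide[OF indicator_Ioc_measurable borel_measurable_const])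
    qed (simp add: indicator_def)
    show ?thesis
      unfolding avg_def by (simp only: scaleR_diff_left strong_integral_diff[OF i i])
  qed
  ultimately show ?thesis by simp
qed

text \<open>Values are recovered from means to the right of s; the limit exists for s in (0,T), the
  range on which \<open>w\<close> matters.\<close>

definition w :: "real \<Rightarrow> 'a" where
  "w s = lim (\<lambda>n. avg s ((T - s) / real (n + 2)))"

text \<open>From the index K on, all intervals lie in the K-th one, so two means differ by at most
  the increment of \<open>g\<close> over it, which is small by continuity. Completeness of the space
  supplies the limit.\<close>

lemma avg_step_lim:
  assumes s: "0 < s" "s < T"
  shows "(\<lambda>n. avg s ((T - s) / real (n + 2))) \<longlonglongrightarrow> w s"
proof -
  let ?h = "\<lambda>n. (T - s) / real (n + 2)"
  have "Cauchy (\<lambda>n. avg s (?h n))"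
  proof (rule metric_CauchyI)
    fix \<epsilon> :: real assume "0 < \<epsilon>"
    then have "\<forall>\<^sub>F n in sequentially. g (s + ?h n) < g s + \<epsilon>"
      by (intro order_tendstoD(2)[OF g_step_lim[OF s]]) simp
    then obtain K where K: "g (s + ?h K) < g s + \<epsilon>"
      by (auto simp: eventually_sequentially)
    have "dist (avg s (?h m)) (avg s (?h n)) < \<epsilon>" if "K \<le> m" "K \<le> n" for m n
    proof -
      have "norm (avg s (?h m) - avg s (?h n)) \<le> g (s + ?h K) - g s"
        by (rule avg_diff[OF s(1) order.refl step_bounds(1)[OF s] step_bounds(1)[OF s] _ _ step_bounds(2)[OF s]])
           (rule add_left_mono[OF step_mono[OF s that(1)]], rule add_left_mono[OF step_mono[OF s that(2)]])
      then show ?thesis using K by (simp only: dist_norm)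
    qed
    then show "\<exists>N. \<forall>m\<ge>N. \<forall>n\<ge>N. dist (avg s (?h m)) (avg s (?h n)) < \<epsilon>" by blast
  qed
  then show ?thesis
    unfolding w_def using Cauchy_convergent convergent_LIMSEQ_iff by blast
qed

text \<open>Of two means at the same point, one is sent to its limit while the other interval stays
  fixed.\<close>

lemma avg_w:
  assumes s: "0 < s" "s < T" and h: "0 < h" "s + h < T"
  shows "norm (avg s h - w s) \<le> g (s + h) - g s"
proof (rule LIMSEQ_le_const2)
  let ?h = "\<lambda>n. (T - s) / real (n + 2)"
  show "(\<lambda>n. norm (avg s h - avg s (?h n))) \<longlonglongrightarrow> norm (avg s h - w s)"
    by (intro tendsto_intros avg_step_lim s)
  have "\<forall>\<^sub>F n in sequentially. ?h n < h"
    by (rule order_tendstoD(2)[OF step_lim[OF s] h(1)])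
  then obtain K where K: "\<And>n. K \<le> n \<Longrightarrow> ?h n < h" by (auto simp: eventually_sequentially)
  have "norm (avg s h - avg s (?h n)) \<le> g (s + h) - g s" if "K \<le> n" for n
    by (rule avg_diff[OF s(1) order.refl h(1) step_bounds(1)[OF s] order.refl
          add_left_mono[OF less_imp_le[OF K[OF that]]] h(2)])
  then show "\<exists>N. \<forall>n\<ge>N. norm (avg s h - avg s (?h n)) \<le> g (s + h) - g s" by blast
qed

lemma w_diff:
  assumes "0 < s" "s \<le> t" "t < T"
  shows "norm (w s - w t) \<le> g t - g s"
proof (cases "s = t")
  case False
  then have "s < t" using assms by simp
  let ?h = "\<lambda>n. (T - s) / real (n + 2)" and ?k = "\<lambda>n. (T - t) / real (n + 2)"
  have st: "0 < s" "s < T" "0 < t" "t < T" using assms by auto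
  have L: "(\<lambda>n. norm (avg s (?h n) - avg t (?k n))) \<longlonglongrightarrow> norm (w s - w t)"
    by (intro tendsto_intros avg_step_lim st)
  have R: "(\<lambda>n. g (t + ?k n) - g s) \<longlonglongrightarrow> g t - g s"
    by (intro tendsto_intros g_step_lim st)
  \<comment> \<open>The hull of the two intervals is to end at \<open>t + ?k n\<close>, so the first
    interval must end before it. This holds once its length is below \<open>t - s\<close>, hence the
    separate treatment of \<open>s = t\<close>.\<close>
  have "\<forall>\<^sub>F n in sequentially. ?h n < t - s"
    using \<open>s < t\<close> by (intro order_tendstoD(2)[OF step_lim[OF st(1,2)]]) simp
  then obtain N where N: "\<forall>n\<ge>N. ?h n < t - s" by (auto simp: eventually_sequentially)
  have "norm (avg s (?h n) - avg t (?k n)) \<le> g (t + ?k n) - g s" if "N \<le> n" for n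
  proof (rule avg_diff)
    show "s + ?h n \<le> t + ?k n"
      using N that step_bounds(1)[OF st(3,4), of n] by (metis add.commute add_increasing2 less_diff_eq less_imp_le)
  qed (use assms step_bounds[OF st(1,2), of n] step_bounds[OF st(3,4), of n] in auto)
  then show ?thesis by (intro LIMSEQ_le[OF L R]) blast
qed simp

end

context weak_derivative
begin

lemma w_diff_abs:
  assumes "s \<in> {0<..<T}" "t \<in> {0<..<T}"
  shows "norm (w t - w s) \<le> \<bar>g t - g s\<bar>"
proof (cases s t rule: le_cases)
  case le
  then show ?thesis using w_diff[of s t] assms by (simp add: norm_minus_commute)
next
  case ge
  then show ?thesis using w_diff[of t s] assms by simp
qed

lemma uniformly_continuous_on_w: "uniformly_continuous_on {0<..<T} w"
proof -
  have g: "uniformly_continuous_on {0..T} g"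
    by (rule compact_uniformly_continuous[OF continuous_on_g]) simp
  show ?thesis
    unfolding uniformly_continuous_on_def
  proof (intro allI impI)
    fix e :: real assume "0 < e"
    with g obtain d where d: "d > 0" "\<And>x x'. x \<in> {0..T} \<Longrightarrow> x' \<in> {0..T} \<Longrightarrow> dist x' x < d \<Longrightarrow> dist (g x') (g x) < e"
      unfolding uniformly_continuous_on_def by metis
    have "dist (w x') (w x) < e" if "x \<in> {0<..<T}" "x' \<in> {0<..<T}" "dist x' x < d" for x x'
      using w_diff_abs[OF that(1,2)] d(2)[of x x'] that unfolding dist_norm by simp
    with d(1) show "\<exists>d>0. \<forall>x\<in>{0<..<T}. \<forall>x'\<in>{0<..<T}. dist x' x < d \<longrightarrow> dist (w x') (w x) < e" by blast
  qed
qed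

lemma integrable_const: "integrable M (\<lambda>x. c :: real)"
  by (rule finite_measure.integrable_const[OF finite_measure_Ioo])

lemma w_int: "strongly_integrable M w"
proof (rule strongly_integrableI[OF _ integrable_const])
  show "strongly_measurable M w"
    by (intro continuous_on_imp_strongly_measurable uniformly_continuous_imp_continuous uniformly_continuous_on_w)
  \<comment> \<open>Comparison with the midpoint, since no values at the end points are available
    yet.\<close>
  have "norm (w x) \<le> norm (w (T / 2)) + g T" if "x \<in> {0<..<T}" for x
  proof -
    have "norm (w x - w (T / 2)) \<le> \<bar>g x - g (T / 2)\<bar>"
      by (rule w_diff_abs) (use that T_pos in auto)
    also have "\<dots> \<le> g T"
      using g_mono[of 0 x] g_mono[of 0 "T / 2"] g_mono[of x T] g_mono[of "T / 2" T] that T_pos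
      by (simp add: g_def[of 0] abs_le_iff)
    finally show ?thesis using norm_triangle_sub[of "w x" "w (T / 2)"] by linarith
  qed
  then show "AE x in M. norm (w x) \<le> norm (w (T / 2)) + g T" by (intro AE_I2) simp
qed

section \<open>Identification of \<open>w\<close> with \<open>y\<close>\<close>

abbreviation f :: "real \<Rightarrow> 'a" where "f \<equiv> \<lambda>x. y x - w x"

lemma f_int: "strongly_integrable M f"
  by (rule strongly_integrable_diff[OF y_int w_int])

text \<open>Cut off by half-lines and defined for every real t, so that vanishing of
  \<open>F\<close> is literally the half-line criterion.\<close>

definition F :: "real \<Rightarrow> 'a" where
  "F t = strong_integral M (\<lambda>x. indicat_real {..t} x *\<^sub>R f x)"

lemma indicator_int: "strongly_integrable M u \<Longrightarrow> A \<in> sets borel \<Longrightarrow> strongly_integrable M (\<lambda>x. indicat_real A x *\<^sub>R u x)"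
  by (rule strongly_integrable_indicator) (auto simp: sets_restrict_space)

lemma F_diff:
  assumes "s \<le> t" shows "F t - F s = strong_integral M (\<lambda>x. indicat_real {s<..t} x *\<^sub>R f x)"
proof -
  have "F t - F s = strong_integral M (\<lambda>x. indicat_real {..t} x *\<^sub>R f x - indicat_real {..s} x *\<^sub>R f x)"
    unfolding F_def by (intro strong_integral_diff[symmetric] indicator_int f_int) simp_all
  also have "(\<lambda>x. indicat_real {..t} x *\<^sub>R f x - indicat_real {..s} x *\<^sub>R f x) = (\<lambda>x. indicat_real {s<..t} x *\<^sub>R f x)"
    using assms by (auto simp: indicator_def)
  finally show ?thesis .
qed

lemma strong_integral_indicator_Ioc_le:
  assumes "strongly_integrable M u" "0 \<le> s" "t \<le> T"
  shows "norm (strong_integral M (\<lambda>x. indicat_real {s<..t} x *\<^sub>R u x)) \<le> integral {s..t} (\<lambda>x. norm (u x))"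
  using norm_strong_integral_le[OF indicator_int[OF assms(1), of "{s<..t}"]]
    integral_indicator_Ioc(2)[OF strongly_integrable_norm[OF assms(1)] assms(2,3)]
  by simp

lemma continuous_on_F: "continuous_on {0..T} F"
proof -
  let ?k = "\<lambda>t. integral {0..t} (\<lambda>x. norm (f x))"
  have int: "(\<lambda>x. norm (f x)) integrable_on {0..T}"
    using integrable_on_lebesgue_on[OF strongly_integrable_norm[OF f_int]]
    by (simp add: integrable_on_open_interval_real)
  have k: "continuous_on {0..T} ?k" by (rule indefinite_integral_continuous_1[OF int])
  have le: "norm (F t - F s) \<le> ?k t - ?k s" if "0 \<le> s" "s \<le> t" "t \<le> T" for s t
  proof -
    have "(\<lambda>x. norm (f x)) integrable_on {0..t}"
      by (rule integrable_on_subinterval[OF int]) (use that in auto)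
    from Henstock_Kurzweil_Integration.integral_combine[OF that(1,2) this]
    show ?thesis
      using F_diff[OF that(2)] strong_integral_indicator_Ioc_le[OF f_int that(1,3)] by simp
  qed
  have le': "dist (F t) (F s) \<le> dist (?k t) (?k s)" if "s \<in> {0..T}" "t \<in> {0..T}" for s t
    using le[of s t] le[of t s] that unfolding dist_norm
    by (cases s t rule: le_cases) (simp_all add: norm_minus_commute[of "F t" "F s"])
  show ?thesis
    unfolding continuous_on_iff
  proof (intro ballI allI impI)
    fix x e :: real assume x: "x \<in> {0..T}" and "0 < e"
    then have "\<exists>d>0. \<forall>x'\<in>{0..T}. dist x' x < d \<longrightarrow> dist (?k x') (?k x) < e"
      using k[unfolded continuous_on_iff] by blast
    then show "\<exists>d>0. \<forall>x'\<in>{0..T}. dist x' x < d \<longrightarrow> dist (F x') (F x) < e"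
      using le'[OF x] by (meson le_less_trans)
  qed
qed

text \<open>Over (s,t] both functions are compared with the constant \<open>w s\<close>: the mean of
  \<open>y\<close> differs from it by at most \<open>g t - g s\<close>, and so does every value of
  \<open>w\<close>. The small factor besides the length is what makes the derivative vanish at every
  point.\<close>

lemma F_quadratic:
  assumes "0 < s" "s < t" "t < T"
  shows "norm (F t - F s) \<le> 2 * (t - s) * (g t - g s)"
proof -
  let ?i = "indicat_real {s<..t}"
  have cint: "strongly_integrable M (\<lambda>x. c)" for c :: 'a
    by (rule strongly_integrableI[OF strongly_measurable_const integrable_const, of _ "norm c"]) simp
  have iy: "strongly_integrable M (\<lambda>x. ?i x *\<^sub>R y x)" and iw: "strongly_integrable M (\<lambda>x. ?i x *\<^sub>R w x)"
    and iws: "strongly_integrable M (\<lambda>x. ?i x *\<^sub>R w s)"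
    by (intro indicator_int y_int w_int cint; simp)+
  have Y: "strong_integral M (\<lambda>x. ?i x *\<^sub>R y x) = (t - s) *\<^sub>R avg s (t - s)"
  proof -
    have "avg s (t - s) = strong_integral M (\<lambda>x. (1 / (t - s)) *\<^sub>R (?i x *\<^sub>R y x))"
      by (simp add: avg_def)
    also have "\<dots> = (1 / (t - s)) *\<^sub>R strong_integral M (\<lambda>x. ?i x *\<^sub>R y x)"
      by (rule strong_integral_scaleR[OF iy])
    finally show ?thesis using assms by simp
  qed
  have W: "strong_integral M (\<lambda>x. ?i x *\<^sub>R w s) = (t - s) *\<^sub>R w s"
  proof (rule strong_integral_eq)
    have "integrable M (\<lambda>x. ?i x * 1)" "(\<integral>x. ?i x * 1 \<partial>M) = integral {s..t} (\<lambda>x. 1)"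
      using assms integral_indicator_Ioc[OF integrable_const[of 1], of s t] by simp_all
    then have *: "integrable M ?i" "(\<integral>x. ?i x \<partial>M) = t - s"
      using assms by simp_all
    show "has_strong_bochner_integral M (\<lambda>x. ?i x *\<^sub>R w s) ((t - s) *\<^sub>R w s)"
      using has_strong_bochner_integral_scaleR_const[OF *(1), of "w s"] unfolding *(2) .
  qed
  have n1: "norm (strong_integral M (\<lambda>x. ?i x *\<^sub>R w x) - (t - s) *\<^sub>R w s) \<le> (t - s) * (g t - g s)"
  proof -
    have "norm (strong_integral M (\<lambda>x. ?i x *\<^sub>R w x) - (t - s) *\<^sub>R w s)
        = norm (strong_integral M (\<lambda>x. ?i x *\<^sub>R w x - ?i x *\<^sub>R w s))"
      by (simp only: strong_integral_diff[OF iw iws] W)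
    also have "\<dots> \<le> (\<integral>x. norm (?i x *\<^sub>R w x - ?i x *\<^sub>R w s) \<partial>M)"
      by (rule norm_strong_integral_le[OF strongly_integrable_diff[OF iw iws]])
    also have "\<dots> \<le> (\<integral>x. ?i x * (g t - g s) \<partial>M)"
    proof (rule Bochner_Integration.integral_mono)
      show "integrable M (\<lambda>x. norm (?i x *\<^sub>R w x - ?i x *\<^sub>R w s))"
        by (rule strongly_integrable_norm[OF strongly_integrable_diff[OF iw iws]])
      show "integrable M (\<lambda>x. ?i x * (g t - g s))"
        using assms by (intro integral_indicator_Ioc(1)[OF integrable_const]) simp_all
      show "norm (?i x *\<^sub>R w x - ?i x *\<^sub>R w s) \<le> ?i x * (g t - g s)" for x
      proof (cases "x \<in> {s<..t}")
        case True
        then have "norm (w s - w x) \<le> g x - g s" "g x \<le> g t"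
          using assms by (auto intro!: w_diff g_mono)
        then show ?thesis using True by (simp add: norm_minus_commute)
      qed simp
    qed
    also have "\<dots> = (t - s) * (g t - g s)"
      using assms by (subst integral_indicator_Ioc(2)[OF integrable_const]) simp_all
    finally show ?thesis .
  qed
  have n2: "norm ((t - s) *\<^sub>R avg s (t - s) - (t - s) *\<^sub>R w s) \<le> (t - s) * (g t - g s)"
    using avg_w[of s "t - s"] assms by (simp flip: scaleR_diff_right add: mult_left_mono)
  have eq: "F t - F s = ((t - s) *\<^sub>R avg s (t - s) - (t - s) *\<^sub>R w s) - (strong_integral M (\<lambda>x. ?i x *\<^sub>R w x) - (t - s) *\<^sub>R w s)"
    using strong_integral_diff[OF iy iw] F_diff[of s t] assms by (simp add: Y scaleR_diff_right)
  have "norm (F t - F s) \<le> (t - s) * (g t - g s) + (t - s) * (g t - g s)"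
    unfolding eq by (rule order_trans[OF norm_triangle_ineq4 add_mono[OF n2 n1]])
  then show ?thesis by (simp only: mult_2 distrib_right)
qed

lemma F_has_derivative_0:
  assumes "t \<in> {0<..<T}"
  shows "(F has_derivative (\<lambda>h. 0)) (at t)"
  unfolding has_derivative_at
proof
  have "t \<in> interior {0..T}" using assms by simp
  then have "isCont g t"
    using continuous_on_g continuous_on_interior by blast
  then have g: "((\<lambda>h. 2 * \<bar>g (t + h) - g t\<bar>) \<longlongrightarrow> 0) (at 0)"
    unfolding isCont_iff by (intro tendsto_eq_intros) auto
  show "((\<lambda>h. norm (F (t + h) - F t - 0) / norm h) \<longlongrightarrow> 0) (at 0)"
  proof (rule Lim_null_comparison[OF _ g])
    have "\<forall>\<^sub>F h in at 0. t + h \<in> {0<..<T}"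
    proof (rule topological_tendstoD)
      show "((\<lambda>h. t + h) \<longlongrightarrow> t) (at 0)" by (intro tendsto_eq_intros) auto
    qed (use assms in auto)
    then show "\<forall>\<^sub>F h in at 0. norm (norm (F (t + h) - F t - 0) / norm h) \<le> 2 * \<bar>g (t + h) - g t\<bar>"
    proof eventually_elim
      case (elim h)
      have "norm (F (t + h) - F t) \<le> 2 * \<bar>h\<bar> * \<bar>g (t + h) - g t\<bar>"
      proof (cases h "0::real" rule: linorder_cases)
        case less
        then have "norm (F t - F (t + h)) \<le> 2 * (t - (t + h)) * (g t - g (t + h))"
          using F_quadratic[of "t + h" t] assms elim by simp
        also have "\<dots> \<le> 2 * \<bar>h\<bar> * \<bar>g (t + h) - g t\<bar>"
          using less g_mono[of "t + h" t] assms elim by (intro mult_mono) auto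
        finally show ?thesis by (simp add: norm_minus_commute)
      next
        case greater
        then have "norm (F (t + h) - F t) \<le> 2 * (t + h - t) * (g (t + h) - g t)"
          using F_quadratic[of t "t + h"] assms elim by simp
        also have "\<dots> \<le> 2 * \<bar>h\<bar> * \<bar>g (t + h) - g t\<bar>"
          using greater g_mono[of t "t + h"] assms elim by (intro mult_mono) auto
        finally show ?thesis .
      qed simp
      then show ?case
        by (cases "h = 0") (simp_all add: pos_divide_le_eq mult_ac)
    qed
  qed
qed simp

lemma F_eq_0: "F t = 0"
proof -
  have zero: "F t = 0" if "t \<le> 0" for t
  proof -
    have "strong_integral M (\<lambda>x. indicat_real {..t} x *\<^sub>R f x) = strong_integral M (\<lambda>x. 0)"
      by (rule strong_integral_cong_AE[OF indicator_int[OF f_int], symmetric]) (use that in \<open>auto intro!: AE_I2\<close>)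
    then show ?thesis unfolding F_def by (simp add: strong_integral_eq[OF has_strong_bochner_integral_0])
  qed
  have mid: "F t = 0" if "t \<in> {0..T}" for t
  proof (rule has_derivative_zero_unique_strong_interval[where k = "{0, T}" and f = F and a = 0 and b = T])
    show "(F has_derivative (\<lambda>h. 0)) (at x within {0..T})" if "x \<in> {0..T} - {0, T}" for x
      by (rule has_derivative_at_withinI, rule F_has_derivative_0) (use that in auto)
  qed (use continuous_on_F zero that in auto)
  \<comment> \<open>The measure lives on (0,T), so a half-line ending at or beyond T cuts off
    nothing.\<close>
  have late: "F t = F T" if "T \<le> t" for t
    unfolding F_def
    by (rule strong_integral_cong_AE[OF indicator_int[OF f_int]])
       (use that in \<open>auto intro!: AE_I2 simp: indicator_def\<close>)
  consider "t \<le> 0" | "t \<in> {0..T}" | "T \<le> t" by fastforce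
  then show ?thesis
  proof cases
    case 3
    then show ?thesis using late mid[of T] T_pos by simp
  qed (use zero mid in blast)+
qed

lemma AE_w_eq_y: "AE t in M. w t = y t"
proof -
  have "AE t in M. f t = 0"
  proof (rule AE_eq_0_if_strong_integral_atMost_eq_0[OF _ f_int])
    show "strong_integral M (\<lambda>x. indicat_real {..a} x *\<^sub>R f x) = 0" for a
      using F_eq_0[of a] by (simp add: F_def)
    have "strong_integral M f = F T"
      unfolding F_def
      by (rule strong_integral_cong_AE[OF indicator_int[OF f_int]]) (auto intro!: AE_I2 simp: indicator_def)
    then show "strong_integral M f = 0" by (simp add: F_eq_0)
  qed simp
  then show ?thesis by eventually_elim simp
qed

text \<open>Uniform continuity extends \<open>w\<close> to the closed interval. The estimate is
  known at interior points only; it reaches the ends by moving s and t slightly towards T/2 and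
  passing to the limit.\<close>

lemma representative_exists:
  obtains w' where "continuous_on {0..T} w'" "AE t in M. w' t = y t"
    "\<And>s t. 0 \<le> s \<Longrightarrow> s \<le> t \<Longrightarrow> t \<le> T \<Longrightarrow> norm (w' t - w' s) \<le> integral {s..t} (\<lambda>x. norm (v x))"
proof -
  obtain w' where w': "uniformly_continuous_on (closure {0<..<T}) w'" "\<And>x. x \<in> {0<..<T} \<Longrightarrow> w x = w' x"
    using uniformly_continuous_on_extension_on_closure[OF uniformly_continuous_on_w] by metis
  have cont: "continuous_on {0..T} w'"
    using uniformly_continuous_imp_continuous[OF w'(1)] T_pos by simp
  show ?thesis
  proof
    show "continuous_on {0..T} w'" by fact
    show "AE t in M. w' t = y t"
      using AE_w_eq_y AE_space by eventually_elim (use w'(2) in simp)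
    fix s t assume st: "0 \<le> s" "s \<le> t" "t \<le> T"
    \<comment> \<open>A convex combination with T/2: it maps [0,T] into the open interval, preserves
      order and tends to x. The n + 2 keeps both weights positive.\<close>
    define c where "c n x = x + (T / 2 - x) / real (n + 2)" for n x
    have c_lim: "(\<lambda>n. c n x) \<longlonglongrightarrow> x" for x
    proof -
      have "(\<lambda>n. (T / 2 - x) / real (n + 2)) \<longlonglongrightarrow> 0"
        by (rule const_divide_LIMSEQ)
      from tendsto_add[OF tendsto_const this, of x] show ?thesis by (simp add: c_def)
    qed
    have c_convex: "c n x = (1 - 1 / real (n + 2)) * x + 1 / real (n + 2) * (T / 2)" for n x
      by (simp add: c_def diff_divide_distrib left_diff_distrib del: of_nat_add)
    have l: "0 < 1 / real (n + 2)" "1 / real (n + 2) < 1" for n by simp_all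
    have c_in: "c n x \<in> {0<..<T}" if "0 \<le> x" "x \<le> T" for n x
    proof -
      have "0 < c n x" unfolding c_convex
        using l[of n] that T_pos by (intro add_nonneg_pos mult_nonneg_nonneg mult_pos_pos) auto
      moreover have "c n x \<le> (1 - 1 / real (n + 2)) * T + 1 / real (n + 2) * (T / 2)"
        unfolding c_convex using l[of n] that by (intro add_right_mono mult_left_mono) auto
      moreover have "\<dots> < (1 - 1 / real (n + 2)) * T + 1 / real (n + 2) * T"
        using l[of n] T_pos by (intro add_strict_left_mono mult_strict_left_mono) auto
      ultimately show ?thesis by (simp add: algebra_simps)
    qed
    have c_mono: "c n s \<le> c n t" for n
      unfolding c_convex using l[of n] st by (intro add_right_mono mult_left_mono) auto
    have lim: "(\<lambda>n. h (c n x)) \<longlonglongrightarrow> h x" if "continuous_on {0..T} h" "0 \<le> x" "x \<le> T" for x and h :: "real \<Rightarrow> 'z::metric_space"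
      by (rule continuous_on_tendsto_compose[OF that(1) c_lim])
         (use c_in[OF that(2,3)] that in \<open>auto intro!: always_eventually simp: less_imp_le\<close>)
    have "norm (w' (c n t) - w' (c n s)) \<le> g (c n t) - g (c n s)" for n
      using w_diff[of "c n s" "c n t"] c_mono c_in[of s] c_in[of t] st w'(2) by (simp add: norm_minus_commute)
    moreover have "(\<lambda>n. norm (w' (c n t) - w' (c n s))) \<longlonglongrightarrow> norm (w' t - w' s)"
      by (intro tendsto_intros lim cont) (use st in auto)
    moreover have "(\<lambda>n. g (c n t) - g (c n s)) \<longlonglongrightarrow> g t - g s"
      by (intro tendsto_intros lim continuous_on_g) (use st in auto)
    ultimately have "norm (w' t - w' s) \<le> g t - g s"
      by (intro LIMSEQ_le) auto
    then show "norm (w' t - w' s) \<le> integral {s..t} (\<lambda>x. norm (v x))"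
      using g_diff[OF st] by simp
  qed
qed

end

section \<open>The trace estimate\<close>

text \<open>Only the products of \<open>v\<close> with test functions are known to be strongly
  measurable. Dividing their norms by bumps that are positive on (d_n, T - d_n) recovers the norm of
  \<open>v\<close> there, and every point of (0,T) is reached from some n on.\<close>

lemma weak_derivative_norm_measurable:
  assumes "0 < T" "has_weak_derivative T y v"
  shows "(\<lambda>t. norm (v t)) \<in> borel_measurable (lebesgue_on {0<..<T})"
proof -
  let ?M = "lebesgue_on {0<..<T}"
  interpret complete_measure ?M by (rule complete_measure_lebesgue_on) simp
  \<comment> \<open>With n + 3 in the denominator, the two ends that are cut off are together
    shorter than T.\<close>
  define d where "d n = T / real (n + 3)" for n
  have d: "0 < d n" "2 * d n < T" for n
  proof -
    have "2 / real (n + 3) < 1" by simp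
    from mult_strict_left_mono[OF this assms(1)]
    show "0 < d n" "2 * d n < T" using assms(1) by (simp_all add: d_def mult.commute)
  qed
  define \<phi> where "\<phi> n x = bump_fun 1 0 ((x - d n) / (T - 2 * d n))" for n x
  have zero: "\<phi> n x = 0" if "x \<le> d n \<or> T - d n \<le> x" for n x
  proof -
    have "\<not> (0 < (x - d n) / (T - 2 * d n) \<and> (x - d n) / (T - 2 * d n) < 1)"
      using that d[of n] by (auto simp: zero_less_divide_iff divide_less_eq)
    then show ?thesis unfolding \<phi>_def bump_fun_def by simp
  qed
  have pos: "0 < \<phi> n x" if "d n < x" "x < T - d n" for n x
    unfolding \<phi>_def by (rule bump_fun_1_pos) (use that d[of n] in \<open>simp_all add: divide_less_eq\<close>)
  have sm: "smooth (\<phi> n)" for n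
    using smooth_linear_combination[OF smooth_bump_fun smooth_bump_fun,
        of 1 1 0 "1 / (T - 2 * d n)" "- (d n / (T - 2 * d n))" 0 1 0 0 0]
    by (simp add: \<phi>_def[abs_def] diff_divide_distrib)
  have meas: "(\<lambda>x. norm (\<phi> n x *\<^sub>R v x) / \<phi> n x) \<in> borel_measurable ?M" for n
  proof -
    have "test_function T (\<phi> n)"
      by (rule test_functionI[OF sm, of "d n" "T - d n"]) (use d[of n] zero in auto)
    then have "strongly_measurable ?M (\<lambda>x. \<phi> n x *\<^sub>R v x)"
      using assms(2) unfolding has_weak_derivative_def has_strong_bochner_integral_def by blast
    then show ?thesis
      by (intro borel_measurable_divide strongly_measurable_norm
          smooth_borel_measurable_lebesgue_on sm) simp_all
  qed
  have d_lim: "d \<longlonglongrightarrow> 0"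
    unfolding d_def[abs_def]
    by (rule const_divide_LIMSEQ)
  show ?thesis
  proof (rule borel_measurable_LIMSEQ_metric[OF meas])
    fix x assume "x \<in> space ?M"
    then have x: "0 < x" "0 < T - x" by auto
    have "\<forall>\<^sub>F n in sequentially. norm (\<phi> n x *\<^sub>R v x) / \<phi> n x = norm (v x)"
      using order_tendstoD(2)[OF d_lim x(1)] order_tendstoD(2)[OF d_lim x(2)]
    proof eventually_elim
      case (elim n)
      then have "0 < \<phi> n x" by (intro pos) auto
      then show ?case by simp
    qed
    then show "(\<lambda>n. norm (\<phi> n x *\<^sub>R v x) / \<phi> n x) \<longlonglongrightarrow> norm (v x)"
      by (rule tendsto_eventually)
  qed
qed

lemma AE_lebesgue_on_Ioo_ex:
  fixes r T :: real
  assumes "AE x in lebesgue_on {0<..<T}. P x" "0 < r" "r \<le> T"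
  obtains x where "x \<in> {0<..<r}" "P x"
proof -
  have "\<exists>x\<in>{0<..<r}. P x"
  proof (rule ccontr)
    assume neg: "\<not> (\<exists>x\<in>{0<..<r}. P x)"
    have "AE x in lebesgue. x \<in> {0<..<T} \<longrightarrow> P x"
      using assms(1) by (subst (asm) AE_restrict_space_iff) auto
    then have "{x. \<not> (x \<in> {0<..<T} \<longrightarrow> P x)} \<in> null_sets lebesgue"
      by (simp add: completion.AE_iff_null_sets)
    then have "negligible {x. \<not> (x \<in> {0<..<T} \<longrightarrow> P x)}"
      by (simp add: negligible_iff_null_sets)
    then have "negligible {0<..<r}"
      by (rule negligible_subset) (use neg assms(3) in auto)
    then show False
      using open_not_negligible[of "{0<..<r}"] assms(2) by simp
  qed
  then show ?thesis using that by blast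
qed

text \<open>Lets a continuous function be evaluated at 0 through relations that hold only almost
  everywhere.\<close>

lemma AE_Ioo_sequence:
  fixes T :: real
  assumes "AE t in lebesgue_on {0<..<T}. P t" "0 < T"
  shows "\<exists>t::nat \<Rightarrow> real. t \<longlonglongrightarrow> 0 \<and> (\<forall>n. t n \<in> {0<..<T}) \<and> (\<forall>n. P (t n))"
proof -
  have le: "T / real (n + 1) \<le> T" for n
    using assms(2) by (simp add: divide_le_eq)
  have "\<exists>t. t \<in> {0<..<T / real (n + 1)} \<and> P t" for n
    by (rule AE_lebesgue_on_Ioo_ex[OF assms(1) _ le]) (use assms(2) in auto)
  then have "\<exists>t. \<forall>n. t n \<in> {0<..<T / real (n + 1)} \<and> P (t n)"
    by (intro choice allI)
  then obtain t where t: "\<And>n. t n \<in> {0<..<T / real (n + 1)}" "\<And>n. P (t n)" by blast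
  have "norm (t n) \<le> T / real (n + 1)" for n
    using t(1)[of n] by simp
  then have lim: "t \<longlonglongrightarrow> 0"
    by (rule Lim_null_comparison[OF always_eventually[OF allI] const_divide_LIMSEQ])
  have "t n \<in> {0<..<T}" for n
    using t(1)[of n] le[of n] by simp
  with lim t(2) show ?thesis by blast
qed

section \<open>Consequences of a finite Morrey norm\<close>

text \<open>If a > c then a^(1-p) is at most c^(1-p), as the exponent is negative. After
  integration, the free parameter c balances the length of the domain against the integral of the
  p-th power.\<close>

lemma le_add_powr:
  fixes a c p :: real
  assumes "0 \<le> a" "0 < c" "1 < p"
  shows "a \<le> c + c powr (1 - p) * a powr p"
proof (cases "a \<le> c")
  case False
  then have "a = a powr (1 - p) * a powr p"
    using assms by (simp flip: powr_add)
  also have "\<dots> \<le> c powr (1 - p) * a powr p"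
    using False assms by (intro mult_right_mono powr_mono2') auto
  finally show ?thesis using assms by simp
next
  case True
  have "0 \<le> c powr (1 - p) * a powr p" by simp
  with True show ?thesis by linarith
qed

lemma morrey_norm_bound:
  assumes "morrey_norm p l T f \<le> ennreal K" "0 \<le> K" "0 < r" "r \<le> T" "0 < p"
  shows "(\<integral>\<^sup>+t. ennreal (norm (f t) powr p) * indicator {0<..<r} t \<partial>lebesgue) \<le> ennreal (K powr p * r powr l)"
proof -
  let ?J = "\<integral>\<^sup>+t. ennreal (norm (f t) powr p) * indicator {0<..<r} t \<partial>lebesgue"
  have "ennreal (measure lebesgue {0<..<r} powr (- (l / p))) * enn_powr ?J (1 / p) \<le> morrey_norm p l T f"
    unfolding morrey_norm_def by (rule SUP_upper) (use assms in \<open>auto simp: is_interval_1\<close>)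
  then have le: "ennreal (r powr (- (l / p))) * enn_powr ?J (1 / p) \<le> ennreal K"
    using assms by (auto intro: order_trans)
  show ?thesis
  proof (cases ?J)
    \<comment> \<open>An infinite integral would make the norm infinite, as the weight is
      positive.\<close>
    case top
    then have "ennreal (r powr (- (l / p))) * top \<le> ennreal K"
      using le by (simp add: enn_powr_def)
    then show ?thesis
      using assms(3) by (simp add: ennreal_mult_top top_unique)
  next
    case (real x)
    then have "ennreal (r powr (- (l / p)) * x powr (1 / p)) \<le> ennreal K"
      using le by (simp add: enn_powr_def ennreal_mult)
    then have "r powr (- (l / p)) * x powr (1 / p) \<le> K"
      using assms(2) by simp
    then have "r powr (l / p) * (r powr (- (l / p)) * x powr (1 / p)) \<le> r powr (l / p) * K"
      by (intro mult_left_mono) auto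
    then have "x powr (1 / p) \<le> r powr (l / p) * K"
      using assms(3) by (simp add: powr_minus field_simps)
    then have "(x powr (1 / p)) powr p \<le> (r powr (l / p) * K) powr p"
      using assms(5) by (intro powr_mono2) auto
    then have "x \<le> K powr p * r powr l"
      using real(1) assms by (simp add: powr_powr powr_mult mult.commute)
    then show ?thesis using real by (simp add: ennreal_leI)
  qed
qed

lemma morrey_integrable:
  assumes meas: "(\<lambda>t. norm (f t)) \<in> borel_measurable (lebesgue_on {0<..<T})"
    and K: "morrey_norm p l T f \<le> ennreal K" "0 \<le> K" and "0 < T" "1 < p"
  shows "integrable (lebesgue_on {0<..<T}) (\<lambda>t. norm (f t) powr p)"
    and "integrable (lebesgue_on {0<..<T}) (\<lambda>t. norm (f t))"
proof -
  let ?M = "lebesgue_on {0<..<T}"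
  have "(\<integral>\<^sup>+t. ennreal (norm (norm (f t) powr p)) \<partial>?M)
      = (\<integral>\<^sup>+t. ennreal (norm (f t) powr p) * indicator {0<..<T} t \<partial>lebesgue)"
    by (subst nn_integral_restrict_space) auto
  also have "\<dots> \<le> ennreal (K powr p * T powr l)"
    using assms by (intro morrey_norm_bound) auto
  also have "\<dots> < \<infinity>" by simp
  finally show int: "integrable ?M (\<lambda>t. norm (f t) powr p)"
    using meas by (intro integrableI_bounded powr_real_measurable) auto
  have "finite_measure ?M" by (rule finite_measure_Ioo)
  then have "integrable ?M (\<lambda>x. 1 + norm (f x) powr p)"
    using int finite_measure.integrable_const by (intro Bochner_Integration.integrable_add) blast+
  then show "integrable ?M (\<lambda>t. norm (f t))"
  proof (rule Bochner_Integration.integrable_bound[OF _ meas])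
    show "AE x in ?M. norm (norm (f x)) \<le> norm (1 + norm (f x) powr p)"
      using le_add_powr[of "norm (f _)" 1 p] \<open>1 < p\<close> by (intro AE_I2) simp
  qed
qed

lemma morrey_integral_le:
  assumes meas: "(\<lambda>t. norm (f t)) \<in> borel_measurable (lebesgue_on {0<..<T})"
    and K: "morrey_norm p l T f \<le> ennreal K" "0 \<le> K" and "0 < r" "r \<le> T" "1 < p"
  shows "integral {0..r} (\<lambda>t. norm (f t) powr p) \<le> K powr p * r powr l"
proof -
  let ?h = "\<lambda>t. norm (f t) powr p"
  have "integrable (lebesgue_on {0<..<T}) ?h"
    using assms by (intro morrey_integrable(1)[OF meas K]) auto
  then have "?h integrable_on {0<..<T}"
    by (rule integrable_on_lebesgue_on) simp
  then have "?h integrable_on {0..T}" by (simp add: integrable_on_open_interval_real)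
  then have "?h integrable_on {0..r}"
    by (rule integrable_on_subinterval) (use assms in auto)
  then have "?h integrable_on {0<..<r}" by (simp add: integrable_on_open_interval_real)
  then have "(\<integral>\<^sup>+t. ennreal (?h t) * indicator {0<..<r} t \<partial>lebesgue) = ennreal (integral {0<..<r} ?h)"
    unfolding nn_integral_completion
    by (intro nn_integral_has_integral_lebesgue'[OF _ integrable_integral]) auto
  then have "ennreal (integral {0<..<r} ?h) \<le> ennreal (K powr p * r powr l)"
    using morrey_norm_bound[OF K, of r] assms by simp
  then have "integral {0<..<r} ?h \<le> K powr p * r powr l"
    using assms(3) by simp
  then show ?thesis by (simp add: integral_open_interval_real)
qed

text \<open>Both uses of Hoelder's inequality are replaced by the bound \<open>a \<le> c + c\<^bsup>1-p\<^esup> a\<^bsup>p\<^esup>\<close>, at the price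
  of a factor 2; here \<open>c = K r\<^bsup>\<theta>-1\<^esup>\<close>.\<close>

lemma morrey_integral_norm_le:
  assumes meas: "(\<lambda>t. norm (f t)) \<in> borel_measurable (lebesgue_on {0<..<T})"
    and K: "morrey_norm p l T f \<le> ennreal K" "0 < K" and r: "0 < r" "r \<le> T" and p: "1 < p"
    and \<theta>: "\<theta> = 1 - (1 - l) / p"
  shows "integral {0..r} (\<lambda>t. norm (f t)) \<le> 2 * K * r powr \<theta>"
proof -
  let ?h = "\<lambda>t. norm (f t) powr p"
  have on: "h integrable_on {0..r}" if "integrable (lebesgue_on {0<..<T}) h" for h :: "real \<Rightarrow> real"
  proof -
    have "h integrable_on {0<..<T}" using that by (rule integrable_on_lebesgue_on) simp
    then have "h integrable_on {0..T}" by (simp add: integrable_on_open_interval_real)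
    then show ?thesis by (rule integrable_on_subinterval) (use r in auto)
  qed
  have int: "?h integrable_on {0..r}" "(\<lambda>t. norm (f t)) integrable_on {0..r}"
    using morrey_integrable[OF meas K(1)] K r p by (auto intro!: on)
  define c where "c = K * r powr (\<theta> - 1)"
  have c: "0 < c" using K r by (simp add: c_def)
  have "((\<lambda>t. c) has_integral c * r) {0..r}"
    using has_integral_const_real[of c 0 r] r by (simp add: mult.commute)
  from has_integral_add[OF this has_integral_mult_right[OF integrable_integral[OF int(1)], of "c powr (1 - p)"]]
  have "integral {0..r} (\<lambda>t. norm (f t)) \<le> c * r + c powr (1 - p) * integral {0..r} ?h"
    by (rule has_integral_le[OF integrable_integral[OF int(2)]]) (rule le_add_powr[OF norm_ge_zero c p])
  also have "\<dots> \<le> c * r + c powr (1 - p) * (K powr p * r powr l)"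
    using morrey_integral_le[OF meas K(1), of r] K r p by (intro add_left_mono mult_left_mono) auto
  also have "c powr (1 - p) * (K powr p * r powr l) = K * r powr \<theta>"
  proof -
    have "c powr (1 - p) = K powr (1 - p) * r powr ((\<theta> - 1) * (1 - p))"
      using K r by (simp add: c_def powr_mult powr_powr)
    then have "c powr (1 - p) * (K powr p * r powr l)
        = (K powr (1 - p) * K powr p) * (r powr ((\<theta> - 1) * (1 - p)) * r powr l)"
      by (simp only: mult_ac)
    also have "\<dots> = K powr (1 - p + p) * r powr ((\<theta> - 1) * (1 - p) + l)"
      by (simp only: powr_add)
    \<comment> \<open>The exponents close up because
      \<open>(\<theta> - 1) * p = l - 1\<close>.\<close>
    also have "(\<theta> - 1) * (1 - p) + l = \<theta>"
      using p unfolding \<theta> by (simp add: field_simps)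
    finally show ?thesis using K by simp
  qed
  also have "c * r = K * r powr \<theta>"
  proof -
    have "r powr (\<theta> - 1) * r = r powr (\<theta> - 1) * r powr 1" using r by simp
    also have "\<dots> = r powr \<theta>" by (simp only: powr_add[symmetric]) simp
    finally show ?thesis by (simp add: c_def)
  qed
  finally show ?thesis by simp
qed

section \<open>Absolute continuity and uniqueness of the trace\<close>

text \<open>The pointwise bound of \<open>k\<close> by c + c^(1-p) k^p splits the sum over the
  intervals into c times their total length and a part of at most c^(1-p) J. A large c makes the
  second part small, and then a small total length the first.\<close>

lemma absolutely_continuous_IccI:
  fixes w :: "real \<Rightarrow> 'a::banach"
  assumes k: "integrable (lebesgue_on {0<..<T}) k" "integrable (lebesgue_on {0<..<T}) (\<lambda>t. k t powr p)"
    and "\<And>t. 0 \<le> k t" and p: "1 < p"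
    and w: "\<And>s t. 0 \<le> s \<Longrightarrow> s \<le> t \<Longrightarrow> t \<le> T \<Longrightarrow> norm (w t - w s) \<le> integral {s..t} k"
  shows "absolutely_continuous_Icc 0 T w"
  unfolding absolutely_continuous_Icc_def
proof (intro allI impI)
  fix \<epsilon> :: real assume "0 < \<epsilon>"
  let ?M = "lebesgue_on {0<..<T}"
  define J where "J = (\<integral>t. k t powr p \<partial>?M)"
  have "0 \<le> J" unfolding J_def by (rule Bochner_Integration.integral_nonneg) simp
  \<comment> \<open>Chosen so that c^(p-1) = 2 (J + 1) / \<epsilon>. The summand 1 keeps the base
    positive when \<open>J = 0\<close> and makes \<open>cJ\<close> strict.\<close>
  define c where "c = (2 * (J + 1) / \<epsilon>) powr (1 / (p - 1))"
  have c: "0 < c" using \<open>0 \<le> J\<close> \<open>0 < \<epsilon>\<close> by (simp add: c_def)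
  have c_powr: "c powr (1 - p) = inverse (2 * (J + 1) / \<epsilon>)"
  proof -
    have "c powr (1 - p) = (2 * (J + 1) / \<epsilon>) powr (- 1)"
      unfolding c_def powr_powr using p by (intro arg_cong[where f = "\<lambda>e. _ powr e"]) (simp add: field_simps)
    also have "\<dots> = inverse (2 * (J + 1) / \<epsilon>)"
      using \<open>0 \<le> J\<close> \<open>0 < \<epsilon>\<close> by (subst powr_minus) simp
    finally show ?thesis .
  qed
  have "c powr (1 - p) * J * 2 + 2 * c powr (1 - p) = c powr (1 - p) * (2 * (J + 1))"
    by (simp add: algebra_simps)
  also have "\<dots> = \<epsilon>" using \<open>0 \<le> J\<close> \<open>0 < \<epsilon>\<close> unfolding c_powr by (simp add: field_simps)
  finally have cJ: "c powr (1 - p) * J < \<epsilon> / 2"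
    using powr_gt_zero[of c "1 - p"] c by linarith
  show "\<exists>\<delta>>0. \<forall>(n::nat) a b. (\<forall>i<n. 0 \<le> a i \<and> a i \<le> b i \<and> b i \<le> T) \<and>
      (\<forall>i<n. \<forall>k<n. i \<noteq> k \<longrightarrow> {a i<..<b i} \<inter> {a k<..<b k} = {}) \<and> (\<Sum>i<n. b i - a i) < \<delta> \<longrightarrow>
      (\<Sum>i<n. norm (w (b i) - w (a i))) < \<epsilon>"
  proof (intro exI[of _ "\<epsilon> / (2 * c)"] conjI allI impI)
    show "0 < \<epsilon> / (2 * c)" using c \<open>0 < \<epsilon>\<close> by simp
    fix n :: nat and a b :: "nat \<Rightarrow> real"
    assume A: "(\<forall>i<n. 0 \<le> a i \<and> a i \<le> b i \<and> b i \<le> T) \<and>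
      (\<forall>i<n. \<forall>k<n. i \<noteq> k \<longrightarrow> {a i<..<b i} \<inter> {a k<..<b k} = {}) \<and> (\<Sum>i<n. b i - a i) < \<epsilon> / (2 * c)"
    have ab: "0 \<le> a i" "a i \<le> b i" "b i \<le> T" if "i < n" for i
      using conjunct1[OF A, rule_format, OF that] by simp_all
    have disj: "{a i<..<b i} \<inter> {a j<..<b j} = {}" if "i < n" "j < n" "i \<noteq> j" for i j
      using that by (rule conjunct1[OF conjunct2[OF A], rule_format])
    have small: "(\<Sum>i<n. b i - a i) < \<epsilon> / (2 * c)"
      by (rule conjunct2[OF conjunct2[OF A]])
    let ?I = "\<lambda>i. indicat_real {a i<..b i}"
    have "disjoint_family_on (\<lambda>i. {a i<..b i}) {..<n}"
      unfolding disjoint_family_on_def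
    proof (intro ballI impI)
      fix i j assume ij: "i \<in> {..<n}" "j \<in> {..<n}" "i \<noteq> j"
      show "{a i<..b i} \<inter> {a j<..b j} = {}"
      proof (rule ccontr)
        assume "{a i<..b i} \<inter> {a j<..b j} \<noteq> {}"
        then obtain x where "x \<in> {a i<..b i} \<inter> {a j<..b j}" by blast
        then have x: "a i < x" "a j < x" "x \<le> b i" "x \<le> b j" by simp_all
        \<comment> \<open>The open intervals are assumed disjoint, while the half-open ones are
          integrated: a common point of the latter lies to the right of both left ends, and moving
          it halfway towards the larger of them gives a common point of the former.\<close>
        define m where "m = max (a i) (a j)"
        have "a i \<le> m" "a j \<le> m" "m < x" using x by (simp_all add: m_def)
        then have "(m + x) / 2 \<in> {a i<..<b i} \<inter> {a j<..<b j}"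
          using x by simp
        then show False using disj ij by blast
      qed
    qed
    then have "(\<Sum>i<n. ?I i x) = indicat_real (\<Union>i<n. {a i<..b i}) x" for x
      by (intro indicator_UN_disjoint[symmetric]) simp_all
    then have sum_le: "(\<Sum>i<n. ?I i x) \<le> 1" for x
      by (simp only:) (simp add: indicator_def)
    have le: "norm (w (b i) - w (a i)) \<le> c * (b i - a i) + c powr (1 - p) * (\<integral>x. ?I i x * k x powr p \<partial>?M)" if "i < n" for i
    proof -
      note int = integral_indicator_Ioc[OF _ ab(1,3)[OF that]]
      have one: "integrable ?M (\<lambda>x. 1::real)"
        by (rule finite_measure.integrable_const[OF finite_measure_Ioo])
      have "norm (w (b i) - w (a i)) \<le> integral {a i..b i} k"
        by (rule w[OF ab[OF that]])
      also have "\<dots> = (\<integral>x. ?I i x * k x \<partial>?M)"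
        by (rule int(2)[OF k(1), symmetric])
      also have "\<dots> \<le> (\<integral>x. c * (?I i x * 1) + c powr (1 - p) * (?I i x * k x powr p) \<partial>?M)"
      proof (rule Bochner_Integration.integral_mono)
        show "integrable ?M (\<lambda>x. ?I i x * k x)"
          by (rule int(1)[OF k(1)])
        show "integrable ?M (\<lambda>x. c * (?I i x * 1) + c powr (1 - p) * (?I i x * k x powr p))"
          by (intro Bochner_Integration.integrable_add integrable_mult_right int(1) one k(2))
        show "?I i x * k x \<le> c * (?I i x * 1) + c powr (1 - p) * (?I i x * k x powr p)" for x
          using le_add_powr[OF assms(3) c p] by (simp add: indicator_def)
      qed
      also have "\<dots> = c * (\<integral>x. ?I i x * 1 \<partial>?M) + c powr (1 - p) * (\<integral>x. ?I i x * k x powr p \<partial>?M)"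
        by (subst Bochner_Integration.integral_add[OF integrable_mult_right[OF int(1)[OF one]] integrable_mult_right[OF int(1)[OF k(2)]]])
           (simp only: integral_mult_right_zero)
      also have "(\<integral>x. ?I i x * 1 \<partial>?M) = b i - a i"
        using ab(2)[OF that] by (subst int(2)[OF one]) simp
      finally show ?thesis .
    qed
    have "(\<Sum>i<n. norm (w (b i) - w (a i))) \<le> (\<Sum>i<n. c * (b i - a i) + c powr (1 - p) * (\<integral>x. ?I i x * k x powr p \<partial>?M))"
      using le by (intro sum_mono) simp
    also have "\<dots> = c * (\<Sum>i<n. b i - a i) + c powr (1 - p) * (\<Sum>i<n. \<integral>x. ?I i x * k x powr p \<partial>?M)"
      by (simp only: sum.distrib sum_distrib_left)
    also have "(\<Sum>i<n. \<integral>x. ?I i x * k x powr p \<partial>?M) \<le> J"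
    proof -
      have i2: "integrable ?M (\<lambda>x. ?I i x * k x powr p)" if "i \<in> {..<n}" for i
        by (rule integral_indicator_Ioc(1)[OF k(2) ab(1,3)]) (use that in simp_all)
      have "(\<Sum>i<n. \<integral>x. ?I i x * k x powr p \<partial>?M) = (\<integral>x. (\<Sum>i<n. ?I i x * k x powr p) \<partial>?M)"
        by (rule Bochner_Integration.integral_sum[OF i2, symmetric])
      also have "\<dots> \<le> J"
        unfolding J_def
      proof (rule Bochner_Integration.integral_mono[OF Bochner_Integration.integrable_sum[OF i2] k(2)])
        show "(\<Sum>i<n. ?I i x * k x powr p) \<le> k x powr p" for x
          using mult_right_mono[OF sum_le[of x], of "k x powr p"] by (simp add: sum_distrib_right)
      qed
      finally show ?thesis .
    qed
    then have "c * (\<Sum>i<n. b i - a i) + c powr (1 - p) * (\<Sum>i<n. \<integral>x. ?I i x * k x powr p \<partial>?M)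
      \<le> c * (\<Sum>i<n. b i - a i) + c powr (1 - p) * J"
      by (intro add_left_mono mult_left_mono) auto
    also have "\<dots> < \<epsilon> / 2 + \<epsilon> / 2"
    proof (rule add_strict_mono[OF _ cJ])
      show "c * (\<Sum>i<n. b i - a i) < \<epsilon> / 2"
        using small c by (simp add: pos_less_divide_eq mult_ac)
    qed
    finally show "(\<Sum>i<n. norm (w (b i) - w (a i))) < \<epsilon>" by simp
  qed
qed

lemma absolutely_continuous_Icc_imp_continuous_on:
  fixes w :: "real \<Rightarrow> 'a::banach"
  assumes "absolutely_continuous_Icc c d w"
  shows "continuous_on {c..d} w"
  unfolding continuous_on_iff
proof (intro ballI allI impI)
  fix x \<epsilon> :: real assume x: "x \<in> {c..d}" and "0 < \<epsilon>"
  obtain \<delta> where \<delta>: "0 < \<delta>" "\<forall>(n::nat) a b.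
        (\<forall>i<n. c \<le> a i \<and> a i \<le> b i \<and> b i \<le> d) \<and>
        (\<forall>i<n. \<forall>k<n. i \<noteq> k \<longrightarrow> {a i<..<b i} \<inter> {a k<..<b k} = {}) \<and>
        (\<Sum>i<n. b i - a i) < \<delta> \<longrightarrow> (\<Sum>i<n. norm (w (b i) - w (a i))) < \<epsilon>"
    using assms[unfolded absolutely_continuous_Icc_def, THEN spec, THEN mp, OF \<open>0 < \<epsilon>\<close>]
    by (elim exE conjE)
  have *: "norm (w t - w s) < \<epsilon>" if "c \<le> s" "s \<le> t" "t \<le> d" "t - s < \<delta>" for s t
    using \<delta>(2)[THEN spec[of _ 1], THEN spec[of _ "\<lambda>_. s"], THEN spec[of _ "\<lambda>_. t"]] that by simp
  have "dist (w x') (w x) < \<epsilon>" if "x' \<in> {c..d}" "dist x' x < \<delta>" for x'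
    using *[of x x'] *[of x' x] x that unfolding dist_norm
    by (cases x x' rule: le_cases) (auto simp: norm_minus_commute)
  with \<delta>(1) show "\<exists>\<delta>>0. \<forall>x'\<in>{c..d}. dist x' x < \<delta> \<longrightarrow> dist (w x') (w x) < \<epsilon>" by blast
qed

text \<open>Two continuous representatives agree at points arbitrarily close to 0, hence at 0, so
  the definite description is determined by any one of them.\<close>

lemma trace0_eq:
  fixes j :: "'b::banach \<Rightarrow> 'a::banach"
  assumes "0 < T" and w: "absolutely_continuous_Icc 0 T w" "AE t in lebesgue_on {0<..<T}. w t = j (u t)"
  shows "trace0 T j u = w 0"
  unfolding trace0_def
proof (rule the_equality)
  show "\<exists>w'. absolutely_continuous_Icc 0 T w' \<and> (AE t in lebesgue_on {0<..<T}. w' t = j (u t)) \<and> w' 0 = w 0"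
    using w by blast
  fix x assume "\<exists>w'. absolutely_continuous_Icc 0 T w' \<and> (AE t in lebesgue_on {0<..<T}. w' t = j (u t)) \<and> w' 0 = x"
  then obtain w' where w': "absolutely_continuous_Icc 0 T w'" "AE t in lebesgue_on {0<..<T}. w' t = j (u t)" "w' 0 = x"
    by blast
  have ae: "AE t in lebesgue_on {0<..<T}. w' t - w t = 0"
    using w(2) w'(2) by eventually_elim simp
  obtain t where t: "t \<longlonglongrightarrow> 0" "\<And>n. t n \<in> {0<..<T}" "\<And>n. w' (t n) - w (t n) = 0"
    using AE_Ioo_sequence[OF ae assms(1)] by blast
  have lim: "(\<lambda>n. h (t n)) \<longlonglongrightarrow> h 0" if "absolutely_continuous_Icc 0 T h" for h :: "real \<Rightarrow> 'a"
    by (rule continuous_on_tendsto_compose[OF absolutely_continuous_Icc_imp_continuous_on[OF that] t(1)])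
       (use assms(1) t(2) in \<open>auto simp: less_imp_le\<close>)
  have "(\<lambda>n. w' (t n) - w (t n)) \<longlonglongrightarrow> w' 0 - w 0"
    by (rule tendsto_diff[OF lim[OF w'(1)] lim[OF w(1)]])
  then have "w' 0 - w 0 = 0"
    unfolding t(3) by (simp add: LIMSEQ_const_iff)
  then show "x = w 0" using w'(3) by simp
qed

section \<open>Decompositions of the trace\<close>

lemma K_functional_le:
  assumes "0 \<le> r"
  shows "K_functional j r (x0 + j x1) \<le> norm x0 + r * norm x1"
  unfolding K_functional_def
  by (rule cInf_lower, blast) (use assms in \<open>auto intro!: bdd_belowI[of _ 0]\<close>)

text \<open>Finite Morrey norms supply the integrability that the locale
  \<open>weak_derivative\<close> asks for. Here \<open>v\<close> is any weak derivative of finite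
  norm, not necessarily the one that witnesses membership of \<open>u\<close> in the evolution
  space.\<close>

lemma trace_representative:
  fixes j :: "'b::banach \<Rightarrow> 'a::banach"
  assumes j: "bounded_linear j" and p: "1 < p" and T: "0 < T"
    and u: "u \<in> evolution_space p l T j" and weak: "has_weak_derivative T (\<lambda>t. j (u t)) v"
    and fin: "morrey_norm p l T v < \<infinity>"
  shows "\<exists>w. continuous_on {0..T} w \<and> (AE t in lebesgue_on {0<..<T}. w t = j (u t)) \<and> trace0 T j u = w 0 \<and>
    (\<forall>s t. 0 \<le> s \<and> s \<le> t \<and> t \<le> T \<longrightarrow> norm (w t - w s) \<le> integral {s..t} (\<lambda>x. norm (v x)))"
proof -
  let ?M = "lebesgue_on {0<..<T}"
  interpret M: complete_measure ?M by (rule complete_measure_lebesgue_on) simp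
  have finite_K: "morrey_norm p l T f \<le> ennreal (enn2real (morrey_norm p l T f))"
    if "morrey_norm p l T f < \<infinity>" for f :: "real \<Rightarrow> 'z::banach"
    using that by simp
  have v: "integrable ?M (\<lambda>t. norm (v t) powr p)" "integrable ?M (\<lambda>t. norm (v t))"
    by (rule morrey_integrable[OF weak_derivative_norm_measurable[OF T weak] finite_K[OF fin] enn2real_nonneg T p])+
  have u': "strongly_measurable ?M u" "morrey_norm p l T u < \<infinity>"
    using u by (auto simp: evolution_space_def morrey_space_def)
  have un: "integrable ?M (\<lambda>t. norm (u t))"
    by (rule morrey_integrable(2)[OF M.strongly_measurable_norm[OF u'(1)] finite_K[OF u'(2)] enn2real_nonneg T p])
  have y: "strongly_integrable ?M (\<lambda>t. j (u t))"
  proof (rule M.strongly_integrableI)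
    show "strongly_measurable ?M (\<lambda>t. j (u t))"
      by (rule strongly_measurable_bounded_linear[OF j u'(1)])
    show "integrable ?M (\<lambda>t. norm (u t) * onorm j)" using un by simp
    show "AE x in ?M. norm (j (u x)) \<le> norm (u x) * onorm j"
      using onorm[OF j] by (intro AE_I2) (simp add: mult.commute)
  qed
  interpret weak_derivative T "\<lambda>t. j (u t)" v
    by unfold_locales (use T y weak v in auto)
  obtain w' where w': "continuous_on {0..T} w'" "AE t in ?M. w' t = j (u t)"
    "\<And>s t. 0 \<le> s \<Longrightarrow> s \<le> t \<Longrightarrow> t \<le> T \<Longrightarrow> norm (w' t - w' s) \<le> integral {s..t} (\<lambda>x. norm (v x))"
    using representative_exists by blast
  have ac: "absolutely_continuous_Icc 0 T w'"
    by (rule absolutely_continuous_IccI[OF v(2,1) norm_ge_zero p w'(3)])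
  have "trace0 T j u = w' 0"
    by (rule trace0_eq[OF T ac]) (rule w'(2))
  with w' show ?thesis by (intro exI[of _ w']) simp
qed

text \<open>The mean of \<open>\<parallel>u\<parallel>\<^sup>p\<close> over \<open>(0,r)\<close> is at most \<open>(K r\<^bsup>\<theta>-1\<^esup>)\<^sup>p\<close>; the slack factor \<open>2\<close> avoids discussing
  equality. The value \<open>u t\<close> will be the \<open>X\<^sub>1\<close>-part of the trace at scale \<open>r\<close>.\<close>

lemma morrey_good_point:
  fixes u :: "real \<Rightarrow> 'b::banach"
  assumes meas: "(\<lambda>t. norm (u t)) \<in> borel_measurable (lebesgue_on {0<..<T})"
    and K: "morrey_norm p l T u \<le> ennreal K" "0 < K" and r: "0 < r" "r \<le> T" and p: "1 < p"
    and \<theta>: "\<theta> = 1 - (1 - l) / p" and P: "AE t in lebesgue_on {0<..<T}. P t"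
  obtains t where "t \<in> {0<..<r}" "P t" "norm (u t) \<le> 2 * K * r powr (\<theta> - 1)"
proof -
  define c where "c = 2 * K * r powr (\<theta> - 1)"
  have c: "0 < c" using K r by (simp add: c_def)
  have "\<exists>t\<in>{0<..<r}. P t \<and> norm (u t) \<le> c"
  proof (rule ccontr)
    assume "\<not> ?thesis"
    \<comment> \<open>The p-th power of the norm would then integrate over (0,r) to at least c^p r =
      2^p K^p r^l, more than the Morrey bound K^p r^l.\<close>
    then have big: "c < norm (u t)" if "t \<in> {0<..<r}" "P t" for t using that by force
    have "AE t in lebesgue. t \<in> {0<..<T} \<longrightarrow> P t"
      using P by (subst (asm) AE_restrict_space_iff) auto
    then have "AE t in lebesgue. ennreal (c powr p) * indicator {0<..<r} t \<le> ennreal (norm (u t) powr p) * indicator {0<..<r} t"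
    proof eventually_elim
      case (elim t)
      show ?case
      proof (cases "t \<in> {0<..<r}")
        case True
        then have "c < norm (u t)" using elim r by (intro big) auto
        then have "c powr p \<le> norm (u t) powr p" using c p by (intro powr_mono2) auto
        then show ?thesis using True by (simp add: ennreal_leI)
      qed simp
    qed
    then have "(\<integral>\<^sup>+t. ennreal (c powr p) * indicator {0<..<r} t \<partial>lebesgue)
        \<le> (\<integral>\<^sup>+t. ennreal (norm (u t) powr p) * indicator {0<..<r} t \<partial>lebesgue)"
      by (rule nn_integral_mono_AE)
    also have "\<dots> \<le> ennreal (K powr p * r powr l)"
      using K r p by (intro morrey_norm_bound) auto
    also have "(\<integral>\<^sup>+t. ennreal (c powr p) * indicator {0<..<r} t \<partial>lebesgue) = ennreal (c powr p * r)"
      using r by (subst nn_integral_cmult_indicator) (auto simp: ennreal_mult')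
    finally have le: "c powr p * r \<le> K powr p * r powr l"
      using K r by simp
    have "c powr p = 2 powr p * K powr p * r powr ((\<theta> - 1) * p)"
      using K r by (simp add: c_def powr_mult powr_powr)
    also have "(\<theta> - 1) * p = l - 1" using p by (simp add: \<theta>)
    finally have "c powr p * r = 2 powr p * K powr p * (r powr (l - 1) * r powr 1)"
      using r by simp
    also have "\<dots> = 2 powr p * (K powr p * r powr l)"
      by (simp only: powr_add[symmetric]) simp
    finally have "2 powr p * (K powr p * r powr l) \<le> 1 * (K powr p * r powr l)"
      using le by simp
    then have "2 powr p \<le> 1"
      by (rule mult_right_le_imp_le) (use K r in simp)
    moreover have "(2::real) powr 1 < 2 powr p" using p by (intro powr_less_mono) auto
    ultimately show False by simp
  qed
  then show ?thesis using that unfolding c_def by blast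
qed

text \<open>For \<open>r \<le> T\<close> the part in X_0 is an increment of \<open>w\<close> and the
  part in X_1 a value of \<open>u\<close>, which gives the factor 2. For larger r the trivial
  decomposition bounds K by the norm of \<open>w 0\<close>, which is estimated from the scale T;
  passing through the embedding produces the summand with \<open>onorm j / T\<close>. Positive
  \<open>Ku\<close> and \<open>Kv\<close> keep the comparison levels positive.\<close>

lemma trace_K_functional_le:
  fixes j :: "'b::banach \<Rightarrow> 'a::banach"
  assumes j: "bounded_linear j" and p: "1 < p" and T: "0 < T" and l: "0 < l" "l < 1"
    and \<theta>: "\<theta> = 1 - (1 - l) / p"
    and u: "u \<in> evolution_space p l T j" and weak: "has_weak_derivative T (\<lambda>t. j (u t)) v"
    and Ku: "morrey_norm p l T u \<le> ennreal Ku" "0 < Ku" and Kv: "morrey_norm p l T v \<le> ennreal Kv" "0 < Kv"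
    and r: "0 < r"
  shows "r powr (- \<theta>) * K_functional j r (trace0 T j u) \<le> (2 + 2 * onorm j / T) * (Ku + Kv)"
proof -
  interpret j: bounded_linear j by fact
  let ?M = "lebesgue_on {0<..<T}"
  interpret M: complete_measure ?M by (rule complete_measure_lebesgue_on) simp
  have "0 < \<theta>" using l p by (simp add: \<theta> divide_less_eq)
  have j0: "0 \<le> onorm j" by (rule onorm_pos_le[OF j])
  have fin: "morrey_norm p l T v < \<infinity>" using Kv(1) by (simp add: order.strict_trans1)
  obtain w where w: "AE t in ?M. w t = j (u t)" "trace0 T j u = w 0"
    "\<forall>s t. 0 \<le> s \<and> s \<le> t \<and> t \<le> T \<longrightarrow> norm (w t - w s) \<le> integral {s..t} (\<lambda>x. norm (v x))"
    using trace_representative[OF j p T u weak fin] by blast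
  have um: "(\<lambda>t. norm (u t)) \<in> borel_measurable ?M"
    using u by (intro M.strongly_measurable_norm) (simp add: evolution_space_def morrey_space_def)
  have vm: "(\<lambda>t. norm (v t)) \<in> borel_measurable ?M"
    by (rule weak_derivative_norm_measurable[OF T weak])
  have decomposition: "\<exists>x0 x1. w 0 = x0 + j x1 \<and> norm x0 \<le> 2 * Kv * r powr \<theta> \<and> norm x1 \<le> 2 * Ku * r powr (\<theta> - 1)"
    if r: "0 < r" "r \<le> T" for r
  proof -
    obtain t where t: "t \<in> {0<..<r}" "w t = j (u t)" "norm (u t) \<le> 2 * Ku * r powr (\<theta> - 1)"
      using morrey_good_point[OF um Ku r p \<theta> w(1)] by blast
    have "norm (w t - w 0) \<le> integral {0..t} (\<lambda>x. norm (v x))"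
      using w(3)[THEN spec[of _ 0], THEN spec[of _ t]] t(1) r by simp
    also have "\<dots> \<le> 2 * Kv * t powr \<theta>"
      using t r by (intro morrey_integral_norm_le[OF vm Kv _ _ p \<theta>]) auto
    also have "\<dots> \<le> 2 * Kv * r powr \<theta>"
      using t r Kv \<open>0 < \<theta>\<close> by (intro mult_left_mono powr_mono2) auto
    finally show ?thesis
      using t by (intro exI[of _ "w 0 - w t"] exI[of _ "u t"]) (simp add: norm_minus_commute)
  qed
  show ?thesis
  proof (cases "r \<le> T")
    case True
    obtain x0 x1 where x: "w 0 = x0 + j x1" "norm x0 \<le> 2 * Kv * r powr \<theta>" "norm x1 \<le> 2 * Ku * r powr (\<theta> - 1)"
      using decomposition[OF r True] by blast
    have "K_functional j r (w 0) \<le> norm x0 + r * norm x1"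
      unfolding x(1) using r by (intro K_functional_le) simp
    also have "\<dots> \<le> 2 * Kv * r powr \<theta> + r * (2 * Ku * r powr (\<theta> - 1))"
      using x r by (intro add_mono mult_left_mono) auto
    also have "r * (2 * Ku * r powr (\<theta> - 1)) = 2 * Ku * (r powr 1 * r powr (\<theta> - 1))"
      using r by simp
    also have "r powr 1 * r powr (\<theta> - 1) = r powr \<theta>"
      by (simp only: powr_add[symmetric]) simp
    finally have "r powr (- \<theta>) * K_functional j r (w 0) \<le> r powr (- \<theta>) * (2 * (Ku + Kv) * r powr \<theta>)"
      by (intro mult_left_mono) (simp_all add: algebra_simps)
    also have "\<dots> = 2 * (Ku + Kv)"
      using r by (simp add: powr_minus)
    also have "\<dots> \<le> (2 + 2 * onorm j / T) * (Ku + Kv)"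
      using j0 T Ku Kv by (intro mult_right_mono) auto
    finally show ?thesis unfolding w(2) .
  next
    case False
    obtain x0 x1 where x: "w 0 = x0 + j x1" "norm x0 \<le> 2 * Kv * T powr \<theta>" "norm x1 \<le> 2 * Ku * T powr (\<theta> - 1)"
      using decomposition[OF T] by blast
    have "K_functional j r (w 0 + j 0) \<le> norm (w 0) + r * norm (0 :: 'b)"
      using r by (intro K_functional_le) simp
    then have "K_functional j r (w 0) \<le> norm (w 0)" by (simp add: j.zero)
    also have "\<dots> \<le> norm x0 + norm (j x1)" unfolding x(1) by (rule norm_triangle_ineq)
    also have "\<dots> \<le> 2 * Kv * T powr \<theta> + onorm j * (2 * Ku * T powr (\<theta> - 1))"
      using x j0 by (intro add_mono order_trans[OF onorm[OF j]] mult_left_mono) auto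
    also have "T powr (\<theta> - 1) = T powr \<theta> / T"
      using T by (simp add: powr_diff)
    finally have "K_functional j r (w 0) \<le> (2 * Kv + 2 * onorm j / T * Ku) * T powr \<theta>"
      by (simp add: algebra_simps)
    also have "\<dots> \<le> ((2 + 2 * onorm j / T) * (Ku + Kv)) * T powr \<theta>"
    proof (rule mult_right_mono)
      have "0 \<le> 2 * onorm j / T * Kv" using j0 T Kv by simp
      then show "2 * Kv + 2 * onorm j / T * Ku \<le> (2 + 2 * onorm j / T) * (Ku + Kv)"
        using Ku by (simp add: distrib_left distrib_right)
    qed simp
    \<comment> \<open>The bound by the norm of \<open>w 0\<close> does not grow with r, whereas
      r^\<theta> exceeds T^\<theta> here.\<close>
    also have "\<dots> \<le> ((2 + 2 * onorm j / T) * (Ku + Kv)) * r powr \<theta>"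
      using False T Ku Kv j0 \<open>0 < \<theta>\<close> by (intro mult_left_mono powr_mono2 mult_nonneg_nonneg add_nonneg_nonneg) auto
    finally have "r powr (- \<theta>) * K_functional j r (w 0) \<le> r powr (- \<theta>) * (((2 + 2 * onorm j / T) * (Ku + Kv)) * r powr \<theta>)"
      by (intro mult_left_mono) simp_all
    also have "\<dots> = (2 + 2 * onorm j / T) * (Ku + Kv)"
      using r by (simp add: powr_minus)
    finally show ?thesis unfolding w(2) .
  qed
qed

text \<open>The constant depends only on \<open>onorm j\<close> and T. An infinite norm of
  \<open>v\<close> makes the right side infinite; finite norms, which may be 0, are enlarged by an
  arbitrarily small \<open>d\<close> to meet the positivity in the preceding estimate.\<close>

lemma trace_interpolation_norm_le:
  fixes j :: "'b::banach \<Rightarrow> 'a::banach"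
  assumes j: "bounded_linear j" and p: "1 < p" and T: "0 < T" and l: "0 < l" "l < 1"
    and \<theta>: "\<theta> = 1 - (1 - l) / p"
    and u: "u \<in> evolution_space p l T j" and weak: "has_weak_derivative T (\<lambda>t. j (u t)) v"
  shows "interpolation_norm j \<theta> (trace0 T j u)
    \<le> ennreal (2 + 2 * onorm j / T) * (morrey_norm p l T u + morrey_norm p l T v)"
proof -
  define B where "B = 2 + 2 * onorm j / T"
  have "0 \<le> onorm j / T" using onorm_pos_le[OF j] T by simp
  then have B: "0 < B" unfolding B_def by simp
  have u': "morrey_norm p l T u < \<infinity>"
    using u by (auto simp: evolution_space_def morrey_space_def)
  show ?thesis
  proof (cases "morrey_norm p l T v < \<infinity>")
    case False
    then have "ennreal B * (morrey_norm p l T u + morrey_norm p l T v) = \<infinity>"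
      using B by (simp add: less_top[symmetric] ennreal_mult_top)
    then show ?thesis by (simp add: B_def)
  next
    case True
    define a b where "a = enn2real (morrey_norm p l T u)" and "b = enn2real (morrey_norm p l T v)"
    have a: "morrey_norm p l T u = ennreal a" "0 \<le> a" using u' by (simp_all add: a_def)
    have b: "morrey_norm p l T v = ennreal b" "0 \<le> b" using True by (simp_all add: b_def)
    have "r powr (- \<theta>) * K_functional j r (trace0 T j u) \<le> B * (a + b)" if r: "0 < r" for r
    proof (rule field_le_epsilon)
      fix e :: real assume "0 < e"
      define d where "d = e / (2 * B)"
      have d: "0 < d" using \<open>0 < e\<close> B by (simp add: d_def)
      have "r powr (- \<theta>) * K_functional j r (trace0 T j u) \<le> B * ((a + d) + (b + d))"
        unfolding B_def
        by (rule trace_K_functional_le[OF j p T l \<theta> u weak _ _ _ _ r])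
           (use a b d in \<open>auto intro!: ennreal_leI\<close>)
      also have "\<dots> = B * (a + b) + e"
        using B by (simp add: d_def field_simps)
      finally show "r powr (- \<theta>) * K_functional j r (trace0 T j u) \<le> B * (a + b) + e" .
    qed
    then have "interpolation_norm j \<theta> (trace0 T j u) \<le> ennreal (B * (a + b))"
      unfolding interpolation_norm_def by (intro SUP_least ennreal_leI) simp
    also have "\<dots> = ennreal B * (morrey_norm p l T u + morrey_norm p l T v)"
      using a b B by (simp add: ennreal_mult ennreal_plus)
    finally show ?thesis by (simp add: B_def)
  qed
qed

section \<open>The extension\<close>

lemma enn_powr_le:
  assumes "J \<le> ennreal y" "0 \<le> y" "0 < a"
  shows "enn_powr J a \<le> ennreal (y powr a)"
proof -
  have J: "J \<noteq> \<infinity>" using assms(1) by (auto simp: top_unique)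
  then have "enn2real J \<le> y" using assms(1,2) by (simp add: enn2real_leI)
  then show ?thesis
    using J assms(3) by (simp add: enn_powr_def ennreal_leI powr_mono2)
qed

text \<open>The fractions a/b and (b-a)/b add up to 1, and each is at most its l-th power. For the
  Morrey norm this says that, among intervals of a given length, the one starting at the origin is
  the worst.\<close>

lemma powr_diff_le:
  fixes a b l :: real
  assumes "0 \<le> a" "a < b" "0 < l" "l \<le> 1"
  shows "b powr l - a powr l \<le> (b - a) powr l"
proof -
  have b: "0 < b" using assms by simp
  have ge: "x \<le> x powr l" if "0 \<le> x" "x \<le> 1" for x
    using powr_mono'[of l 1 x] that assms by simp
  have "1 = a / b + (b - a) / b" using b by (simp add: diff_divide_distrib)
  also have "\<dots> \<le> (a / b) powr l + ((b - a) / b) powr l"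
    using assms b by (intro add_mono ge) auto
  also have "\<dots> = (a powr l + (b - a) powr l) / b powr l"
    using assms b by (simp add: powr_divide add_divide_distrib)
  finally show ?thesis using b by (simp add: field_simps)
qed

lemma has_integral_powr_Icc:
  fixes a b l :: real
  assumes "0 \<le> a" "a \<le> b" "0 < l"
  shows "((\<lambda>t. t powr (l - 1)) has_integral (b powr l - a powr l) / l) {a..b}"
proof -
  have h: "((\<lambda>t. t powr (l - 1)) has_integral c powr l / l) {0..c}" if "0 \<le> c" for c
    using has_integral_powr_from_0[of "l - 1" c] that assms by simp
  have i: "(\<lambda>t. t powr (l - 1)) integrable_on {0..b}"
    using h[of b] assms by auto
  then have i': "(\<lambda>t. t powr (l - 1)) integrable_on {a..b}"
    by (rule integrable_on_subinterval) (use assms in auto)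
  have "integral {0..a} (\<lambda>t. t powr (l - 1)) + integral {a..b} (\<lambda>t. t powr (l - 1)) = integral {0..b} (\<lambda>t. t powr (l - 1))"
    by (rule Henstock_Kurzweil_Integration.integral_combine[OF assms(1,2) i])
  then have "integral {a..b} (\<lambda>t. t powr (l - 1)) = (b powr l - a powr l) / l"
    using integral_unique[OF h[of a]] integral_unique[OF h[of b]] assms by (simp add: diff_divide_distrib)
  then show ?thesis using integrable_integral[OF i'] by simp
qed

text \<open>The p-th power of t^(\<theta>-1) is t^(l-1), whose integral over an interval of length D
  is at most D^l / l, wherever the interval lies. The length then cancels against the weight and
  leaves the factor l^(-1/p).\<close>

lemma morrey_norm_powr_le:
  assumes f: "\<And>t. t \<in> {0<..<T} \<Longrightarrow> norm (f t) \<le> c * t powr (\<theta> - 1)" and c: "0 \<le> c"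
    and p: "1 < p" and l: "0 < l" "l < 1" and \<theta>: "\<theta> = 1 - (1 - l) / p"
  shows "morrey_norm p l T f \<le> ennreal (c * l powr (- (1 / p)))"
  unfolding morrey_norm_def
proof (rule SUP_least)
  fix I assume "I \<in> {I. is_interval I \<and> I \<subseteq> {0<..<T} \<and> 0 < measure lebesgue I}"
  then have I: "is_interval I" "I \<subseteq> {0<..<T}" "0 < measure lebesgue I" by auto
  \<comment> \<open>An interval of any kind lies between (a,b) and [a,b], so only its end points
    matter.\<close>
  define a b where "a = Inf I" and "b = Sup I"
  have "I \<noteq> {}" using I(3) by auto
  have bdd: "bdd_below I" "bdd_above I"
    using I(2) by (meson bdd_below_Ioo bdd_below_mono, meson bdd_above_Ioo bdd_above_mono)
  have sub: "I \<subseteq> {a..b}"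
    using bdd by (auto simp: a_def b_def intro: cInf_lower cSup_upper)
  have sup: "{a<..<b} \<subseteq> I"
  proof
    fix x assume "x \<in> {a<..<b}"
    then have "Inf I < x" "x < Sup I" by (auto simp: a_def b_def)
    then obtain y z where "y \<in> I" "y < x" "z \<in> I" "x < z"
      using cInf_less_iff[OF \<open>I \<noteq> {}\<close> bdd(1)] less_cSup_iff[OF \<open>I \<noteq> {}\<close> bdd(2)] by blast
    then show "x \<in> I" using I(1) unfolding is_interval_1 by (meson less_imp_le)
  qed
  have "I \<in> sets lebesgue" using I(3) measure_notin_sets by fastforce
  then have Im: "I \<in> lmeasurable"
    using sub by (rule fmeasurableI2[OF lmeasurable_cbox[of a b, unfolded cbox_interval], rotated])
  have "measure lebesgue I \<le> measure lebesgue {a..b}"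
    by (rule measure_mono_fmeasurable[OF sub]) (use \<open>I \<in> sets lebesgue\<close> in auto)
  moreover have "a \<le> b" using sub \<open>I \<noteq> {}\<close> by fastforce
  ultimately have ab: "a < b" and "measure lebesgue I \<le> b - a"
    using I(3) by simp_all
  moreover have "measure lebesgue {a<..<b} \<le> measure lebesgue I"
    by (rule measure_mono_fmeasurable[OF sup _ Im]) simp
  ultimately have mI: "measure lebesgue I = b - a" by simp
  have a0: "0 \<le> a" unfolding a_def
    by (rule cInf_greatest[OF \<open>I \<noteq> {}\<close>]) (use I(2) in auto)
  define D where "D = b - a"
  have D: "0 < D" using ab by (simp add: D_def)
  have "(\<integral>\<^sup>+t. ennreal (norm (f t) powr p) * indicator I t \<partial>lebesgue)
      \<le> (\<integral>\<^sup>+t. ennreal (c powr p * t powr (l - 1)) * indicator {a..b} t \<partial>lebesgue)"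
  proof (rule nn_integral_mono)
    fix t
    show "ennreal (norm (f t) powr p) * indicator I t \<le> ennreal (c powr p * t powr (l - 1)) * indicator {a..b} t"
    proof (cases "t \<in> I")
      case True
      then have t: "t \<in> {0<..<T}" "t \<in> {a..b}" using I(2) sub by auto
      have "norm (f t) powr p \<le> (c * t powr (\<theta> - 1)) powr p"
        using f[OF t(1)] p by (intro powr_mono2) auto
      also have "\<dots> = c powr p * t powr ((\<theta> - 1) * p)"
        using c by (simp add: powr_mult powr_powr)
      also have "(\<theta> - 1) * p = l - 1" using p by (simp add: \<theta>)
      finally show ?thesis using True t by (simp add: ennreal_leI)
    qed simp
  qed
  also have "\<dots> = ennreal (c powr p * ((b powr l - a powr l) / l))"
    unfolding nn_integral_completion
    using has_integral_mult_right[OF has_integral_powr_Icc[OF a0 less_imp_le[OF ab] l(1)], of "c powr p"]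
    by (intro nn_integral_has_integral_lebesgue') auto
  also have "\<dots> \<le> ennreal (c powr p * (D powr l / l))"
    using powr_diff_le[OF a0 ab l(1)] l
    by (intro ennreal_leI mult_left_mono divide_right_mono) (auto simp: D_def)
  finally have "enn_powr (\<integral>\<^sup>+t. ennreal (norm (f t) powr p) * indicator I t \<partial>lebesgue) (1 / p)
      \<le> ennreal ((c powr p * (D powr l / l)) powr (1 / p))"
    using p l by (intro enn_powr_le) auto
  also have "(c powr p * (D powr l / l)) powr (1 / p) = c * D powr (l / p) * l powr (- (1 / p))"
    using p l c D by (simp add: powr_mult powr_divide powr_powr powr_minus_divide)
  finally have "ennreal (D powr (- (l / p))) * enn_powr (\<integral>\<^sup>+t. ennreal (norm (f t) powr p) * indicator I t \<partial>lebesgue) (1 / p)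
      \<le> ennreal (D powr (- (l / p))) * ennreal (c * D powr (l / p) * l powr (- (1 / p)))"
    by (rule mult_left_mono) simp
  also have "\<dots> = ennreal (D powr (- (l / p)) * (c * D powr (l / p) * l powr (- (1 / p))))"
    by (rule ennreal_mult'[symmetric]) simp
  also have "D powr (- (l / p)) * (c * D powr (l / p) * l powr (- (1 / p))) = c * l powr (- (1 / p))"
    using D by (simp add: powr_minus)
  finally show "ennreal (measure lebesgue I powr (- (l / p))) * enn_powr (\<integral>\<^sup>+t. ennreal (norm (f t) powr p) * indicator I t \<partial>lebesgue) (1 / p)
      \<le> ennreal (c * l powr (- (1 / p)))"
    unfolding mI D_def .
qed

section \<open>Dyadic interpolation of decompositions\<close>

text \<open>\<open>b k\<close> is the X_1 part of a decomposition of \<open>x\<close> at scale T /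
  2^k, and \<open>N\<close> stands for the interpolation norm of \<open>x\<close>. The factor 2 is
  the slack over the K-functional.\<close>

locale dyadic_extension =
  fixes j :: "'b::banach \<Rightarrow> 'a::banach" and p l T \<theta> N :: real and x :: 'a and b :: "nat \<Rightarrow> 'b"
  assumes j: "bounded_linear j" and p: "1 < p" and l: "0 < l" "l < 1" and T: "0 < T"
    and \<theta>: "\<theta> = 1 - (1 - l) / p" and N: "0 \<le> N"
    and b: "\<And>k. norm (x - j (b k)) + T / 2 ^ k * norm (b k) \<le> 2 * (T / 2 ^ k) powr \<theta> * N"
begin

interpretation j: bounded_linear j by (rule j)

definition \<tau> :: "nat \<Rightarrow> real" where "\<tau> k = T / 2 ^ k"

text \<open>Equal to 1 below \<open>\<tau> (Suc k)\<close>, to 0 above \<open>\<tau> k\<close>, and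
  affine between, because \<open>\<tau> k\<close> is twice \<open>\<tau> (Suc k)\<close>.\<close>

definition ramp :: "nat \<Rightarrow> real \<Rightarrow> real" where
  "ramp k t = max 0 (min 1 (2 - t / \<tau> (Suc k)))"

text \<open>The derivative of \<open>ramp k\<close> away from its two corners. With half-open
  intervals exactly one slope is nonzero at each t in (0,T).\<close>

definition slope :: "nat \<Rightarrow> real \<Rightarrow> real" where
  "slope k t = indicat_real {\<tau> (Suc k)..<\<tau> k} t * (- 1 / \<tau> (Suc k))"

text \<open>As t decreases from \<open>\<tau> k\<close> to \<open>\<tau> (Suc k)\<close>, the
  increment from \<open>b k\<close> to \<open>b (Suc k)\<close> is switched on gradually;
  \<open>n\<close> is the number of scales taken into account.\<close>

definition U :: "nat \<Rightarrow> real \<Rightarrow> 'b" where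
  "U n t = b 0 + (\<Sum>k<n. ramp k t *\<^sub>R (b (Suc k) - b k))"

definition V :: "nat \<Rightarrow> real \<Rightarrow> 'a" where
  "V n t = (\<Sum>k<n. slope k t *\<^sub>R (j (b (Suc k)) - j (b k)))"

text \<open>Since 2^m exceeds m, this many scales reach down to t; the infinite sum thus becomes a
  finite one at every positive t.\<close>

definition cut :: "real \<Rightarrow> nat" where "cut t = nat \<lceil>T / t\<rceil>"

definition u :: "real \<Rightarrow> 'b" where "u t = U (cut t) t"

definition v :: "real \<Rightarrow> 'a" where "v t = V (cut t) t"

lemma \<tau>_pos: "0 < \<tau> k" and \<tau>_0: "\<tau> 0 = T" and \<tau>_Suc: "\<tau> k = 2 * \<tau> (Suc k)"
  using T by (simp_all add: \<tau>_def)

lemma \<tau>_antimono: "k \<le> n \<Longrightarrow> \<tau> n \<le> \<tau> k"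
  using T by (simp add: \<tau>_def divide_left_mono)

lemma \<tau>_cut: assumes "0 < t" shows "\<tau> (cut t) \<le> t"
proof -
  have "T / t \<le> real (cut t)" unfolding cut_def by linarith
  also have "\<dots> \<le> 2 ^ cut t" using of_nat_less_two_power[of "cut t", where 'a = real] by simp
  finally show ?thesis using assms by (simp add: \<tau>_def field_simps)
qed

lemma ramp_eq_0: "\<tau> k \<le> t \<Longrightarrow> ramp k t = 0"
  using \<tau>_pos[of "Suc k"] \<tau>_Suc[of k] by (simp add: ramp_def le_divide_eq)

lemma ramp_eq_1: "t \<le> \<tau> (Suc k) \<Longrightarrow> ramp k t = 1"
  using \<tau>_pos[of "Suc k"] by (simp add: ramp_def divide_le_eq)

lemma ramp_mid: "\<tau> (Suc k) \<le> t \<Longrightarrow> t \<le> \<tau> k \<Longrightarrow> ramp k t = 2 - t / \<tau> (Suc k)"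
  using \<tau>_pos[of "Suc k"] \<tau>_Suc[of k] by (simp add: ramp_def divide_le_eq le_divide_eq)

lemma ramp_bounds: "0 \<le> ramp k t" "ramp k t \<le> 1"
  by (simp_all add: ramp_def)

lemma slope_eq_0: "\<tau> k \<le> t \<or> t < \<tau> (Suc k) \<Longrightarrow> slope k t = 0"
  by (auto simp: slope_def)

text \<open>Ramps with index at least \<open>n\<close> vanish from \<open>\<tau> n\<close> on. Hence
  \<open>u\<close> agrees there with one fixed finite sum, which reduces its continuity and its weak
  derivative to finitely many ramps.\<close>

lemma U_stable: assumes "\<tau> n \<le> t" "n \<le> n'" shows "U n' t = U n t"
  unfolding U_def
proof (rule arg_cong[where f = "\<lambda>s. b 0 + s"], rule sum.mono_neutral_right)
  show "\<forall>i\<in>{..<n'} - {..<n}. ramp i t *\<^sub>R (b (Suc i) - b i) = 0"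
  proof
    fix i assume "i \<in> {..<n'} - {..<n}"
    then have "\<tau> i \<le> t" using \<tau>_antimono[of n i] assms(1) by simp
    then show "ramp i t *\<^sub>R (b (Suc i) - b i) = 0" by (simp add: ramp_eq_0)
  qed
qed (use assms(2) in auto)

lemma V_stable: assumes "\<tau> n \<le> t" "n \<le> n'" shows "V n' t = V n t"
  unfolding V_def
proof (rule sum.mono_neutral_right)
  show "\<forall>i\<in>{..<n'} - {..<n}. slope i t *\<^sub>R (j (b (Suc i)) - j (b i)) = 0"
  proof
    fix i assume "i \<in> {..<n'} - {..<n}"
    then have "\<tau> i \<le> t" using \<tau>_antimono[of n i] assms(1) by simp
    then show "slope i t *\<^sub>R (j (b (Suc i)) - j (b i)) = 0" by (simp add: slope_eq_0)
  qed
qed (use assms(2) in auto)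

lemma u_eq: assumes "0 < t" "\<tau> n \<le> t" shows "u t = U n t"
  unfolding u_def
  using U_stable[OF \<tau>_cut[OF assms(1)], of n] U_stable[OF assms(2), of "cut t"]
  by (cases "n \<le> cut t") auto

lemma v_eq: assumes "0 < t" "\<tau> n \<le> t" shows "v t = V n t"
  unfolding v_def
  using V_stable[OF \<tau>_cut[OF assms(1)], of n] V_stable[OF assms(2), of "cut t"]
  by (cases "n \<le> cut t") auto

lemma dyadic_interval:
  assumes "0 < t" "t < T"
  shows "\<exists>k. \<tau> (Suc k) \<le> t \<and> t < \<tau> k"
proof -
  define n where "n = (LEAST n. \<tau> n \<le> t)"
  have n: "\<tau> n \<le> t" unfolding n_def by (rule LeastI[of "\<lambda>n. \<tau> n \<le> t", OF \<tau>_cut[OF assms(1)]])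
  then obtain k where k: "n = Suc k" using assms(2) \<tau>_0 by (cases n) auto
  have "\<not> \<tau> k \<le> t" using not_less_Least[of k "\<lambda>n. \<tau> n \<le> t"] k unfolding n_def by simp
  then show ?thesis using n k by (intro exI[of _ k]) simp
qed

text \<open>All coarser ramps have the value 1 here, so their increments telescope to
  \<open>b k - b 0\<close>, and only \<open>ramp k\<close> is in transition.\<close>

lemma u_on_dyadic_interval:
  assumes "\<tau> (Suc k) \<le> t" "t < \<tau> k"
  shows "u t = (1 - ramp k t) *\<^sub>R b k + ramp k t *\<^sub>R b (Suc k)"
proof -
  have "0 < t" using assms(1) \<tau>_pos[of "Suc k"] by simp
  have "ramp i t = 1" if "i < k" for i
    by (rule ramp_eq_1) (use assms(2) \<tau>_antimono[of "Suc i" k] that in simp)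
  then have "u t = b 0 + ((\<Sum>i<k. b (Suc i) - b i) + ramp k t *\<^sub>R (b (Suc k) - b k))"
    unfolding u_eq[OF \<open>0 < t\<close> assms(1)] U_def by simp
  also have "(\<Sum>i<k. b (Suc i) - b i) = b k - b 0" by (rule sum_lessThan_telescope)
  finally show ?thesis by (simp add: algebra_simps)
qed

lemma v_on_dyadic_interval:
  assumes "\<tau> (Suc k) \<le> t" "t < \<tau> k"
  shows "v t = (- 1 / \<tau> (Suc k)) *\<^sub>R (j (b (Suc k)) - j (b k))"
proof -
  have "0 < t" using assms(1) \<tau>_pos[of "Suc k"] by simp
  have z: "slope i t = 0" if "i < k" for i
    by (rule slope_eq_0) (use assms(2) \<tau>_antimono[of "Suc i" k] that in simp)
  then show ?thesis
    unfolding v_eq[OF \<open>0 < t\<close> assms(1)] V_def using assms by (simp add: slope_def[of k])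
qed

lemma \<theta>_bounds: "0 < \<theta>" "\<theta> < 1"
  using p l by (simp_all add: \<theta> divide_less_eq)

lemma norm_b_le: "norm (b k) \<le> 2 * N * \<tau> k powr (\<theta> - 1)"
proof -
  have "\<tau> k * norm (b k) \<le> 2 * \<tau> k powr \<theta> * N"
    using b[of k] norm_ge_zero[of "x - j (b k)"] unfolding \<tau>_def by linarith
  also have "\<tau> k powr \<theta> = \<tau> k * \<tau> k powr (\<theta> - 1)"
    using \<tau>_pos[of k] by (simp add: powr_diff)
  finally have "\<tau> k * norm (b k) \<le> \<tau> k * (2 * N * \<tau> k powr (\<theta> - 1))"
    by (simp add: mult_ac)
  then show ?thesis using \<tau>_pos[of k] by simp
qed

lemma norm_a_le: "norm (x - j (b k)) \<le> 2 * N * \<tau> k powr \<theta>"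
proof -
  have "0 \<le> T / 2 ^ k * norm (b k)" using T by simp
  then show ?thesis using b[of k] by (simp add: \<tau>_def mult_ac)
qed

text \<open>A convex combination of two vectors whose scales are at least t/2. As \<theta> - 1 is
  negative, each has norm at most 2 N (t/2)^(\<theta>-1), and 2^(1-\<theta>) \<le> 2 gives the
  constant 4.\<close>

lemma norm_u_le:
  assumes "t \<in> {0<..<T}" shows "norm (u t) \<le> 4 * N * t powr (\<theta> - 1)"
proof -
  obtain k where k: "\<tau> (Suc k) \<le> t" "t < \<tau> k" using dyadic_interval[of t] assms by auto
  have mono: "s powr (\<theta> - 1) \<le> (t / 2) powr (\<theta> - 1)" if "t / 2 \<le> s" for s
    using assms that \<theta>_bounds by (intro powr_mono2') auto
  have h: "t / 2 \<le> \<tau> (Suc k)" "t / 2 \<le> \<tau> k" using k \<tau>_Suc[of k] assms by simp_all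
  have nb: "norm (b i) \<le> 2 * N * (t / 2) powr (\<theta> - 1)" if "t / 2 \<le> \<tau> i" for i
    by (rule order_trans[OF norm_b_le mult_left_mono[OF mono[OF that]]]) (use N in simp)
  have "norm (u t) \<le> norm ((1 - ramp k t) *\<^sub>R b k) + norm (ramp k t *\<^sub>R b (Suc k))"
    unfolding u_on_dyadic_interval[OF k] by (rule norm_triangle_ineq)
  also have "\<dots> \<le> (1 - ramp k t) * (2 * N * (t / 2) powr (\<theta> - 1)) + ramp k t * (2 * N * (t / 2) powr (\<theta> - 1))"
    using ramp_bounds[of k t] nb[OF h(1)] nb[OF h(2)] by (simp add: add_mono mult_left_mono)
  also have "\<dots> = 2 * N * (t / 2) powr (\<theta> - 1)"
    by (simp add: algebra_simps)
  also have "(t / 2) powr (\<theta> - 1) = 2 powr (1 - \<theta>) * t powr (\<theta> - 1)"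
    using assms by (simp add: powr_divide powr_minus_divide[of 2 "\<theta> - 1", symmetric] powr_diff)
  also have "2 * N * (2 powr (1 - \<theta>) * t powr (\<theta> - 1)) \<le> 2 * N * (2 powr 1 * t powr (\<theta> - 1))"
    using N \<theta>_bounds by (intro mult_left_mono mult_right_mono powr_mono) auto
  finally show ?thesis by simp
qed

text \<open>The increment is a difference of two remainders \<open>x - j (b i)\<close>, each at most
  \<open>2 * N * \<tau> k powr \<theta>\<close>. Dividing their sum by
  \<open>\<tau> (Suc k)\<close>, half of \<open>\<tau> k\<close>, gives the constant 8.\<close>

lemma norm_v_le:
  assumes "t \<in> {0<..<T}" shows "norm (v t) \<le> 8 * N * t powr (\<theta> - 1)"
proof -
  obtain k where k: "\<tau> (Suc k) \<le> t" "t < \<tau> k" using dyadic_interval[of t] assms by auto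
  have "norm (v t) = 1 / \<tau> (Suc k) * norm ((x - j (b k)) - (x - j (b (Suc k))))"
    unfolding v_on_dyadic_interval[OF k] using \<tau>_pos[of "Suc k"] by simp
  also have "\<dots> \<le> 1 / \<tau> (Suc k) * (2 * N * \<tau> k powr \<theta> + 2 * N * \<tau> (Suc k) powr \<theta>)"
    using \<tau>_pos[of "Suc k"]
    by (intro mult_left_mono order_trans[OF norm_triangle_ineq4] add_mono norm_a_le) auto
  also have "\<dots> \<le> 1 / \<tau> (Suc k) * (2 * N * \<tau> k powr \<theta> + 2 * N * \<tau> k powr \<theta>)"
    using \<tau>_pos[of "Suc k"] \<tau>_antimono[of k "Suc k"] N \<theta>_bounds
    by (intro mult_left_mono add_left_mono powr_mono2) auto
  also have "\<dots> = 8 * N * (\<tau> k powr \<theta> / \<tau> k)"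
    unfolding \<tau>_Suc[of k] by simp
  also have "\<tau> k powr \<theta> / \<tau> k = \<tau> k powr (\<theta> - 1)"
    using \<tau>_pos[of k] by (simp add: powr_diff)
  also have "8 * N * \<tau> k powr (\<theta> - 1) \<le> 8 * N * t powr (\<theta> - 1)"
    using assms k \<theta>_bounds N by (intro mult_left_mono powr_mono2') auto
  finally show ?thesis .
qed

text \<open>The remainder at t is a convex combination of remainders at scales of at most 2 t. As
  \<theta> is positive, it tends to 0 with t, which identifies the trace.\<close>

lemma norm_ju_le:
  assumes "t \<in> {0<..<T}" shows "norm (x - j (u t)) \<le> 2 * N * (2 * t) powr \<theta>"
proof -
  obtain k where k: "\<tau> (Suc k) \<le> t" "t < \<tau> k" using dyadic_interval[of t] assms by auto
  have na: "norm (x - j (b i)) \<le> 2 * N * (2 * t) powr \<theta>" if "\<tau> i \<le> 2 * t" for i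
  proof (rule order_trans[OF norm_a_le mult_left_mono])
    show "\<tau> i powr \<theta> \<le> (2 * t) powr \<theta>"
      using that \<tau>_pos[of i] \<theta>_bounds by (intro powr_mono2) auto
  qed (use N in simp)
  have h: "\<tau> k \<le> 2 * t" "\<tau> (Suc k) \<le> 2 * t" using k \<tau>_Suc[of k] assms by simp_all
  have "x - j (u t) = (1 - ramp k t) *\<^sub>R (x - j (b k)) + ramp k t *\<^sub>R (x - j (b (Suc k)))"
    unfolding u_on_dyadic_interval[OF k] j.add j.scaleR by (simp add: algebra_simps)
  then have "norm (x - j (u t)) \<le> norm ((1 - ramp k t) *\<^sub>R (x - j (b k))) + norm (ramp k t *\<^sub>R (x - j (b (Suc k))))"
    by (simp only: norm_triangle_ineq)
  also have "\<dots> \<le> (1 - ramp k t) * (2 * N * (2 * t) powr \<theta>) + ramp k t * (2 * N * (2 * t) powr \<theta>)"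
    using ramp_bounds[of k t] na[OF h(1)] na[OF h(2)] by (simp add: add_mono mult_left_mono)
  also have "\<dots> = 2 * N * (2 * t) powr \<theta>"
    by (simp add: algebra_simps)
  finally show ?thesis .
qed

abbreviation M :: "real measure" where "M \<equiv> lebesgue_on {0<..<T}"

lemma continuous_on_ramp: "continuous_on A (ramp k)"
  unfolding ramp_def[abs_def] using \<tau>_pos[of "Suc k"] by (intro continuous_intros) auto

lemma strongly_measurable_u: "strongly_measurable M u"
proof (rule continuous_on_imp_strongly_measurable)
  show "continuous_on {0<..<T} u"
  proof (rule continuous_at_imp_continuous_on, rule ballI)
    fix t assume t: "t \<in> {0<..<T}"
    \<comment> \<open>One more scale puts t strictly above \<open>\<tau> ?n\<close>, so the fixed
      finite sum represents \<open>u\<close> on a neighbourhood of t.\<close>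
    let ?n = "Suc (cut t)"
    have lt: "\<tau> ?n < t"
      using \<tau>_cut[of t] \<tau>_Suc[of "cut t"] \<tau>_pos[of ?n] t by simp
    have "continuous_on {\<tau> ?n<..} (U ?n)"
      unfolding U_def[abs_def] by (intro continuous_intros continuous_on_ramp)
    moreover have "U ?n s = u s" if "s \<in> {\<tau> ?n<..}" for s
      by (rule u_eq[symmetric]) (use that \<tau>_pos[of ?n] in auto)
    ultimately have "continuous_on {\<tau> ?n<..} u"
      using continuous_on_cong by (metis (no_types, lifting))
    then show "isCont u t"
      using lt by (simp add: continuous_on_eq_continuous_at)
  qed
qed

lemma slope_measurable: "slope k \<in> borel_measurable M"
  unfolding slope_def[abs_def]
  by (intro borel_measurable_times borel_measurable_const measurable_restrict_space1 measurable_completion) simp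

text \<open>The finite sums \<open>V n\<close> are simple functions, and at each t > 0 they
  eventually equal \<open>v t\<close>.\<close>

lemma strongly_measurable_v: "strongly_measurable M v"
  unfolding strongly_measurable_def
proof (intro exI conjI allI AE_I2)
  fix n
  have I: "simple_function M (indicat_real {\<tau> (Suc k)..<\<tau> k})" for k
  proof -
    have "simple_function M (indicat_real ({\<tau> (Suc k)..<\<tau> k} \<inter> {0<..<T}))"
      by (intro simple_function_indicator) (auto simp: sets_restrict_space)
    moreover have "simple_function M (indicat_real ({\<tau> (Suc k)..<\<tau> k} \<inter> {0<..<T})) \<longleftrightarrow>
      simple_function M (indicat_real {\<tau> (Suc k)..<\<tau> k})"
      by (rule simple_function_cong) (simp add: indicator_def)
    ultimately show ?thesis by simp
  qed
  show "simple_function M (V n)"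
    unfolding V_def[abs_def] slope_def
    by (intro simple_function_sum simple_function_compose1[OF I,
          where g = "\<lambda>i. (i * (- 1 / \<tau> (Suc _))) *\<^sub>R (j (b (Suc _)) - j (b _))"])
next
  fix t assume "t \<in> space M"
  then have t: "0 < t" by simp
  have "\<forall>\<^sub>F n in sequentially. V n t = v t"
    unfolding v_def
    by (rule eventually_mono[OF eventually_ge_at_top[of "cut t"]]) (rule V_stable[OF \<tau>_cut[OF t]])
  then show "(\<lambda>n. V n t) \<longlonglongrightarrow> v t" by (rule tendsto_eventually)
qed

lemma morrey_u: "morrey_norm p l T u \<le> ennreal (4 * N * l powr (- (1 / p)))"
  using N by (intro morrey_norm_powr_le[OF norm_u_le _ p l \<theta>]) auto

lemma morrey_v: "morrey_norm p l T v \<le> ennreal (8 * N * l powr (- (1 / p)))"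
  using N by (intro morrey_norm_powr_le[OF norm_v_le _ p l \<theta>]) auto

section \<open>The weak derivative of the interpolant\<close>

lemma ramp_has_real_derivative:
  assumes "t \<noteq> \<tau> (Suc k)" "t \<noteq> \<tau> k"
  shows "(ramp k has_real_derivative slope k t) (at t)"
proof -
  consider "t < \<tau> (Suc k)" | "\<tau> (Suc k) < t" "t < \<tau> k" | "\<tau> k < t"
    using assms by linarith
  then show ?thesis
  proof cases
    case 1
    have "((\<lambda>t. 1) has_real_derivative slope k t) (at t)"
      using slope_eq_0[of k t] 1 by simp
    then show ?thesis
      by (rule has_field_derivative_transform_within_open[of _ _ _ "{..<\<tau> (Suc k)}"])
         (use 1 ramp_eq_1 in auto)
  next
    case 2
    have "((\<lambda>t. 2 - t / \<tau> (Suc k)) has_real_derivative - 1 / \<tau> (Suc k)) (at t)"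
      using \<tau>_pos[of "Suc k"] by (auto intro!: derivative_eq_intros)
    then have "((\<lambda>t. 2 - t / \<tau> (Suc k)) has_real_derivative slope k t) (at t)"
      using 2 by (simp add: slope_def)
    then show ?thesis
      by (rule has_field_derivative_transform_within_open[of _ _ _ "{\<tau> (Suc k)<..<\<tau> k}"])
         (use 2 ramp_mid in auto)
  next
    case 3
    have "((\<lambda>t. 0) has_real_derivative slope k t) (at t)"
      using slope_eq_0[of k t] 3 by simp
    then show ?thesis
      by (rule has_field_derivative_transform_within_open[of _ _ _ "{\<tau> k<..}"])
         (use 3 ramp_eq_0 in auto)
  qed
qed

lemma integrable_bounded_product:
  fixes h m :: "real \<Rightarrow> real"
  assumes "continuous_on {0..T} h" "m \<in> borel_measurable M" "\<And>t. \<bar>m t\<bar> \<le> C"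
  shows "integrable M (\<lambda>t. h t * m t)"
proof -
  have "compact (h ` {0..T})" by (intro compact_continuous_image assms(1)) simp
  then obtain B where B: "\<forall>y\<in>h ` {0..T}. norm y \<le> B"
    using compact_imp_bounded bounded_iff by blast
  show ?thesis
  proof (rule finite_measure.integrable_const_bound)
    show "finite_measure M" by (rule finite_measure_Ioo)
    have "h \<in> borel_measurable M"
      by (rule continuous_imp_measurable_on_sets_lebesgue[OF continuous_on_subset[OF assms(1)]]) auto
    then show "(\<lambda>t. h t * m t) \<in> borel_measurable M"
      using assms(2) by (rule borel_measurable_times)
    show "AE t in M. norm (h t * m t) \<le> B * C"
    proof (rule AE_I2)
      fix t assume "t \<in> space M"
      then have "norm (h t) \<le> B" using B by simp
      then show "norm (h t * m t) \<le> B * C"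
        using assms(3)[of t] unfolding norm_mult
        by (intro mult_mono) (auto intro: order_trans[OF norm_ge_zero])
    qed
  qed
qed

text \<open>The fundamental theorem of calculus for \<open>\<phi> t * ramp k t\<close>, with the two
  corners of the ramp as exceptional points; \<open>\<phi>\<close> vanishes at 0 and T. The integral
  of \<open>deriv \<phi>\<close> accounts for the constant summand \<open>b 0\<close>.\<close>

lemma ramp_integration_by_parts:
  assumes \<phi>: "test_function T \<phi>"
  shows "integrable M (\<lambda>t. deriv \<phi> t * ramp k t)" "integrable M (\<lambda>t. \<phi> t * slope k t)"
    "(\<integral>t. \<phi> t * slope k t \<partial>M) = - (\<integral>t. deriv \<phi> t * ramp k t \<partial>M)"
    "integrable M (deriv \<phi>)" "(\<integral>t. deriv \<phi> t \<partial>M) = 0"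
proof -
  have sm: "smooth \<phi>" using \<phi> by (simp add: test_function_def smooth_def)
  obtain \<alpha> \<beta> where "0 < \<alpha>" "\<beta> < T" "\<forall>t. t < \<alpha> \<or> \<beta> < t \<longrightarrow> \<phi> t = 0 \<and> deriv \<phi> t = 0"
    using test_function_support[OF \<phi>] by (elim exE conjE)
  then have ends: "\<phi> 0 = 0" "\<phi> T = 0" by simp_all
  have ramp_meas: "ramp k \<in> borel_measurable M"
    by (rule continuous_imp_measurable_on_sets_lebesgue[OF continuous_on_ramp]) simp
  show i1: "integrable M (\<lambda>t. deriv \<phi> t * ramp k t)"
  proof (rule integrable_bounded_product[OF smooth_imp_continuous_on[OF smooth_deriv[OF sm]] ramp_meas])
    show "\<bar>ramp k t\<bar> \<le> 1" for t using ramp_bounds[of k t] by simp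
  qed
  show i2: "integrable M (\<lambda>t. \<phi> t * slope k t)"
  proof (rule integrable_bounded_product[OF smooth_imp_continuous_on[OF sm] slope_measurable])
    show "\<bar>slope k t\<bar> \<le> 1 / \<tau> (Suc k)" for t
      using \<tau>_pos[of "Suc k"] by (simp add: slope_def indicator_def)
  qed
  show i3: "integrable M (deriv \<phi>)"
    using integrable_bounded_product[OF smooth_imp_continuous_on[OF smooth_deriv[OF sm]], of "\<lambda>_. 1" 1] by simp
  have D: "(\<phi> has_real_derivative deriv \<phi> t) (at t)" for t by (rule smooth_has_real_derivative[OF sm])
  have "((\<lambda>t. deriv \<phi> t * ramp k t + \<phi> t * slope k t) has_integral \<phi> T * ramp k T - \<phi> 0 * ramp k 0) {0..T}"
  proof (rule fundamental_theorem_of_calculus_interior_strong[where S = "{\<tau> (Suc k), \<tau> k}"])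
    show "continuous_on {0..T} (\<lambda>t. \<phi> t * ramp k t)"
      by (intro continuous_on_mult smooth_imp_continuous_on sm continuous_on_ramp)
    fix t assume "t \<in> {0<..<T} - {\<tau> (Suc k), \<tau> k}"
    then have "(ramp k has_real_derivative slope k t) (at t)"
      by (intro ramp_has_real_derivative) auto
    from DERIV_mult[OF D this]
    show "((\<lambda>t. \<phi> t * ramp k t) has_vector_derivative deriv \<phi> t * ramp k t + \<phi> t * slope k t) (at t)"
      by (simp add: has_real_derivative_iff_has_vector_derivative mult.commute)
  qed (use T in auto)
  then have "integral {0..T} (\<lambda>t. deriv \<phi> t * ramp k t + \<phi> t * slope k t) = 0"
    using ends by (simp add: integral_unique)
  moreover have "(\<integral>t. deriv \<phi> t * ramp k t + \<phi> t * slope k t \<partial>M) = integral {0<..<T} (\<lambda>t. deriv \<phi> t * ramp k t + \<phi> t * slope k t)"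
    by (rule lebesgue_integral_eq_integral[OF Bochner_Integration.integrable_add[OF i1 i2]]) simp
  ultimately have "(\<integral>t. deriv \<phi> t * ramp k t + \<phi> t * slope k t \<partial>M) = 0"
    by (simp add: integral_open_interval_real)
  then show "(\<integral>t. \<phi> t * slope k t \<partial>M) = - (\<integral>t. deriv \<phi> t * ramp k t \<partial>M)"
    unfolding Bochner_Integration.integral_add[OF i1 i2] by linarith
  have "(deriv \<phi> has_integral \<phi> T - \<phi> 0) {0..T}"
    by (rule fundamental_theorem_of_calculus)
       (use T D in \<open>auto simp: has_real_derivative_iff_has_vector_derivative[symmetric] intro: has_field_derivative_at_within\<close>)
  then have "integral {0..T} (deriv \<phi>) = 0" using ends by (simp add: integral_unique)
  moreover have "(\<integral>t. deriv \<phi> t \<partial>M) = integral {0<..<T} (deriv \<phi>)"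
    by (rule lebesgue_integral_eq_integral[OF i3]) simp
  ultimately show "(\<integral>t. deriv \<phi> t \<partial>M) = 0" by (simp add: integral_open_interval_real)
qed

text \<open>The support of \<open>\<phi>\<close> stays above some \<alpha> > 0, where
  \<open>u\<close> and \<open>v\<close> are finite sums with \<open>cut \<alpha>\<close> terms. The
  claim becomes scalar integration by parts for each ramp.\<close>

lemma weak_derivative_u: "has_weak_derivative T (\<lambda>t. j (u t)) v"
  unfolding has_weak_derivative_def
proof (intro allI impI)
  fix \<phi> assume \<phi>: "test_function T \<phi>"
  interpret M: complete_measure M by (rule complete_measure_lebesgue_on) simp
  obtain \<alpha> \<beta> where "\<beta> < T" and \<alpha>: "0 < \<alpha>" and supp: "\<forall>t. t < \<alpha> \<or> \<beta> < t \<longrightarrow> \<phi> t = 0 \<and> deriv \<phi> t = 0"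
    using test_function_support[OF \<phi>] by (elim exE conjE)
  let ?n = "cut \<alpha>" and ?d = "\<lambda>k. j (b (Suc k)) - j (b k)"
  note parts = ramp_integration_by_parts[OF \<phi>]
  define z where "z = (\<Sum>k<?n. (\<integral>t. deriv \<phi> t * ramp k t \<partial>M) *\<^sub>R ?d k)"
  have "has_strong_bochner_integral M (\<lambda>t. (\<Sum>k<?n. (deriv \<phi> t * ramp k t) *\<^sub>R ?d k) + 1 *\<^sub>R (deriv \<phi> t *\<^sub>R j (b 0)))
      (z + 1 *\<^sub>R ((\<integral>t. deriv \<phi> t \<partial>M) *\<^sub>R j (b 0)))"
    unfolding z_def
    by (intro M.has_strong_bochner_integral_scaleR_add M.has_strong_bochner_integral_sum
        M.has_strong_bochner_integral_scaleR_const parts)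
  then have 1: "has_strong_bochner_integral M (\<lambda>t. (\<Sum>k<?n. (deriv \<phi> t * ramp k t) *\<^sub>R ?d k) + 1 *\<^sub>R (deriv \<phi> t *\<^sub>R j (b 0))) z"
    by (simp add: parts(5))
  have neg: "(\<Sum>k<?n. (\<integral>t. \<phi> t * slope k t \<partial>M) *\<^sub>R ?d k) = - z"
    unfolding z_def parts(3) by (simp add: sum_negf)
  have 2: "has_strong_bochner_integral M (\<lambda>t. (\<Sum>k<?n. (\<phi> t * slope k t) *\<^sub>R ?d k)) (- z)"
    unfolding neg[symmetric]
    by (rule M.has_strong_bochner_integral_sum) (rule M.has_strong_bochner_integral_scaleR_const[OF parts(2)])
  have cut: "\<tau> ?n \<le> t" if "\<not> t < \<alpha>" for t
    using \<tau>_cut[OF \<alpha>] that by simp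
  show "\<exists>z. has_strong_bochner_integral M (\<lambda>t. deriv \<phi> t *\<^sub>R j (u t)) z \<and>
      has_strong_bochner_integral M (\<lambda>t. \<phi> t *\<^sub>R v t) (- z)"
  proof (intro exI[of _ z] conjI M.has_strong_bochner_integral_cong_AE[OF 1] M.has_strong_bochner_integral_cong_AE[OF 2] AE_I2)
    fix t assume "t \<in> space M"
    then have t: "0 < t" by simp
    show "(\<Sum>k<?n. (deriv \<phi> t * ramp k t) *\<^sub>R ?d k) + 1 *\<^sub>R (deriv \<phi> t *\<^sub>R j (b 0)) = deriv \<phi> t *\<^sub>R j (u t)"
    proof (cases "t < \<alpha>")
      case True
      then show ?thesis using supp by simp
    next
      case False
      have "j (u t) = j (b 0) + (\<Sum>k<?n. ramp k t *\<^sub>R ?d k)"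
        unfolding u_eq[OF t cut[OF False]] U_def by (simp only: j.add j.sum j.scaleR j.diff)
      then show ?thesis by (simp add: scaleR_add_right scaleR_sum_right)
    qed
    show "(\<Sum>k<?n. (\<phi> t * slope k t) *\<^sub>R ?d k) = \<phi> t *\<^sub>R v t"
    proof (cases "t < \<alpha>")
      case True
      then show ?thesis using supp by simp
    next
      case False
      show ?thesis
        unfolding v_eq[OF t cut[OF False]] V_def by (simp add: scaleR_sum_right)
    qed
  qed
qed

lemma u_in_evolution_space: "u \<in> evolution_space p l T j"
proof -
  have "morrey_norm p l T u < \<infinity>" "morrey_norm p l T v < \<infinity>"
    using morrey_u morrey_v by (auto intro: order.strict_trans1)
  then show ?thesis
    using strongly_measurable_u strongly_measurable_v weak_derivative_u
    by (auto simp: evolution_space_def morrey_space_def)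
qed

text \<open>Along a sequence tending to 0 on which the representative equals \<open>j u\<close>, its
  values tend to \<open>x\<close>, and continuity gives the value at 0.\<close>

lemma trace0_u: "trace0 T j u = x"
proof -
  have fin: "morrey_norm p l T v < \<infinity>" using morrey_v by (auto intro: order.strict_trans1)
  obtain w where w: "continuous_on {0..T} w" "AE t in M. w t = j (u t)" "trace0 T j u = w 0"
    using trace_representative[OF j p T u_in_evolution_space weak_derivative_u fin] by blast
  obtain t where t_lim: "t \<longlonglongrightarrow> 0" and t_in: "\<And>n. t n \<in> {0<..<T}" and t: "\<And>n. w (t n) = j (u (t n))"
    using AE_Ioo_sequence[OF w(2) T] by blast
  have "(\<lambda>n. w (t n)) \<longlonglongrightarrow> w 0"
    by (rule continuous_on_tendsto_compose[OF w(1) t_lim]) (use T t_in in \<open>auto simp: less_imp_le\<close>)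
  then have L: "(\<lambda>n. x - w (t n)) \<longlonglongrightarrow> x - w 0"
    by (rule tendsto_diff[OF tendsto_const])
  have "(\<lambda>n. 2 * N * (2 * t n) powr \<theta>) \<longlonglongrightarrow> 2 * N * (2 * 0) powr \<theta>"
    using \<theta>_bounds t_in by (intro tendsto_mult tendsto_const tendsto_powr2 t_lim) (auto simp: less_imp_le)
  then have R: "(\<lambda>n. 2 * N * (2 * t n) powr \<theta>) \<longlonglongrightarrow> 0" by simp
  have "norm (x - w (t n)) \<le> 2 * N * (2 * t n) powr \<theta>" for n
    unfolding t by (rule norm_ju_le[OF t_in])
  then have "(\<lambda>n. x - w (t n)) \<longlonglongrightarrow> 0"
    by (rule Lim_null_comparison[OF always_eventually[OF allI] R])
  with L have "x - w 0 = 0" by (rule LIMSEQ_unique)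
  then show ?thesis using w(3) by simp
qed

text \<open>The constants 4 for \<open>u\<close> and 8 for \<open>v\<close> add up to the 12 in
  \<open>extension_constant\<close>.\<close>

lemma morrey_sum_le:
  "morrey_norm p l T u + morrey_norm p l T v \<le> ennreal (extension_constant p l) * ennreal N"
proof -
  have "morrey_norm p l T u + morrey_norm p l T v
      \<le> ennreal (4 * N * l powr (- (1 / p))) + ennreal (8 * N * l powr (- (1 / p)))"
    by (intro add_mono morrey_u morrey_v)
  also have "\<dots> = ennreal (4 * N * l powr (- (1 / p)) + 8 * N * l powr (- (1 / p)))"
    using N by (intro ennreal_plus[symmetric]) auto
  also have "4 * N * l powr (- (1 / p)) + 8 * N * l powr (- (1 / p)) = extension_constant p l * N"
    by (simp add: extension_constant_def algebra_simps)
  also have "ennreal (extension_constant p l * N) = ennreal (extension_constant p l) * ennreal N"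
    using N by (intro ennreal_mult) (simp_all add: extension_constant_def)
  finally show ?thesis .
qed

end

section \<open>Near-optimal decompositions and the two inclusions\<close>

text \<open>The infimum in the K-functional need not be attained; the factor 2 leaves room as soon
  as the bound is positive. For \<open>x = 0\<close> both parts are 0; for other \<open>x\<close>
  boundedness of the embedding forces \<open>0 < N\<close>.\<close>

lemma near_optimal_decomposition:
  fixes j :: "'b::banach \<Rightarrow> 'a::banach"
  assumes j: "bounded_linear j" and x: "interpolation_norm j \<theta> x \<le> ennreal N" "0 \<le> N" and r: "0 < r"
  shows "\<exists>b. norm (x - j b) + r * norm b \<le> 2 * r powr \<theta> * N"
proof (cases "x = 0")
  case True
  interpret bounded_linear j by (rule j)
  show ?thesis using True x(2) by (intro exI[of _ 0]) (simp add: zero)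
next
  case False
  have K: "K_functional j s x \<le> s powr \<theta> * N" if "0 < s" for s
  proof -
    have "ennreal (s powr (- \<theta>) * K_functional j s x) \<le> interpolation_norm j \<theta> x"
      unfolding interpolation_norm_def by (rule SUP_upper) (use that in simp)
    then have "s powr (- \<theta>) * K_functional j s x \<le> N"
      using x order_trans by fastforce
    then have "s powr \<theta> * (s powr (- \<theta>) * K_functional j s x) \<le> s powr \<theta> * N"
      by (intro mult_left_mono) auto
    moreover have "s powr \<theta> * (s powr (- \<theta>) * K_functional j s x) = K_functional j s x"
      unfolding mult.assoc[symmetric] powr_add[symmetric] using that by simp
    ultimately show ?thesis by simp
  qed
  have decomp: "\<exists>b. norm (x - j b) + s * norm b < y" if "K_functional j s x < y" "0 < s" for s y
  proof -
    have "x = x + j 0" using j by (simp add: bounded_linear.linear linear_0)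
    then have "{norm x0 + s * norm x1 |x0 x1. x = x0 + j x1} \<noteq> {}" by blast
    from cInf_lessD[OF this] that obtain x0 x1 where "x = x0 + j x1" "norm x0 + s * norm x1 < y"
      unfolding K_functional_def by blast
    then show ?thesis by (intro exI[of _ x1]) simp
  qed
  have "0 < N"
  proof (rule ccontr)
    assume "\<not> 0 < N"
    then have "K_functional j 1 x \<le> 0" using K[of 1] x(2) by simp
    \<comment> \<open>With \<open>N = 0\<close> there would be decompositions of arbitrarily small
      size at r = 1, whereas each has size at least \<open>norm x / (1 + onorm j)\<close>.\<close>
    define e where "e = norm x / (1 + onorm j)"
    have oj: "0 \<le> onorm j" by (rule onorm_pos_le[OF j])
    have "0 < e" using False oj by (simp add: e_def)
    with \<open>K_functional j 1 x \<le> 0\<close> have "K_functional j 1 x < e" by simp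
    from decomp[OF this] obtain b where b: "norm (x - j b) + norm b < e" by auto
    have "norm x \<le> norm (x - j b) + norm (j b)"
      using norm_triangle_ineq[of "x - j b" "j b"] by simp
    also have "\<dots> \<le> norm (x - j b) + onorm j * norm b"
      by (intro add_left_mono onorm[OF j])
    also have "\<dots> \<le> (1 + onorm j) * (norm (x - j b) + norm b)"
      using oj by (simp add: algebra_simps)
    also have "\<dots> < (1 + onorm j) * e"
      using b oj by (intro mult_strict_left_mono) auto
    also have "\<dots> = norm x" using oj by (simp add: e_def)
    finally show False by simp
  qed
  then have "r powr \<theta> * N < 2 * r powr \<theta> * N" using r by simp
  then have "K_functional j r x < 2 * r powr \<theta> * N" by (rule le_less_trans[OF K[OF r]])
  from decomp[OF this r] show ?thesis using less_imp_le by blast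
qed

theorem theorem3p3:
  fixes j :: "'b::banach \<Rightarrow> 'a::banach"
    and p lam T \<theta> :: real
  assumes embedding: "bounded_linear j" "inj j"
    and p: "1 < p"
    and lambda: "0 < lam" "lam < 1"
    and T: "0 < T"
    and theta: "\<theta> = 1 - (1 - lam) / p"
  shows
    "trace0 T j ` evolution_space p lam T j = interpolation_space j \<theta> \<and>
     (\<exists>B::real. \<forall>u \<in> evolution_space p lam T j. \<forall>v. has_weak_derivative T (\<lambda>t. j (u t)) v \<longrightarrow>
        interpolation_norm j \<theta> (trace0 T j u)
          \<le> ennreal B * (morrey_norm p lam T u + morrey_norm p lam T v)) \<and>
     (\<forall>x \<in> interpolation_space j \<theta>. \<exists>u \<in> evolution_space p lam T j. \<exists>v.
        has_weak_derivative T (\<lambda>t. j (u t)) v \<and> trace0 T j u = x \<and>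
        morrey_norm p lam T u + morrey_norm p lam T v
          \<le> ennreal (extension_constant p lam) * interpolation_norm j \<theta> x)"
proof -
  note bound = trace_interpolation_norm_le[OF embedding(1) p T lambda theta]
  have extension: "\<exists>u \<in> evolution_space p lam T j. \<exists>v.
        has_weak_derivative T (\<lambda>t. j (u t)) v \<and> trace0 T j u = x \<and>
        morrey_norm p lam T u + morrey_norm p lam T v
          \<le> ennreal (extension_constant p lam) * interpolation_norm j \<theta> x"
    if "x \<in> interpolation_space j \<theta>" for x
  proof -
    define N where "N = enn2real (interpolation_norm j \<theta> x)"
    have N_eq: "interpolation_norm j \<theta> x = ennreal N" "0 \<le> N"
      using that by (simp_all add: N_def interpolation_space_def)
    have "\<forall>k::nat. \<exists>b. norm (x - j b) + T / 2 ^ k * norm b \<le> 2 * (T / 2 ^ k) powr \<theta> * N"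
      using T by (intro allI near_optimal_decomposition[OF embedding(1) eq_refl[OF N_eq(1)] N_eq(2)]) simp
    then obtain b where b: "\<forall>k::nat. norm (x - j (b k)) + T / 2 ^ k * norm (b k) \<le> 2 * (T / 2 ^ k) powr \<theta> * N"
      using choice[of "\<lambda>k b. norm (x - j b) + T / 2 ^ k * norm b \<le> 2 * (T / 2 ^ k) powr \<theta> * N"] by blast
    interpret dyadic_extension j p lam T \<theta> N x b
      by (rule dyadic_extension.intro[OF embedding(1) p lambda T theta N_eq(2)]) (use b in blast)
    show ?thesis
      unfolding N_eq(1)
      by (intro bexI[of _ u] exI[of _ v] conjI weak_derivative_u trace0_u morrey_sum_le u_in_evolution_space)
  qed
  \<comment> \<open>Membership supplies one weak derivative of finite Morrey norm, which makes the
    right side of the trace bound finite.\<close>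
  have "trace0 T j u \<in> interpolation_space j \<theta>" if u: "u \<in> evolution_space p lam T j" for u
  proof -
    obtain v where v: "v \<in> morrey_space p lam T" "has_weak_derivative T (\<lambda>t. j (u t)) v"
      using u by (auto simp: evolution_space_def)
    have "morrey_norm p lam T u + morrey_norm p lam T v < \<infinity>"
      using u v(1) by (simp add: evolution_space_def morrey_space_def)
    then have "ennreal (2 + 2 * onorm j / T) * (morrey_norm p lam T u + morrey_norm p lam T v) < \<infinity>"
      by (simp add: ennreal_mult_less_top)
    then show ?thesis
      using bound[OF u v(2)] by (simp add: interpolation_space_def order.strict_trans1)
  qed
  with extension bound show ?thesis by blast
qed

end
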